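(* Let $n\ge 3$, $p\ge 1$, and let $M^n$ be a weakly Einstein submanifold of the Euclidean space $\mathbb{R}^{n+p}$ satisfying Chen's equality. Let $a,b$ denote the entries of the shape operator $A_1$ in the normal form of the shape operators described in the context. If $p=1$, then the hypersurface $M^n$ is flat. If $p\ge 2$, then either (i) $M^n$ is flat, or (ii) $a=b\neq 0$ and the Ricci curvature of $M^n$ is non-negative. If $n=4$, then in this case additionally $a=b=\pm\frac12$ and the Ricci operator has rank $2$.
   Context: Conventions: $R(X,Y)=[\nabla_X,\nabla_Y]-\nabla_{[X,Y]}$ and $R(X,Y,Z,W)=\langle R(X,Y)Z,W\rangle$. The Ricci tensor is $\rho(X,Y)=\mathrm{Tr}(Z\mapsto R(Z,X)Y)$, and $\tau=\mathrm{Tr}_g\rho$ is the scalar curvature. The sectional curvature of $\pi=X\wedge Y$ is $K(\pi)=R(X,Y,Y,X)/(\langle X,X\rangle\langle Y,Y\rangle-\langle X,Y\rangle^2)$, and $(\inf K)(x)=\inf\{K(\pi):\pi \text{ a plane in } T_xM\}$. An $n$-dimensional Riemannian manifold $(M,g)$ is weakly Einstein if $\check R(X,Y)=\frac{\|R\|^2}{n}g(X,Y)$ for all vector fields $X,Y$, where $\check R(X,Y)=\sum_{i,j,k=1}^n R(X,e_i,e_j,e_k)R(Y,e_i,e_j,e_k)$ for a local orthonormal frame $\{e_i\}$. Submanifolds are immersed and carry the induced metric. $h$ is the second fundamental form, $H=\frac1n\mathrm{Tr}\,h$ is the mean curvature vector, and the shape operator $A_\xi$ in the normal direction $\xi$ is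 given by $\langle A_\xi X,Y\rangle=\langle h(X,Y),\xi\rangle$. A submanifold $M^n$ of a space form of dimension $n+p$ and constant curvature $c$ always satisfies Chen's inequality $\frac12\tau-\inf K\le \frac{n^2(n-2)}{2(n-1)}\|H\|^2+(n+1)(n-2)\frac c2$. It is said to satisfy Chen's equality if equality holds at every point (for $\mathbb{R}^{n+p}$, $c=0$). Normal form: equality holds at a point $x$ if and only if, with respect to suitable orthonormal frames $\{e_i\}_{i=1}^n$ of the tangent space and $\{\xi_t\}_{t=1}^p$ of the normal space, the shape operators $A_t:=A_{\xi_t}$ are as follows. $A_1=\mathrm{diag}(a,b,\mu,\dots,\mu)$ with $\mu=a+b$. For $t\ge 2$, $A_t$ has upper-left $2\times2$ block $\begin{pmatrix} c_t & d_t\\ d_t & -c_t\end{pmatrix}$ and all other entries zero. The letters $a,b$ refer to this normal form. *)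

theory Defs
  imports "HOL-Analysis.Analysis"
begin

section \<open>Smooth maps, manifolds and immersions\<close>

text \<open>The set S is always an open subset of a Euclidean space below.\<close>

primrec Ck_on :: "nat \<Rightarrow> 'a::euclidean_space set \<Rightarrow> ('a \<Rightarrow> 'b::euclidean_space) \<Rightarrow> bool" where
  "Ck_on 0 S f \<longleftrightarrow> continuous_on S f"
| "Ck_on (Suc k) S f \<longleftrightarrow>
     (\<forall>x\<in>S. f differentiable (at x)) \<and> (\<forall>v. Ck_on k S (\<lambda>x. frechet_derivative f (at x) v))"

definition smooth_map_on :: "'a::euclidean_space set \<Rightarrow> ('a \<Rightarrow> 'b::euclidean_space) \<Rightarrow> bool" where
  "smooth_map_on S f \<longleftrightarrow> (\<forall>k. Ck_on k S f)"

text \<open>A chart is a pair of a domain and a coordinate map with values in the model space 'a.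
  Only the values of the coordinate map on its domain matter.\<close>

type_synonym ('m, 'a) chart = "'m set \<times> ('m \<Rightarrow> 'a)"

definition smooth_atlas :: "'m topology \<Rightarrow> ('m, 'a::euclidean_space) chart set \<Rightarrow> bool" where
  "smooth_atlas X \<A> \<longleftrightarrow>
     Hausdorff_space X \<and> second_countable X \<and>
     (\<Union>(U, \<phi>)\<in>\<A>. U) = topspace X \<and>
     (\<forall>(U, \<phi>)\<in>\<A>. openin X U \<and> open (\<phi> ` U) \<and>
        homeomorphic_map (subtopology X U) (top_of_set (\<phi> ` U)) \<phi>) \<and>
     (\<forall>(U, \<phi>)\<in>\<A>. \<forall>(V, \<psi>)\<in>\<A>. smooth_map_on (\<phi> ` (U \<inter> V)) (\<psi> \<circ> inv_into U \<phi>))"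

definition in_chart :: "('m \<Rightarrow> 'b) \<Rightarrow> ('m, 'a) chart \<Rightarrow> 'a \<Rightarrow> 'b" where
  "in_chart F = (\<lambda>(U, \<phi>). F \<circ> inv_into U \<phi>)"

definition immersed_submanifold ::
  "'m topology \<Rightarrow> ('m, 'a::euclidean_space) chart set \<Rightarrow> ('m \<Rightarrow> 'b::euclidean_space) \<Rightarrow> bool" where
  "immersed_submanifold X \<A> F \<longleftrightarrow>
     smooth_atlas X \<A> \<and>
     (\<forall>(U, \<phi>)\<in>\<A>. smooth_map_on (\<phi> ` U) (in_chart F (U, \<phi>)) \<and>
        (\<forall>y\<in>\<phi> ` U. inj (frechet_derivative (in_chart F (U, \<phi>)) (at y))))"

text \<open>All geometric notions below are chart independent, and are therefore expressed for the local
  parametrization f given by a chart, at a point y of the coordinate domain. Tangent vectors at the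
  point are represented by their coordinate vectors in 'a. The following quantifies
  over all points of the manifold (and all charts of the atlas around the point).\<close>

definition everywhere ::
  "('m, 'a) chart set \<Rightarrow> ('m \<Rightarrow> 'b) \<Rightarrow> (('a \<Rightarrow> 'b) \<Rightarrow> 'a \<Rightarrow> bool) \<Rightarrow> bool" where
  "everywhere \<A> F P \<longleftrightarrow> (\<forall>(U, \<phi>)\<in>\<A>. \<forall>x\<in>U. P (in_chart F (U, \<phi>)) (\<phi> x))"


section \<open>Linear algebra with respect to an inner product\<close>

text \<open>In this section G is an inner product on 'a.\<close>

definition metric_dual :: "('a \<Rightarrow> 'a \<Rightarrow> real) \<Rightarrow> ('a \<Rightarrow> real) \<Rightarrow> 'a" where
  "metric_dual G \<alpha> = (THE z. \<forall>w. G z w = \<alpha> w)"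

definition orthonormal_frame :: "('a::euclidean_space \<Rightarrow> 'a \<Rightarrow> real) \<Rightarrow> (nat \<Rightarrow> 'a) \<Rightarrow> bool" where
  "orthonormal_frame G e \<longleftrightarrow>
     (\<forall>i\<in>{1..DIM('a)}. \<forall>j\<in>{1..DIM('a)}. G (e i) (e j) = (if i = j then 1 else 0))"

text \<open>For a bilinear B the choice of the orthonormal frame is immaterial.\<close>

definition metric_trace ::
  "('a::euclidean_space \<Rightarrow> 'a \<Rightarrow> real) \<Rightarrow> ('a \<Rightarrow> 'a \<Rightarrow> 'c::real_vector) \<Rightarrow> 'c" where
  "metric_trace G B = (let e = (SOME e. orthonormal_frame G e) in \<Sum>i = 1..DIM('a). B (e i) (e i))"

definition linear_trace :: "('a::euclidean_space \<Rightarrow> 'a) \<Rightarrow> real" where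
  "linear_trace L = (\<Sum>b\<in>Basis. L b \<bullet> b)"


section \<open>Riemannian geometry in coordinates\<close>

text \<open>A Riemannian metric is a family g of inner products g y on 'a, and a vector field is a
  function from 'a to 'a.\<close>

type_synonym 'a metric = "'a \<Rightarrow> 'a \<Rightarrow> 'a \<Rightarrow> real"

text \<open>Koszul formula for the coordinate (constant) vector fields u and v.\<close>

definition christoffel :: "'a::euclidean_space metric \<Rightarrow> 'a \<Rightarrow> 'a \<Rightarrow> 'a \<Rightarrow> 'a" where
  "christoffel g y u v = metric_dual (g y) (\<lambda>w.
     (frechet_derivative (\<lambda>z. g z v w) (at y) u
      + frechet_derivative (\<lambda>z. g z u w) (at y) v
      - frechet_derivative (\<lambda>z. g z u v) (at y) w) / 2)"

definition levi_civita ::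
  "'a::euclidean_space metric \<Rightarrow> ('a \<Rightarrow> 'a) \<Rightarrow> ('a \<Rightarrow> 'a) \<Rightarrow> 'a \<Rightarrow> 'a" where
  "levi_civita g V W = (\<lambda>y. frechet_derivative W (at y) (V y) + christoffel g y (V y) (W y))"

definition lie_bracket :: "('a::euclidean_space \<Rightarrow> 'a) \<Rightarrow> ('a \<Rightarrow> 'a) \<Rightarrow> 'a \<Rightarrow> 'a" where
  "lie_bracket V W = (\<lambda>y. frechet_derivative W (at y) (V y) - frechet_derivative V (at y) (W y))"

definition curvature_field ::
  "'a::euclidean_space metric \<Rightarrow> ('a \<Rightarrow> 'a) \<Rightarrow> ('a \<Rightarrow> 'a) \<Rightarrow> ('a \<Rightarrow> 'a) \<Rightarrow> 'a \<Rightarrow> 'a" where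
  "curvature_field g V W Z = (\<lambda>y.
     levi_civita g V (levi_civita g W Z) y - levi_civita g W (levi_civita g V Z) y
     - levi_civita g (lie_bracket V W) Z y)"

text \<open>The curvature is tensorial, so tangent vectors may be extended to constant fields.\<close>

definition curvature_op :: "'a::euclidean_space metric \<Rightarrow> 'a \<Rightarrow> 'a \<Rightarrow> 'a \<Rightarrow> 'a \<Rightarrow> 'a" where
  "curvature_op g y u v w = curvature_field g (\<lambda>_. u) (\<lambda>_. v) (\<lambda>_. w) y"

definition riemann :: "'a::euclidean_space metric \<Rightarrow> 'a \<Rightarrow> 'a \<Rightarrow> 'a \<Rightarrow> 'a \<Rightarrow> 'a \<Rightarrow> real" where
  "riemann g y u v w z = g y (curvature_op g y u v w) z"

definition ricci :: "'a::euclidean_space metric \<Rightarrow> 'a \<Rightarrow> 'a \<Rightarrow> 'a \<Rightarrow> real" where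
  "ricci g y u v = linear_trace (\<lambda>z. curvature_op g y z u v)"

definition ricci_operator :: "'a::euclidean_space metric \<Rightarrow> 'a \<Rightarrow> 'a \<Rightarrow> 'a" where
  "ricci_operator g y u = metric_dual (g y) (ricci g y u)"

definition scalar_curvature :: "'a::euclidean_space metric \<Rightarrow> 'a \<Rightarrow> real" where
  "scalar_curvature g y = metric_trace (g y) (ricci g y)"

definition sectional :: "'a::euclidean_space metric \<Rightarrow> 'a \<Rightarrow> 'a \<Rightarrow> 'a \<Rightarrow> real" where
  "sectional g y u v = riemann g y u v v u / (g y u u * g y v v - (g y u v)\<^sup>2)"

definition inf_sectional :: "'a::euclidean_space metric \<Rightarrow> 'a \<Rightarrow> real" where
  "inf_sectional g y = Inf {sectional g y u v | u v. u \<noteq> v \<and> independent {u, v}}"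

definition flat_at :: "'a::euclidean_space metric \<Rightarrow> 'a \<Rightarrow> bool" where
  "flat_at g y \<longleftrightarrow> (\<forall>u v w. curvature_op g y u v w = 0)"

definition nonneg_ricci_at :: "'a::euclidean_space metric \<Rightarrow> 'a \<Rightarrow> bool" where
  "nonneg_ricci_at g y \<longleftrightarrow> (\<forall>u. ricci g y u u \<ge> 0)"

definition R_check ::
  "'a::euclidean_space metric \<Rightarrow> 'a \<Rightarrow> (nat \<Rightarrow> 'a) \<Rightarrow> 'a \<Rightarrow> 'a \<Rightarrow> real" where
  "R_check g y e u v = (\<Sum>i = 1..DIM('a). \<Sum>j = 1..DIM('a). \<Sum>k = 1..DIM('a).
     riemann g y u (e i) (e j) (e k) * riemann g y v (e i) (e j) (e k))"

definition R_norm_sq :: "'a::euclidean_space metric \<Rightarrow> 'a \<Rightarrow> (nat \<Rightarrow> 'a) \<Rightarrow> real" where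
  "R_norm_sq g y e =
     (\<Sum>i = 1..DIM('a). \<Sum>j = 1..DIM('a). \<Sum>k = 1..DIM('a). \<Sum>l = 1..DIM('a).
        (riemann g y (e i) (e j) (e k) (e l))\<^sup>2)"

definition weakly_einstein_at :: "'a::euclidean_space metric \<Rightarrow> 'a \<Rightarrow> bool" where
  "weakly_einstein_at g y \<longleftrightarrow>
     (\<forall>e. orthonormal_frame (g y) e \<longrightarrow>
        (\<forall>u v. R_check g y e u v = R_norm_sq g y e / DIM('a) * g y u v))"


section \<open>Submanifold geometry of a local parametrization\<close>

definition induced_metric :: "('a::euclidean_space \<Rightarrow> 'b::euclidean_space) \<Rightarrow> 'a metric" where
  "induced_metric f y u v = frechet_derivative f (at y) u \<bullet> frechet_derivative f (at y) v"

text \<open>Gauss formula: the ambient derivative minus the Levi-Civita derivative of the induced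
  metric, for the coordinate fields u and v.\<close>

definition second_fundamental_form ::
  "('a::euclidean_space \<Rightarrow> 'b::euclidean_space) \<Rightarrow> 'a \<Rightarrow> 'a \<Rightarrow> 'a \<Rightarrow> 'b" where
  "second_fundamental_form f y u v =
     frechet_derivative (\<lambda>z. frechet_derivative f (at z) v) (at y) u
     - frechet_derivative f (at y) (levi_civita (induced_metric f) (\<lambda>_. u) (\<lambda>_. v) y)"

definition mean_curvature_vector ::
  "('a::euclidean_space \<Rightarrow> 'b::euclidean_space) \<Rightarrow> 'a \<Rightarrow> 'b" where
  "mean_curvature_vector f y =
     (1 / DIM('a)) *\<^sub>R metric_trace (induced_metric f y) (second_fundamental_form f y)"

definition shape_operator ::
  "('a::euclidean_space \<Rightarrow> 'b::euclidean_space) \<Rightarrow> 'a \<Rightarrow> 'b \<Rightarrow> 'a \<Rightarrow> 'a" where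
  "shape_operator f y \<xi> u =
     metric_dual (induced_metric f y) (\<lambda>v. second_fundamental_form f y u v \<bullet> \<xi>)"

definition orthonormal_normal_frame ::
  "('a::euclidean_space \<Rightarrow> 'b::euclidean_space) \<Rightarrow> 'a \<Rightarrow> (nat \<Rightarrow> 'b) \<Rightarrow> bool" where
  "orthonormal_normal_frame f y \<xi> \<longleftrightarrow>
     (\<forall>s\<in>{1..DIM('b) - DIM('a)}.
        (\<forall>u. \<xi> s \<bullet> frechet_derivative f (at y) u = 0) \<and>
        (\<forall>t\<in>{1..DIM('b) - DIM('a)}. \<xi> s \<bullet> \<xi> t = (if s = t then 1 else 0)))"

definition chen_equality_at ::
  "('a::euclidean_space \<Rightarrow> 'b::euclidean_space) \<Rightarrow> 'a \<Rightarrow> bool" where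
  "chen_equality_at f y \<longleftrightarrow>
     scalar_curvature (induced_metric f) y / 2 - inf_sectional (induced_metric f) y =
     (real DIM('a))\<^sup>2 * (real DIM('a) - 2) / (2 * (real DIM('a) - 1))
       * (norm (mean_curvature_vector f y))\<^sup>2"

text \<open>The frames \<open>e\<close> (tangent) and \<open>\<xi>\<close> (normal) put all shape operators at the point into the normal
  form characterizing Chen's equality, with entries \<open>a\<close>, \<open>b\<close> of the first one.\<close>

definition chen_normal_form_at ::
  "('a::euclidean_space \<Rightarrow> 'b::euclidean_space) \<Rightarrow> 'a \<Rightarrow> (nat \<Rightarrow> 'a) \<Rightarrow> (nat \<Rightarrow> 'b) \<Rightarrow> real \<Rightarrow> real \<Rightarrow> bool"
where
  "chen_normal_form_at f y e \<xi> a b \<longleftrightarrow>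
     orthonormal_frame (induced_metric f y) e \<and> orthonormal_normal_frame f y \<xi> \<and>
     shape_operator f y (\<xi> 1) (e 1) = a *\<^sub>R e 1 \<and>
     shape_operator f y (\<xi> 1) (e 2) = b *\<^sub>R e 2 \<and>
     (\<forall>i\<in>{3..DIM('a)}. shape_operator f y (\<xi> 1) (e i) = (a + b) *\<^sub>R e i) \<and>
     (\<forall>t\<in>{2..DIM('b) - DIM('a)}.
        (\<exists>c d. shape_operator f y (\<xi> t) (e 1) = c *\<^sub>R e 1 + d *\<^sub>R e 2 \<and>
               shape_operator f y (\<xi> t) (e 2) = d *\<^sub>R e 1 - c *\<^sub>R e 2) \<and>
        (\<forall>i\<in>{3..DIM('a)}. shape_operator f y (\<xi> t) (e i) = 0))"


section \<open>Properties of an immersed submanifold\<close>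

definition flat :: "('m, 'a::euclidean_space) chart set \<Rightarrow> ('m \<Rightarrow> 'b::euclidean_space) \<Rightarrow> bool" where
  "flat \<A> F \<longleftrightarrow> everywhere \<A> F (\<lambda>f. flat_at (induced_metric f))"

definition weakly_einstein ::
  "('m, 'a::euclidean_space) chart set \<Rightarrow> ('m \<Rightarrow> 'b::euclidean_space) \<Rightarrow> bool" where
  "weakly_einstein \<A> F \<longleftrightarrow> everywhere \<A> F (\<lambda>f. weakly_einstein_at (induced_metric f))"

definition nonneg_ricci ::
  "('m, 'a::euclidean_space) chart set \<Rightarrow> ('m \<Rightarrow> 'b::euclidean_space) \<Rightarrow> bool" where
  "nonneg_ricci \<A> F \<longleftrightarrow> everywhere \<A> F (\<lambda>f. nonneg_ricci_at (induced_metric f))"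

definition chen_equality ::
  "('m, 'a::euclidean_space) chart set \<Rightarrow> ('m \<Rightarrow> 'b::euclidean_space) \<Rightarrow> bool" where
  "chen_equality \<A> F \<longleftrightarrow> everywhere \<A> F chen_equality_at"

definition ricci_operator_rank ::
  "('m, 'a::euclidean_space) chart set \<Rightarrow> ('m \<Rightarrow> 'b::euclidean_space) \<Rightarrow> nat \<Rightarrow> bool" where
  "ricci_operator_rank \<A> F r \<longleftrightarrow>
     everywhere \<A> F (\<lambda>f y. dim (range (ricci_operator (induced_metric f) y)) = r)"

text \<open>The frames of a normal form are not unique. The condition P on the entries a, b is required
  of every normal form at every point, and a normal form is required to exist.\<close>

definition normal_form_entries ::
  "('m, 'a::euclidean_space) chart set \<Rightarrow> ('m \<Rightarrow> 'b::euclidean_space) \<Rightarrow> (real \<Rightarrow> real \<Rightarrow> bool) \<Rightarrow> bool" where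
  "normal_form_entries \<A> F P \<longleftrightarrow> everywhere \<A> F (\<lambda>f y.
     (\<exists>e \<xi> a b. chen_normal_form_at f y e \<xi> a b) \<and>
     (\<forall>e \<xi> a b. chen_normal_form_at f y e \<xi> a b \<longrightarrow> P a b))"

end

(* The submanifold is always flat, so the alternative (ii) never occurs. Chen's equality forces, at each
   point, h = eta g on the orthogonal complement D of a plane E, and h = eta g / 2 + h0 on E with h0 trace-free,
   eta being n/(n-1) times the mean curvature vector. The weakly Einstein condition then gives h = 0 if eta = 0,
   and otherwise h0 orthogonal to eta with |h0|^2 a fixed multiple of |eta|^2. Where eta does not vanish, E and D
   are the eigendistributions of the shape operator of eta, and the symmetry of the covariant derivative of h
   forces eta to be parallel in the normal bundle. Hence |eta| is locally constant, the derivatives of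
   eta + |eta|^2 f and eta + |eta|^2 f / 2 are multiples of the projections to E and to D, and f is locally an
   extrinsic product, which contradicts the mixed sectional curvature |eta|^2 / 2. *)

theory Submission
  imports Defs
begin

section \<open>Calculus of smooth maps\<close>

text \<open>The plane E and the entries of h0 are found point by point and need not vary smoothly,
  so no eigenframe may be differentiated. Only identities polynomial in the metric, h and eta are
  differentiated, on fields projected by the shape operator of eta; a frame is inserted afterwards.
  Let n be the dimension, s = sqrt (3 n - 8), and let p, q, -p be the entries of h0 in an
  orthonormal frame of E. Comparing the weakly Einstein condition on E and on D gives p . p + q . q
  = (1 + 2 s) |eta|^2 / 4. It is s > 0 that makes the Codazzi relations nondegenerate: along E this
  sum must differ from |eta|^2 / 4, along D both s and 1 + 2 s must be nonzero. The factors of the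
  product are never constructed. The derivatives of the two maps in the overview are orthogonal to
  each other, and differentiating this twice makes the second derivative of the first map at (e1,
  e1), with e1 a unit vector in E, orthogonal to that of the second at (u, u), with u a unit vector
  in D. The tangential parts do not contribute, while the normal parts have inner product -|eta|^6 /
  8.\<close>

definition dd :: "'a::euclidean_space \<Rightarrow> ('a \<Rightarrow> 'b::euclidean_space) \<Rightarrow> 'a \<Rightarrow> 'b" where
  "dd v f = (\<lambda>x. frechet_derivative f (at x) v)"

lemma dd_eqI: "(f has_derivative f') (at x) \<Longrightarrow> dd v f x = f' v"
  unfolding dd_def by (metis frechet_derivative_at)

lemma dd_works: "f differentiable (at x) \<Longrightarrow> (f has_derivative (\<lambda>v. dd v f x)) (at x)"
  unfolding dd_def using frechet_derivative_works by metis

lemma linear_dd: "f differentiable (at x) \<Longrightarrow> linear (\<lambda>v. dd v f x)"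
  using dd_works has_derivative_linear by blast

lemma dd_cong_open:
  assumes "open S" "x \<in> S" "\<And>y. y \<in> S \<Longrightarrow> f y = g y"
  shows "dd v f x = dd v g x"
proof -
  have "(f has_derivative D) (at x) \<longleftrightarrow> (g has_derivative D) (at x)" for D
    using assms by (metis has_derivative_transform_within_open)
  then show ?thesis unfolding dd_def frechet_derivative_def by simp
qed

lemma differentiable_cong_open:
  assumes "open S" "x \<in> S" "\<And>y. y \<in> S \<Longrightarrow> f y = g y"
  shows "f differentiable (at x) \<longleftrightarrow> g differentiable (at x)"
  using assms unfolding differentiable_def by (metis has_derivative_transform_within_open)

lemma Ck_on_Suc: "Ck_on (Suc k) S f \<longleftrightarrow> (\<forall>x\<in>S. f differentiable (at x)) \<and> (\<forall>v. Ck_on k S (dd v f))"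
  by (simp add: dd_def)

text \<open>Derivatives at a point of an open set depend only on nearby values, so formulas for
  Christoffel symbols or metric duals that hold only on S can be substituted under
  \<open>Ck_on\<close>.\<close>

lemma Ck_on_cong:
  assumes "open S" "\<And>y. y \<in> S \<Longrightarrow> f y = g y"
  shows "Ck_on k S f \<longleftrightarrow> Ck_on k S g"
  using assms(2)
proof (induction k arbitrary: f g)
  case 0
  then show ?case by (simp cong: continuous_on_cong)
next
  case (Suc k)
  have "Ck_on k S (dd v f) \<longleftrightarrow> Ck_on k S (dd v g)" for v
    by (rule Suc.IH) (rule dd_cong_open[OF assms(1) _ Suc.prems])
  moreover have "f differentiable (at x) \<longleftrightarrow> g differentiable (at x)" if "x \<in> S" for x
    by (rule differentiable_cong_open[OF assms(1) that Suc.prems])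
  ultimately show ?case unfolding Ck_on_Suc by auto
qed

lemma Ck_on_SucD: "Ck_on (Suc k) S f \<Longrightarrow> Ck_on k S f"
proof (induction k arbitrary: f)
  case 0
  then show ?case
    by (auto intro!: continuous_at_imp_continuous_on differentiable_imp_continuous_within)
next
  case (Suc k)
  then show ?case by (metis Ck_on_Suc)
qed

lemma Ck_on_const: "Ck_on k S (\<lambda>x. c)"
proof (induction k arbitrary: c)
  case 0
  then show ?case by simp
next
  case (Suc k)
  have "dd v (\<lambda>x. c) = (\<lambda>x. 0)" for v :: 'a by (simp add: dd_def)
  then show ?case using Suc by (simp only: Ck_on_Suc) simp
qed

lemma Ck_on_add:
  assumes "open S"
  shows "Ck_on k S f \<Longrightarrow> Ck_on k S g \<Longrightarrow> Ck_on k S (\<lambda>x. f x + g x)"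
proof (induction k arbitrary: f g)
  case 0
  then show ?case by (simp add: continuous_on_add)
next
  case (Suc k)
  have d: "f differentiable (at x)" "g differentiable (at x)" if "x \<in> S" for x
    using Suc.prems that by (auto simp only: Ck_on_Suc)
  have "dd v (\<lambda>x. f x + g x) x = dd v f x + dd v g x" if "x \<in> S" for v x
    by (intro dd_eqI has_derivative_add dd_works d that)
  then have "Ck_on k S (dd v (\<lambda>x. f x + g x)) \<longleftrightarrow> Ck_on k S (\<lambda>x. dd v f x + dd v g x)" for v
    by (rule Ck_on_cong[OF assms])
  then show ?case using Suc d by (auto simp only: Ck_on_Suc intro: differentiable_add)
qed

text \<open>The Leibniz rule gives a sum of two expressions of the same bilinear kind, so one
  induction covers inner products, scalar multiples and real products.\<close>

lemma Ck_on_bilinear: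
  assumes "open S" "bounded_bilinear B"
  shows "Ck_on k S f \<Longrightarrow> Ck_on k S g \<Longrightarrow> Ck_on k S (\<lambda>x. B (f x) (g x))"
proof (induction k arbitrary: f g)
  case 0
  then show ?case by (simp add: bounded_bilinear.continuous_on[OF assms(2)])
next
  case (Suc k)
  have d: "f differentiable (at x)" "g differentiable (at x)" if "x \<in> S" for x
    using Suc.prems that by (auto simp only: Ck_on_Suc)
  have D: "((\<lambda>x. B (f x) (g x)) has_derivative (\<lambda>v. B (f x) (dd v g x) + B (dd v f x) (g x))) (at x)"
    if "x \<in> S" for x
    by (intro bounded_bilinear.FDERIV[OF assms(2)] dd_works d that)
  then have "dd v (\<lambda>x. B (f x) (g x)) x = B (f x) (dd v g x) + B (dd v f x) (g x)" if "x \<in> S" for v x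
    using that dd_eqI by blast
  then have eq: "Ck_on k S (dd v (\<lambda>x. B (f x) (g x))) \<longleftrightarrow>
      Ck_on k S (\<lambda>x. B (f x) (dd v g x) + B (dd v f x) (g x))" for v
    by (rule Ck_on_cong[OF assms(1)])
  have "Ck_on k S (\<lambda>x. B (f x) (dd v g x) + B (dd v f x) (g x))" for v
    by (intro Ck_on_add[OF assms(1)] Suc.IH Ck_on_SucD[OF Suc.prems(1)] Ck_on_SucD[OF Suc.prems(2)])
      (use Suc.prems in \<open>auto simp only: Ck_on_Suc\<close>)
  with eq D show ?case unfolding Ck_on_Suc by (blast intro: differentiableI)
qed

lemma smooth_onD:
  assumes "smooth_map_on S f"
  shows "x \<in> S \<Longrightarrow> f differentiable (at x)" "smooth_map_on S (dd v f)"
proof -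
  have "Ck_on (Suc k) S f" for k using assms by (simp only: smooth_map_on_def)
  then show "x \<in> S \<Longrightarrow> f differentiable (at x)" "smooth_map_on S (dd v f)"
    unfolding Ck_on_Suc smooth_map_on_def by auto
qed

lemma smooth_on_continuous: "smooth_map_on S f \<Longrightarrow> continuous_on S f"
  by (metis Ck_on.simps(1) smooth_map_on_def)

lemma smooth_on_cong:
  "open S \<Longrightarrow> (\<And>y. y \<in> S \<Longrightarrow> f y = g y) \<Longrightarrow> smooth_map_on S f \<longleftrightarrow> smooth_map_on S g"
  unfolding smooth_map_on_def using Ck_on_cong by blast

lemma smooth_on_const: "smooth_map_on S (\<lambda>x. c)"
  by (simp add: smooth_map_on_def Ck_on_const)

lemma smooth_on_add:
  "open S \<Longrightarrow> smooth_map_on S f \<Longrightarrow> smooth_map_on S g \<Longrightarrow> smooth_map_on S (\<lambda>x. f x + g x)"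
  by (simp add: smooth_map_on_def Ck_on_add)

lemma smooth_on_inner:
  "open S \<Longrightarrow> smooth_map_on S f \<Longrightarrow> smooth_map_on S g \<Longrightarrow> smooth_map_on S (\<lambda>x. f x \<bullet> g x)"
  by (simp add: smooth_map_on_def Ck_on_bilinear bounded_bilinear_inner)

lemma smooth_on_scaleR:
  "open S \<Longrightarrow> smooth_map_on S f \<Longrightarrow> smooth_map_on S g \<Longrightarrow> smooth_map_on S (\<lambda>x. f x *\<^sub>R g x)"
  by (simp add: smooth_map_on_def Ck_on_bilinear bounded_bilinear_scaleR)

lemma smooth_on_diff:
  assumes "open S" "smooth_map_on S f" "smooth_map_on S g"
  shows "smooth_map_on S (\<lambda>x. f x - g x)"
  using smooth_on_add[OF assms(1,2) smooth_on_scaleR[OF assms(1) smooth_on_const[of S "-1"] assms(3)]]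
  by simp

lemma smooth_on_sum:
  assumes "open S" "\<And>i. i \<in> I \<Longrightarrow> smooth_map_on S (f i)"
  shows "smooth_map_on S (\<lambda>x. \<Sum>i\<in>I. f i x)"
  using assms(2) by (induction I rule: infinite_finite_induct) (auto simp: smooth_on_const smooth_on_add[OF assms(1)])

lemma smooth_on_subset:
  assumes "smooth_map_on S f" "T \<subseteq> S"
  shows "smooth_map_on T f"
proof -
  have "Ck_on k S f \<Longrightarrow> Ck_on k T f" for k
    by (induction k arbitrary: f) (use assms(2) continuous_on_subset in auto)
  then show ?thesis using assms(1) by (simp add: smooth_map_on_def)
qed

text \<open>The second difference over the parallelogram spanned by h u and h v is symmetric in u
  and v. Read as an increment in direction u of an increment in direction v, it allows the mean
  value theorem once in each direction, and the point of evaluation stays inside the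
  parallelogram.\<close>

lemma mixed_difference_mean_value:
  fixes g :: "'a::euclidean_space \<Rightarrow> real"
  assumes g: "smooth_map_on S g" and "h > 0"
    and sub: "\<And>s t. 0 \<le> s \<Longrightarrow> s \<le> h \<Longrightarrow> 0 \<le> t \<Longrightarrow> t \<le> h \<Longrightarrow> x + s *\<^sub>R u + t *\<^sub>R v \<in> S"
  obtains s t where "0 \<le> s" "s \<le> h" "0 \<le> t" "t \<le> h"
    "g (x + h *\<^sub>R u + h *\<^sub>R v) - g (x + h *\<^sub>R u) - g (x + h *\<^sub>R v) + g x
      = h * h * dd v (dd u g) (x + s *\<^sub>R u + t *\<^sub>R v)"
proof -
  have D1: "((\<lambda>s. k (x + s *\<^sub>R u + t *\<^sub>R v)) has_real_derivative dd u k (x + s *\<^sub>R u + t *\<^sub>R v)) (at s)"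
    if "smooth_map_on S k" "0 \<le> s" "s \<le> h" "0 \<le> t" "t \<le> h" for s t and k :: "'a \<Rightarrow> real"
  proof -
    have "(k has_derivative (\<lambda>w. dd w k (x + s *\<^sub>R u + t *\<^sub>R v))) (at (x + s *\<^sub>R u + t *\<^sub>R v))"
      using smooth_onD(1)[OF that(1) sub] that dd_works by blast
    then have "((\<lambda>s. k (x + s *\<^sub>R u + t *\<^sub>R v)) has_derivative
        (\<lambda>r. dd (r *\<^sub>R u) k (x + s *\<^sub>R u + t *\<^sub>R v))) (at s)"
      by (rule has_derivative_compose[rotated]) (auto intro!: derivative_eq_intros)
    moreover have "dd (r *\<^sub>R u) k (x + s *\<^sub>R u + t *\<^sub>R v) = dd u k (x + s *\<^sub>R u + t *\<^sub>R v) * r" for r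
      using linear_cmul[OF linear_dd[OF smooth_onD(1)[OF that(1) sub]]] that by simp
    ultimately show ?thesis by (simp add: has_field_derivative_def)
  qed
  have D2: "((\<lambda>t. k (x + s *\<^sub>R u + t *\<^sub>R v)) has_real_derivative dd v k (x + s *\<^sub>R u + t *\<^sub>R v)) (at t)"
    if "smooth_map_on S k" "0 \<le> s" "s \<le> h" "0 \<le> t" "t \<le> h" for s t and k :: "'a \<Rightarrow> real"
  proof -
    have "(k has_derivative (\<lambda>w. dd w k (x + s *\<^sub>R u + t *\<^sub>R v))) (at (x + s *\<^sub>R u + t *\<^sub>R v))"
      using smooth_onD(1)[OF that(1) sub] that dd_works by blast
    then have "((\<lambda>t. k (x + s *\<^sub>R u + t *\<^sub>R v)) has_derivative
        (\<lambda>r. dd (r *\<^sub>R v) k (x + s *\<^sub>R u + t *\<^sub>R v))) (at t)"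
      by (rule has_derivative_compose[rotated]) (auto intro!: derivative_eq_intros)
    moreover have "dd (r *\<^sub>R v) k (x + s *\<^sub>R u + t *\<^sub>R v) = dd v k (x + s *\<^sub>R u + t *\<^sub>R v) * r" for r
      using linear_cmul[OF linear_dd[OF smooth_onD(1)[OF that(1) sub]]] that by simp
    ultimately show ?thesis by (simp add: has_field_derivative_def)
  qed
  \<comment> \<open>The summand \<open>0 *\<^sub>R v\<close> is kept so that both terms are
    instances of \<open>D1\<close>, with t = h and t = 0.\<close>
  let ?\<phi> = "\<lambda>s. g (x + s *\<^sub>R u + h *\<^sub>R v) - g (x + s *\<^sub>R u + 0 *\<^sub>R v)"
  have "\<exists>s>0. s < h \<and> ?\<phi> h - ?\<phi> 0 = (h - 0) * (dd u g (x + s *\<^sub>R u + h *\<^sub>R v) - dd u g (x + s *\<^sub>R u + 0 *\<^sub>R v))"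
    by (rule MVT2[OF \<open>h > 0\<close>]) (intro DERIV_diff D1 g; use \<open>h > 0\<close> in simp)
  then obtain s where s: "0 < s" "s < h" and
    e1: "?\<phi> h - ?\<phi> 0 = h * (dd u g (x + s *\<^sub>R u + h *\<^sub>R v) - dd u g (x + s *\<^sub>R u + 0 *\<^sub>R v))"
    by auto
  have "\<exists>t>0. t < h \<and> dd u g (x + s *\<^sub>R u + h *\<^sub>R v) - dd u g (x + s *\<^sub>R u + 0 *\<^sub>R v)
     = (h - 0) * dd v (dd u g) (x + s *\<^sub>R u + t *\<^sub>R v)"
    by (rule MVT2[OF \<open>h > 0\<close>]) (intro D2 smooth_onD(2)[OF g]; use s in simp)
  then obtain t where t: "0 < t" "t < h" and
    e2: "dd u g (x + s *\<^sub>R u + h *\<^sub>R v) - dd u g (x + s *\<^sub>R u + 0 *\<^sub>R v) = h * dd v (dd u g) (x + s *\<^sub>R u + t *\<^sub>R v)"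
    by auto
  show ?thesis
    by (rule that[of s t]) (use s t e1 e2 in \<open>auto simp: algebra_simps\<close>)
qed

text \<open>At points of arbitrarily small parallelograms both iterated derivatives equal the same
  second difference divided by h * h; if they differed at x, continuity would keep them apart
  nearby.\<close>

lemma dd_commute_real:
  fixes g :: "'a::euclidean_space \<Rightarrow> real"
  assumes "open S" "x \<in> S" "smooth_map_on S g"
  shows "dd u (dd v g) x = dd v (dd u g) x"
proof (rule ccontr)
  define a b where "a = dd v (dd u g)" and "b = dd u (dd v g)"
  assume "dd u (dd v g) x \<noteq> dd v (dd u g) x"
  then have pos: "\<bar>b x - a x\<bar> / 2 > 0" by (simp add: a_def b_def)
  have cont: "continuous_on S a" "continuous_on S b"
    unfolding a_def b_def by (intro smooth_on_continuous smooth_onD(2) assms)+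
  obtain d1 where d1: "d1 > 0" "\<And>y. y \<in> S \<Longrightarrow> dist y x < d1 \<Longrightarrow> dist (a y) (a x) < \<bar>b x - a x\<bar> / 2"
    using cont(1)[unfolded continuous_on_iff, rule_format, OF assms(2) pos] by blast
  obtain d2 where d2: "d2 > 0" "\<And>y. y \<in> S \<Longrightarrow> dist y x < d2 \<Longrightarrow> dist (b y) (b x) < \<bar>b x - a x\<bar> / 2"
    using cont(2)[unfolded continuous_on_iff, rule_format, OF assms(2) pos] by blast
  obtain d3 where d3: "d3 > 0" "ball x d3 \<subseteq> S" using assms(1,2) openE by blast
  define d where "d = min d1 (min d2 d3)"
  \<comment> \<open>Half of d divided by the size of the two directions; the summand 1 keeps the
    denominator positive when u and v vanish.\<close>
  define h where "h = d / (2 * (norm u + norm v + 1))"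
  have h: "h > 0" "h * (norm u + norm v) < d"
  proof -
    have "d > 0" using d1 d2 d3 by (simp add: d_def)
    moreover have "norm u + norm v + 1 > 0" by (smt (verit) norm_ge_zero)
    ultimately show "h > 0" by (simp add: h_def)
    have "h * (norm u + norm v) \<le> h * (norm u + norm v + 1)" using \<open>h > 0\<close> by simp
    also have "\<dots> = d / 2" using \<open>norm u + norm v + 1 > 0\<close> by (simp add: h_def field_simps)
    finally show "h * (norm u + norm v) < d" using \<open>d > 0\<close> by simp
  qed
  have near: "dist (x + s *\<^sub>R u + t *\<^sub>R v) x < d" if "0 \<le> s" "s \<le> h" "0 \<le> t" "t \<le> h" for s t
  proof -
    have "dist (x + s *\<^sub>R u + t *\<^sub>R v) x \<le> s * norm u + t * norm v"
      using that norm_triangle_ineq[of "s *\<^sub>R u" "t *\<^sub>R v"] by (simp add: dist_norm algebra_simps)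
    also have "\<dots> \<le> h * norm u + h * norm v"
      using that by (intro add_mono mult_right_mono) auto
    finally show ?thesis using h by (simp add: algebra_simps)
  qed
  then have inS: "x + s *\<^sub>R u + t *\<^sub>R v \<in> S" if "0 \<le> s" "s \<le> h" "0 \<le> t" "t \<le> h" for s t
    using that d3 by (force simp: d_def dist_commute)
  obtain s t where st: "0 \<le> s" "s \<le> h" "0 \<le> t" "t \<le> h"
    "g (x + h *\<^sub>R u + h *\<^sub>R v) - g (x + h *\<^sub>R u) - g (x + h *\<^sub>R v) + g x = h * h * a (x + s *\<^sub>R u + t *\<^sub>R v)"
    unfolding a_def using mixed_difference_mean_value[OF assms(3) h(1) inS] by blast
  have inS': "x + s *\<^sub>R v + t *\<^sub>R u \<in> S" if "0 \<le> s" "s \<le> h" "0 \<le> t" "t \<le> h" for s t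
    using inS[of t s] that by (simp add: algebra_simps)
  obtain s' t' where st': "0 \<le> s'" "s' \<le> h" "0 \<le> t'" "t' \<le> h"
    "g (x + h *\<^sub>R v + h *\<^sub>R u) - g (x + h *\<^sub>R v) - g (x + h *\<^sub>R u) + g x = h * h * b (x + s' *\<^sub>R v + t' *\<^sub>R u)"
    unfolding b_def using mixed_difference_mean_value[OF assms(3) h(1) inS'] by blast
  have *: "x + s' *\<^sub>R v + t' *\<^sub>R u = x + t' *\<^sub>R u + s' *\<^sub>R v" "x + h *\<^sub>R v + h *\<^sub>R u = x + h *\<^sub>R u + h *\<^sub>R v"
    by (simp_all add: algebra_simps)
  have "h * h * a (x + s *\<^sub>R u + t *\<^sub>R v) = h * h * b (x + t' *\<^sub>R u + s' *\<^sub>R v)"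
    using st(5) st'(5) unfolding * by linarith
  then have "a (x + s *\<^sub>R u + t *\<^sub>R v) = b (x + t' *\<^sub>R u + s' *\<^sub>R v)" using h by simp
  moreover have "dist (a (x + s *\<^sub>R u + t *\<^sub>R v)) (a x) < \<bar>b x - a x\<bar> / 2"
    using d1(2)[OF inS] near st d_def by simp
  moreover have "dist (b (x + t' *\<^sub>R u + s' *\<^sub>R v)) (b x) < \<bar>b x - a x\<bar> / 2"
    using d2(2)[OF inS] near st' d_def by simp
  ultimately show False by (simp add: dist_real_def abs_if split: if_splits)
qed

lemma dd_inner_const:
  assumes "f differentiable (at x)"
  shows "dd v (\<lambda>y. f y \<bullet> c) x = dd v f x \<bullet> c"
  by (intro dd_eqI has_derivative_inner_left dd_works assms)

lemma dd_commute:
  assumes "open S" "x \<in> S" "smooth_map_on S f"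
  shows "dd u (dd v f) x = dd v (dd u f) x"
proof (rule euclidean_eqI)
  fix c :: 'b assume "c \<in> Basis"
  let ?g = "\<lambda>y. f y \<bullet> c"
  have sg: "smooth_map_on S ?g" by (intro smooth_on_inner smooth_on_const assms)
  have *: "dd u (dd v ?g) x = dd u (dd v f) x \<bullet> c" for u v
  proof -
    have "dd u (dd v ?g) x = dd u (\<lambda>y. dd v f y \<bullet> c) x"
      by (rule dd_cong_open[OF assms(1,2)]) (rule dd_inner_const, rule smooth_onD(1)[OF assms(3)])
    also have "\<dots> = dd u (dd v f) x \<bullet> c"
      by (rule dd_inner_const, rule smooth_onD(1)[OF smooth_onD(2)[OF assms(3)] assms(2)])
    finally show ?thesis .
  qed
  show "dd u (dd v f) x \<bullet> c = dd v (dd u f) x \<bullet> c"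
    using dd_commute_real[OF assms(1,2) sg, of u v] by (simp add: *)
qed

section \<open>Smooth dependence of metric duals\<close>

definition inner_form :: "('a::euclidean_space \<Rightarrow> 'a \<Rightarrow> real) \<Rightarrow> bool" where
  "inner_form G \<longleftrightarrow> bilinear G \<and> (\<forall>u v. G u v = G v u) \<and> (\<forall>v. v \<noteq> 0 \<longrightarrow> G v v > 0)"

lemma inner_formD:
  assumes "inner_form G"
  shows "linear (\<lambda>u. G u v)" "linear (\<lambda>v. G u v)" "G u v = G v u" "v \<noteq> 0 \<Longrightarrow> G v v > 0"
  using assms unfolding inner_form_def bilinear_def by blast+

lemma inner_form_expand:
  assumes "inner_form G"
  shows "G u w = (\<Sum>b\<in>Basis. (u \<bullet> b) * G b w)"
proof -
  have "G u w = G (\<Sum>b\<in>Basis. (u \<bullet> b) *\<^sub>R b) w" by (simp add: euclidean_representation)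
  also have "\<dots> = (\<Sum>b\<in>Basis. (u \<bullet> b) * G b w)"
    by (simp only: linear_sum[OF inner_formD(1)[OF assms]] linear_cmul[OF inner_formD(1)[OF assms]] real_scaleR_def)
  finally show ?thesis .
qed

lemma inner_form_expand_right:
  assumes "inner_form G"
  shows "G u w = (\<Sum>b\<in>Basis. (w \<bullet> b) * G u b)"
  unfolding inner_formD(3)[OF assms, of u] by (rule inner_form_expand[OF assms])

lemma inner_form_expand2:
  assumes "inner_form G"
  shows "G u w = (\<Sum>b\<in>Basis. \<Sum>c\<in>Basis. (u \<bullet> b) * (w \<bullet> c) * G b c)"
proof -
  have "G u w = (\<Sum>b\<in>Basis. (u \<bullet> b) * G b w)" by (rule inner_form_expand[OF assms])
  also have "\<dots> = (\<Sum>b\<in>Basis. (u \<bullet> b) * (\<Sum>c\<in>Basis. (w \<bullet> c) * G b c))"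
    by (intro sum.cong refl arg_cong2[where f="(*)"] inner_form_expand_right[OF assms])
  finally show ?thesis by (simp add: sum_distrib_left mult.assoc)
qed

lemma linear_expand:
  fixes \<alpha> :: "'a::euclidean_space \<Rightarrow> 'c::real_vector"
  assumes "linear \<alpha>"
  shows "\<alpha> u = (\<Sum>b\<in>Basis. (u \<bullet> b) *\<^sub>R \<alpha> b)"
proof -
  have "\<alpha> u = \<alpha> (\<Sum>b\<in>Basis. (u \<bullet> b) *\<^sub>R b)" by (simp add: euclidean_representation)
  also have "\<dots> = (\<Sum>b\<in>Basis. (u \<bullet> b) *\<^sub>R \<alpha> b)" by (simp only: linear_sum[OF assms] linear_cmul[OF assms])
  finally show ?thesis .
qed

lemma linear_real_mult: "linear f \<Longrightarrow> linear (\<lambda>x. (k::real) * f x)"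
  using linear_compose_scale_right[of f k] by simp

lemma inner_form_ext:
  assumes "inner_form G" "\<And>w. G z w = G z' w"
  shows "z = z'"
proof (rule ccontr)
  assume "z \<noteq> z'"
  then have "G (z - z') (z - z') > 0" using inner_formD(4)[OF assms(1)] by simp
  then show False using linear_diff[OF inner_formD(1)[OF assms(1)], of z z'] assms(2) by simp
qed

lemma metric_dual_eqI:
  assumes "inner_form G" "\<And>w. G z w = \<alpha> w"
  shows "metric_dual G \<alpha> = z"
  unfolding metric_dual_def
proof (rule the_equality)
  fix z' assume "\<forall>w. G z' w = \<alpha> w"
  then show "z' = z" using inner_form_ext[OF assms(1)] assms(2) by metis
qed (use assms in simp)

text \<open>Sending z to the functional G z is injective by positivity, hence surjective by
  dimension; in coordinates it is the linear map \<open>?F\<close>. This is what makes the definite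
  description in \<open>metric_dual\<close> denote something.\<close>

lemma metric_dual_works:
  fixes G :: "'a::euclidean_space \<Rightarrow> 'a \<Rightarrow> real"
  assumes "inner_form G" "linear \<alpha>"
  shows "G (metric_dual G \<alpha>) w = \<alpha> w"
proof -
  let ?F = "\<lambda>z. \<Sum>b\<in>Basis. G z b *\<^sub>R b"
  have G: "linear (\<lambda>u. G u v)" for v using assms(1) by (rule inner_formD)
  have lin: "linear ?F"
    by (intro linearI) (simp_all add: linear_add[OF G] linear_cmul[OF G] sum.distrib scaleR_sum_right scaleR_left_distrib)
  have comp: "?F z \<bullet> b = G z b" if "b \<in> Basis" for z b
    using that by (simp add: inner_sum_left inner_Basis if_distrib sum.delta cong: if_cong)
  have "z = z'" if "?F z = ?F z'" for z z'
  proof (rule inner_form_ext[OF assms(1)])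
    fix w
    have *: "G z b = G z' b" if "b \<in> Basis" for b
      using comp[OF that, of z] comp[OF that, of z'] \<open>?F z = ?F z'\<close> by simp
    show "G z w = G z' w"
      unfolding inner_form_expand_right[OF assms(1), of _ w] by (intro sum.cong refl) (simp add: *)
  qed
  then have "surj ?F" using linear_injective_imp_surjective[OF lin] by (simp add: inj_def)
  then obtain z where z: "?F z = (\<Sum>b\<in>Basis. \<alpha> b *\<^sub>R b)" unfolding surj_def by metis
  have "G z b = \<alpha> b" if "b \<in> Basis" for b
    using comp[OF that, of z] that unfolding z
    by (simp add: inner_sum_left inner_Basis if_distrib sum.delta cong: if_cong)
  then have "G z w = \<alpha> w" for w
    unfolding inner_form_expand_right[OF assms(1), of z w] linear_expand[OF assms(2), of w]
    by (intro sum.cong refl) simp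
  from metric_dual_eqI[OF assms(1) this] this show ?thesis by simp
qed

lemma inner_form_coercive:
  fixes G :: "'a::euclidean_space \<Rightarrow> 'a \<Rightarrow> real"
  assumes "inner_form G"
  obtains c where "c > 0" "\<And>v. c * (norm v)\<^sup>2 \<le> G v v"
proof -
  have cont: "continuous_on (sphere 0 1) (\<lambda>v. G v v)"
  proof -
    have "(\<lambda>v. G v v) = (\<lambda>v. \<Sum>b\<in>Basis. \<Sum>c\<in>Basis. (v \<bullet> b) * (v \<bullet> c) * G b c)"
      by (rule ext) (rule inner_form_expand2[OF assms])
    then show ?thesis by (rule ssubst) (intro continuous_intros)
  qed
  have "sphere (0::'a) 1 \<noteq> {}" by simp
  then obtain v0 :: 'a where v0: "norm v0 = 1" "\<And>v. norm v = 1 \<Longrightarrow> G v0 v0 \<le> G v v"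
    using continuous_attains_inf[OF compact_sphere _ cont] by auto
  show ?thesis
  proof (rule that[of "G v0 v0"])
    show "G v0 v0 > 0" using inner_formD(4)[OF assms, of v0] v0 by force
    fix v
    show "G v0 v0 * (norm v)\<^sup>2 \<le> G v v"
    proof (cases "v = 0")
      case True then show ?thesis using linear_0[OF inner_formD(1)[OF assms]] by simp
    next
      case False
      have "G (v /\<^sub>R norm v) (v /\<^sub>R norm v) = G v v / (norm v)\<^sup>2"
        by (simp only: linear_cmul[OF inner_formD(1)[OF assms]] linear_cmul[OF inner_formD(2)[OF assms]])
          (simp add: power2_eq_square divide_simps)
      moreover have "G v0 v0 \<le> G (v /\<^sub>R norm v) (v /\<^sub>R norm v)" using False by (intro v0) simp
      ultimately have "G v0 v0 \<le> G v v / (norm v)\<^sup>2" by simp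
      then show ?thesis using False by (simp add: pos_le_divide_eq)
    qed
  qed
qed

text \<open>A bound for the inverse Gram matrix, uniform near y0. It turns estimates of g y v b into
  estimates of v and so takes the place of an explicit inverse when duals are
  differentiated.\<close>

lemma inner_form_norm_bound:
  fixes g :: "'a::euclidean_space metric"
  assumes "open S" "y0 \<in> S" "\<And>y. y \<in> S \<Longrightarrow> inner_form (g y)"
    and cont: "\<And>u v. continuous_on S (\<lambda>y. g y u v)"
  obtains C where "C > 0" "\<forall>\<^sub>F y in at y0. \<forall>v. norm v \<le> C * (\<Sum>b\<in>Basis. \<bar>g y v b\<bar>)"
proof -
  obtain c where c: "c > 0" "\<And>v. c * (norm v)\<^sup>2 \<le> g y0 v v"
    using inner_form_coercive[OF assms(3)[OF assms(2)]] by blast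
  \<comment> \<open>\<open>?e\<close> is the total change of the metric coefficients. Once it is
    below c / 2, half of the coercivity constant c survives at y, which explains the factor 2 /
    c.\<close>
  let ?e = "\<lambda>y. \<Sum>b\<in>Basis. \<Sum>b'\<in>Basis. \<bar>g y b b' - g y0 b b'\<bar>"
  have lim: "((\<lambda>y. g y u v) \<longlongrightarrow> g y0 u v) (at y0)" for u v
    using cont[of u v] assms(1,2) by (simp add: continuous_on_eq_continuous_at continuous_at)
  have "(?e \<longlongrightarrow> (\<Sum>b\<in>Basis. \<Sum>b'\<in>Basis. \<bar>g y0 b b' - g y0 b b'\<bar>)) (at y0)"
    by (intro tendsto_sum tendsto_rabs tendsto_diff lim tendsto_const)
  then have "\<forall>\<^sub>F y in at y0. ?e y < c / 2"
    using c by (intro order_tendstoD(2)) auto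
  moreover have "\<forall>\<^sub>F y in at y0. y \<in> S" using assms(1,2) by (rule eventually_at_in_open')
  ultimately have "\<forall>\<^sub>F y in at y0. \<forall>v. norm v \<le> 2 / c * (\<Sum>b\<in>Basis. \<bar>g y v b\<bar>)"
  proof eventually_elim
    case (elim y)
    show ?case
    proof
      fix v
      have ex: "g z v v = (\<Sum>b\<in>Basis. \<Sum>b'\<in>Basis. (v \<bullet> b) * (v \<bullet> b') * g z b b')" if "z \<in> S" for z
        by (rule inner_form_expand2[OF assms(3)[OF that]])
      have "\<bar>g y v v - g y0 v v\<bar> = \<bar>\<Sum>b\<in>Basis. \<Sum>b'\<in>Basis. (v \<bullet> b) * (v \<bullet> b') * (g y b b' - g y0 b b')\<bar>"
        unfolding ex[OF elim(2)] ex[OF assms(2)] by (simp add: sum_subtractf algebra_simps)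
      also have "\<dots> \<le> (\<Sum>b\<in>Basis. \<Sum>b'\<in>Basis. \<bar>(v \<bullet> b) * (v \<bullet> b') * (g y b b' - g y0 b b')\<bar>)"
        by (intro order.trans[OF sum_abs] sum_mono order.refl)
      also have "\<dots> \<le> (\<Sum>b\<in>Basis. \<Sum>b'\<in>Basis. (norm v)\<^sup>2 * \<bar>g y b b' - g y0 b b'\<bar>)"
        unfolding abs_mult power2_eq_square
        by (intro sum_mono mult_right_mono mult_mono Basis_le_norm) auto
      also have "\<dots> = (norm v)\<^sup>2 * ?e y" by (simp add: sum_distrib_left)
      also have "\<dots> \<le> (norm v)\<^sup>2 * (c / 2)" using elim by (intro mult_left_mono) auto
      finally have "\<bar>g y v v - g y0 v v\<bar> \<le> (norm v)\<^sup>2 * (c / 2)" .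
      then have "g y v v \<ge> c / 2 * (norm v)\<^sup>2" using c(2)[of v]
        by (smt (verit) field_sum_of_halves mult.commute times_divide_eq_right abs_ge_minus_self)
      moreover have "g y v v \<le> norm v * (\<Sum>b\<in>Basis. \<bar>g y v b\<bar>)"
      proof -
        have "g y v v = (\<Sum>b\<in>Basis. (v \<bullet> b) * g y v b)"
          by (rule inner_form_expand_right[OF assms(3)[OF elim(2)]])
        also have "\<dots> \<le> (\<Sum>b\<in>Basis. norm v * \<bar>g y v b\<bar>)"
        proof (rule sum_mono)
          fix b :: 'a assume "b \<in> Basis"
          then have "\<bar>(v \<bullet> b) * g y v b\<bar> \<le> norm v * \<bar>g y v b\<bar>"
            unfolding abs_mult by (intro mult_right_mono Basis_le_norm) auto
          then show "(v \<bullet> b) * g y v b \<le> norm v * \<bar>g y v b\<bar>" by simp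
        qed
        finally show ?thesis by (simp add: sum_distrib_left)
      qed
      ultimately have "norm v * (c / 2 * norm v) \<le> norm v * (\<Sum>b\<in>Basis. \<bar>g y v b\<bar>)"
        by (simp add: power2_eq_square algebra_simps)
      moreover have "0 \<le> (\<Sum>b\<in>Basis. \<bar>g y v b\<bar>)" by (simp add: sum_nonneg)
      ultimately have "c / 2 * norm v \<le> (\<Sum>b\<in>Basis. \<bar>g y v b\<bar>)"
        by (cases "v = 0") auto
      then show "norm v \<le> 2 / c * (\<Sum>b\<in>Basis. \<bar>g y v b\<bar>)" using c by (simp add: field_simps)
    qed
  qed
  then show ?thesis using that[of "2 / c"] c by simp
qed

lemma linear_dd_param:
  assumes "open S" "y \<in> S" "\<And>y. y \<in> S \<Longrightarrow> linear (\<alpha> y)" "\<And>w. (\<lambda>y. \<alpha> y w) differentiable (at y)"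
  shows "linear (\<lambda>w. dd v (\<lambda>y. \<alpha> y w) y)"
proof (rule linearI)
  fix w w' :: 'b and r :: real
  have "dd v (\<lambda>y. \<alpha> y (w + w')) y = dd v (\<lambda>y. \<alpha> y w + \<alpha> y w') y"
    by (rule dd_cong_open[OF assms(1,2)]) (simp add: linear_add[OF assms(3)])
  also have "\<dots> = dd v (\<lambda>y. \<alpha> y w) y + dd v (\<lambda>y. \<alpha> y w') y"
    by (intro dd_eqI has_derivative_add dd_works assms)
  finally show "dd v (\<lambda>y. \<alpha> y (w + w')) y = dd v (\<lambda>y. \<alpha> y w) y + dd v (\<lambda>y. \<alpha> y w') y" .
  have "dd v (\<lambda>y. \<alpha> y (r *\<^sub>R w)) y = dd v (\<lambda>y. r *\<^sub>R \<alpha> y w) y"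
    by (rule dd_cong_open[OF assms(1,2)]) (simp add: linear_cmul[OF assms(3)])
  also have "\<dots> = r *\<^sub>R dd v (\<lambda>y. \<alpha> y w) y"
    by (intro dd_eqI has_derivative_scaleR_right dd_works assms)
  finally show "dd v (\<lambda>y. \<alpha> y (r *\<^sub>R w)) y = r *\<^sub>R dd v (\<lambda>y. \<alpha> y w) y" .
qed

lemma continuous_on_metric_dual:
  fixes g :: "'a::euclidean_space metric"
  assumes "open S" "\<And>y. y \<in> S \<Longrightarrow> inner_form (g y)" "\<And>u v. continuous_on S (\<lambda>y. g y u v)"
    "\<And>y. y \<in> S \<Longrightarrow> linear (\<alpha> y)" "\<And>w. continuous_on S (\<lambda>y. \<alpha> y w)"
  shows "continuous_on S (\<lambda>y. metric_dual (g y) (\<alpha> y))"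
  unfolding continuous_on_eq_continuous_at[OF assms(1)] continuous_at
proof
  fix y0 assume y0: "y0 \<in> S"
  let ?z = "\<lambda>y. metric_dual (g y) (\<alpha> y)"
  obtain C where C: "C > 0" "\<forall>\<^sub>F y in at y0. \<forall>v. norm v \<le> C * (\<Sum>b\<in>Basis. \<bar>g y v b\<bar>)"
    by (rule inner_form_norm_bound[OF assms(1) y0 assms(2,3)])
  let ?e = "\<lambda>y. C * (\<Sum>b\<in>Basis. \<bar>\<alpha> y b - g y (?z y0) b\<bar>)"
  have lim: "((\<lambda>y. g y u v) \<longlongrightarrow> g y0 u v) (at y0)" "((\<lambda>y. \<alpha> y v) \<longlongrightarrow> \<alpha> y0 v) (at y0)" for u v
    using assms(3)[of u v] assms(5)[of v] assms(1) y0 by (simp_all add: continuous_on_eq_continuous_at continuous_at)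
  have "(?e \<longlongrightarrow> C * (\<Sum>b\<in>Basis. \<bar>\<alpha> y0 b - g y0 (?z y0) b\<bar>)) (at y0)"
    by (intro tendsto_mult tendsto_sum tendsto_rabs tendsto_diff lim tendsto_const)
  then have lim0: "(?e \<longlongrightarrow> 0) (at y0)" using metric_dual_works[OF assms(2,4)[OF y0]] by simp
  have "\<forall>\<^sub>F y in at y0. y \<in> S" using assms(1) y0 by (rule eventually_at_in_open')
  with C(2) have "\<forall>\<^sub>F y in at y0. norm (?z y - ?z y0) \<le> ?e y"
  proof eventually_elim
    case (elim y)
    have "g y (?z y - ?z y0) b = \<alpha> y b - g y (?z y0) b" for b
      using linear_diff[OF inner_formD(1)[OF assms(2)[OF elim(2)]]] metric_dual_works[OF assms(2,4)[OF elim(2)]] by simp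
    then show ?case using elim(1)[rule_format, of "?z y - ?z y0"] by simp
  qed
  from Lim_null_comparison[OF this lim0] show "(?z \<longlongrightarrow> ?z y0) (at y0)" by (simp add: LIM_zero_iff)
qed

text \<open>The formula comes from differentiating g y (z y) w = \<alpha> y w as if z were
  differentiable: g y0 (z' v) w is the derivative of \<alpha> minus that of g with z y0 held fixed.
  The derivative is again a metric dual, which is what allows iteration.\<close>

lemma has_derivative_metric_dual:
  fixes g :: "'a::euclidean_space metric"
  assumes "open S" "y0 \<in> S" "\<And>y. y \<in> S \<Longrightarrow> inner_form (g y)" "\<And>u v. continuous_on S (\<lambda>y. g y u v)"
    and dg: "\<And>u v. (\<lambda>y. g y u v) differentiable (at y0)"
    and \<alpha>: "\<And>y. y \<in> S \<Longrightarrow> linear (\<alpha> y)" and d\<alpha>: "\<And>w. (\<lambda>y. \<alpha> y w) differentiable (at y0)"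
  shows "((\<lambda>y. metric_dual (g y) (\<alpha> y)) has_derivative
    (\<lambda>v. metric_dual (g y0) (\<lambda>w. dd v (\<lambda>y. \<alpha> y w) y0
       - (\<Sum>b\<in>Basis. (metric_dual (g y0) (\<alpha> y0) \<bullet> b) * dd v (\<lambda>y. g y b w) y0)))) (at y0)"
proof -
  let ?z = "\<lambda>y. metric_dual (g y) (\<alpha> y)"
  let ?\<beta> = "\<lambda>v w. dd v (\<lambda>y. \<alpha> y w) y0 - (\<Sum>b\<in>Basis. (?z y0 \<bullet> b) * dd v (\<lambda>y. g y b w) y0)"
  let ?L = "\<lambda>v. metric_dual (g y0) (?\<beta> v)"
  have ip: "inner_form (g y0)" using assms by blast
  have g1: "linear (\<lambda>w. dd v (\<lambda>y. g y b w) y0)" for v b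
    by (rule linear_dd_param[OF assms(1,2)]) (use assms(3) inner_formD(2) dg in blast)+
  have a1: "linear (\<lambda>w. dd v (\<lambda>y. \<alpha> y w) y0)" for v
    by (rule linear_dd_param[OF assms(1,2) \<alpha> d\<alpha>])
  have lin: "linear (?\<beta> v)" for v
    by (intro linear_compose_sub a1 linear_compose_sum ballI linear_real_mult g1)
  have L: "g y0 (?L v) w = ?\<beta> v w" for v w by (rule metric_dual_works[OF ip lin])
  have lin2: "linear (\<lambda>v. ?\<beta> v w)" for w
    by (intro linear_compose_sub linear_compose_sum ballI linear_real_mult linear_dd dg d\<alpha>)
  have linL: "linear ?L"
  proof (rule linearI; rule inner_form_ext[OF ip])
    show "g y0 (?L (u + v)) w = g y0 (?L u + ?L v) w" for u v w
      unfolding linear_add[OF inner_formD(1)[OF ip]] L by (rule linear_add[OF lin2])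
    show "g y0 (?L (r *\<^sub>R u)) w = g y0 (r *\<^sub>R ?L u) w" for r u w
      unfolding linear_cmul[OF inner_formD(1)[OF ip]] L by (rule linear_cmul[OF lin2])
  qed
  obtain C where C: "C > 0" "\<forall>\<^sub>F y in at y0. \<forall>v. norm v \<le> C * (\<Sum>b\<in>Basis. \<bar>g y v b\<bar>)"
    by (rule inner_form_norm_bound[OF assms(1-4)])
  \<comment> \<open>\<open>?\<sigma> b y\<close> is g y applied to the remainder z y - z y0 - L (y -
    y0) and to b, with z y eliminated through \<alpha>. Being free of z y, it can be differentiated
    before anything is known about z; its derivative at y0 vanishes by the choice of L.\<close>
  let ?\<sigma> = "\<lambda>w y. \<alpha> y w - (\<Sum>b\<in>Basis. (?z y0 \<bullet> b) * g y b w) - (\<Sum>b\<in>Basis. (?L (y - y0) \<bullet> b) * g y b w)"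
  have \<sigma>0: "(?\<sigma> w has_derivative (\<lambda>v. 0)) (at y0)" for w
  proof -
    have LD: "((\<lambda>y. ?L (y - y0) \<bullet> b) has_derivative (\<lambda>v. ?L v \<bullet> b)) (at y0)" for b
      by (intro has_derivative_inner_left has_derivative_eq_rhs[OF bounded_linear.has_derivative[of ?L]])
        (use linL in \<open>auto simp: linear_conv_bounded_linear intro!: derivative_eq_intros\<close>)
    have gD: "((\<lambda>y. g y b w) has_derivative (\<lambda>v. dd v (\<lambda>y. g y b w) y0)) (at y0)" for b
      by (rule dd_works[OF dg])
    have aD: "((\<lambda>y. \<alpha> y w) has_derivative (\<lambda>v. dd v (\<lambda>y. \<alpha> y w) y0)) (at y0)"
      by (rule dd_works[OF d\<alpha>])
    have "(?\<sigma> w has_derivative (\<lambda>v. dd v (\<lambda>y. \<alpha> y w) y0 - (\<Sum>b\<in>Basis. (?z y0 \<bullet> b) * dd v (\<lambda>y. g y b w) y0)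
      - (\<Sum>b\<in>Basis. ?L (y0 - y0) \<bullet> b * dd v (\<lambda>y. g y b w) y0 + ?L v \<bullet> b * g y0 b w))) (at y0)"
      by (intro has_derivative_diff has_derivative_sum aD has_derivative_mult_right has_derivative_mult gD LD)
    moreover have "dd v (\<lambda>y. \<alpha> y w) y0 - (\<Sum>b\<in>Basis. (?z y0 \<bullet> b) * dd v (\<lambda>y. g y b w) y0)
      - (\<Sum>b\<in>Basis. ?L (y0 - y0) \<bullet> b * dd v (\<lambda>y. g y b w) y0 + ?L v \<bullet> b * g y0 b w) = 0" for v
    proof -
      have "?L (y0 - y0) = 0" using linear_0[OF linL] by simp
      then show ?thesis using L[of v w] inner_form_expand[OF ip, of "?L v" w] by simp
    qed
    ultimately show ?thesis by simp
  qed
  have \<sigma>z: "?\<sigma> w y0 = 0" for w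
    using metric_dual_works[OF ip \<alpha>[OF assms(2)], of w] inner_form_expand[OF ip, of "?z y0" w] linear_0[OF linL] by simp
  have lim: "((\<lambda>y. C * (\<Sum>b\<in>Basis. \<bar>?\<sigma> b y\<bar> / norm (y - y0))) \<longlongrightarrow> 0) (at y0)"
  proof -
    have "((\<lambda>y. \<bar>?\<sigma> b y\<bar> / norm (y - y0)) \<longlongrightarrow> 0) (at y0)" for b
      using \<sigma>0[of b] \<sigma>z[of b] unfolding has_derivative_iff_norm by simp
    then have "((\<lambda>y. C * (\<Sum>b\<in>Basis. \<bar>?\<sigma> b y\<bar> / norm (y - y0))) \<longlongrightarrow> C * (\<Sum>b\<in>(Basis::'a set). 0)) (at y0)"
      by (intro tendsto_mult tendsto_const tendsto_sum)
    then show ?thesis by simp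
  qed
  have "\<forall>\<^sub>F y in at y0. y \<in> S" using assms(1,2) by (rule eventually_at_in_open')
  with C(2) have ev: "\<forall>\<^sub>F y in at y0. norm (norm (?z y - ?z y0 - ?L (y - y0)) / norm (y - y0))
      \<le> C * (\<Sum>b\<in>Basis. \<bar>?\<sigma> b y\<bar> / norm (y - y0))"
  proof eventually_elim
    case (elim y)
    have ipy: "inner_form (g y)" using assms(3) elim by blast
    have "g y (?z y - ?z y0 - ?L (y - y0)) b = ?\<sigma> b y" for b
      using linear_diff[OF inner_formD(1)[OF ipy]] metric_dual_works[OF ipy \<alpha>[OF elim(2)]]
        inner_form_expand[OF ipy, of "?z y0" b] inner_form_expand[OF ipy, of "?L (y - y0)" b] by simp
    then have "norm (?z y - ?z y0 - ?L (y - y0)) \<le> C * (\<Sum>b\<in>Basis. \<bar>?\<sigma> b y\<bar>)"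
      using elim(1)[rule_format, of "?z y - ?z y0 - ?L (y - y0)"] by simp
    from divide_right_mono[OF this, of "norm (y - y0)"] show ?case
      by (simp add: sum_divide_distrib[symmetric])
  qed
  show ?thesis unfolding has_derivative_iff_norm
    using linL Lim_null_comparison[OF ev lim] by (simp add: linear_conv_bounded_linear)
qed

text \<open>The functional representing the derivative contains the dual itself. The induction on k
  therefore uses its hypothesis twice: for the dual as a C^k map, and for the dual of the
  differentiated functional.\<close>

lemma smooth_on_metric_dual:
  fixes g :: "'a::euclidean_space metric"
  assumes S: "open S" and ip: "\<And>y. y \<in> S \<Longrightarrow> inner_form (g y)" and g: "\<And>u v. smooth_map_on S (\<lambda>y. g y u v)"
    and "\<And>y. y \<in> S \<Longrightarrow> linear (\<alpha> y)" "\<And>w. smooth_map_on S (\<lambda>y. \<alpha> y w)"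
  shows "smooth_map_on S (\<lambda>y. metric_dual (g y) (\<alpha> y))"
proof -
  have gc: "continuous_on S (\<lambda>y. g y u v)" for u v by (rule smooth_on_continuous[OF g])
  have "Ck_on k S (\<lambda>y. metric_dual (g y) (\<alpha> y))"
    if "\<And>y. y \<in> S \<Longrightarrow> linear (\<alpha> y)" "\<And>w. Ck_on k S (\<lambda>y. \<alpha> y w)" for k \<alpha>
    using that
  proof (induction k arbitrary: \<alpha>)
    case 0
    then show ?case using continuous_on_metric_dual[OF S ip gc] by simp
  next
    case (Suc k)
    let ?z = "\<lambda>y. metric_dual (g y) (\<alpha> y)"
    let ?\<beta> = "\<lambda>v y w. dd v (\<lambda>y. \<alpha> y w) y - (\<Sum>b\<in>Basis. (?z y \<bullet> b) * dd v (\<lambda>y. g y b w) y)"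
    have d\<alpha>: "(\<lambda>y. \<alpha> y w) differentiable (at y)" if "y \<in> S" for y w
      using Suc.prems(2)[of w] that unfolding Ck_on_Suc by blast
    have dg: "(\<lambda>y. g y u w) differentiable (at y)" if "y \<in> S" for y u w
      by (rule smooth_onD(1)[OF g that])
    have D: "(?z has_derivative (\<lambda>v. metric_dual (g y) (?\<beta> v y))) (at y)" if "y \<in> S" for y
      by (rule has_derivative_metric_dual[OF S that ip gc dg[OF that] Suc.prems(1) d\<alpha>[OF that]])
    then have eq: "Ck_on k S (dd v ?z) \<longleftrightarrow> Ck_on k S (\<lambda>y. metric_dual (g y) (?\<beta> v y))" for v
      by (intro Ck_on_cong[OF S] dd_eqI)
    have lin: "linear (?\<beta> v y)" if "y \<in> S" for v y
      by (intro linear_compose_sub linear_compose_sum ballI linear_real_mult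
          linear_dd_param[OF S that Suc.prems(1) d\<alpha>[OF that]]
          linear_dd_param[OF S that inner_formD(2)[OF ip] dg[OF that]])
    have zk: "Ck_on k S ?z"
      by (rule Suc.IH[OF Suc.prems(1) Ck_on_SucD[OF Suc.prems(2)]])
    have "Ck_on k S (\<lambda>y. ?\<beta> v y w)" for v w
    proof -
      have 1: "Ck_on k S (\<lambda>y. dd v (\<lambda>y. \<alpha> y w) y)" using Suc.prems(2)[of w] unfolding Ck_on_Suc by simp
      have "Ck_on k S (dd v (\<lambda>y. g y b w))" for b
        using smooth_onD(2)[OF g] by (simp add: smooth_map_on_def)
      then have "Ck_on k S (\<lambda>y. (?z y \<bullet> b) * dd v (\<lambda>y. g y b w) y)" for b
        by (intro Ck_on_bilinear[OF S bounded_bilinear_mult] Ck_on_bilinear[OF S bounded_bilinear_inner] zk Ck_on_const)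
      then have "Ck_on k S (\<lambda>y. \<Sum>b\<in>B. (?z y \<bullet> b) * dd v (\<lambda>y. g y b w) y)" for B
        by (induction B rule: infinite_finite_induct) (auto simp: Ck_on_const Ck_on_add[OF S])
      then have "Ck_on k S (\<lambda>y. (-1) * (\<Sum>b\<in>Basis. (?z y \<bullet> b) * dd v (\<lambda>y. g y b w) y))"
        by (intro Ck_on_bilinear[OF S bounded_bilinear_mult] Ck_on_const)
      from Ck_on_add[OF S 1 this] show ?thesis by simp
    qed
    then have "Ck_on k S (\<lambda>y. metric_dual (g y) (?\<beta> v y))" for v
      by (intro Suc.IH lin)
    then show ?case unfolding Ck_on_Suc eq using D by (auto intro: differentiableI)
  qed
  then show ?thesis using assms(4,5) by (simp add: smooth_map_on_def)
qed

section \<open>Orthonormal frames and the Gauss equation\<close>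

definition orthonormal_upto :: "('a::euclidean_space \<Rightarrow> 'a \<Rightarrow> real) \<Rightarrow> nat \<Rightarrow> (nat \<Rightarrow> 'a) \<Rightarrow> bool" where
  "orthonormal_upto G k e \<longleftrightarrow> (\<forall>i\<in>{1..k}. \<forall>j\<in>{1..k}. G (e i) (e j) = (if i = j then 1 else 0))"

lemma orthonormal_frame_iff: "orthonormal_frame G e \<longleftrightarrow> orthonormal_upto G DIM('a) e"
  for e :: "nat \<Rightarrow> 'a::euclidean_space"
  by (simp add: orthonormal_frame_def orthonormal_upto_def)

text \<open>The orthogonal projection \<open>?L\<close> onto the k given vectors has rank at most k,
  below the dimension, so it has a nonzero kernel vector; normalising it gives u.\<close>

lemma orthonormal_upto_orthogonal_vector:
  fixes G :: "'a::euclidean_space \<Rightarrow> 'a \<Rightarrow> real"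
  assumes "inner_form G" "orthonormal_upto G k e" "k < DIM('a)"
  obtains u where "G u u = 1" "\<And>i. i \<in> {1..k} \<Longrightarrow> G u (e i) = 0"
proof -
  let ?L = "\<lambda>u. \<Sum>i=1..k. G u (e i) *\<^sub>R e i"
  have G: "linear (\<lambda>u. G u v)" "linear (\<lambda>v. G u v)" for u v by (rule inner_formD[OF assms(1)])+
  have lin: "linear ?L"
    by (intro linearI) (simp_all add: linear_add[OF G(1)] linear_cmul[OF G(1)] sum.distrib scaleR_sum_right scaleR_left_distrib)
  have "range ?L \<subseteq> span (e ` {1..k})"
    by (intro image_subsetI span_sum span_scale span_base imageI)
  then have "dim (range ?L) \<le> card (e ` {1..k})" by (simp add: dim_le_card)
  also have "\<dots> \<le> k" using card_image_le[of "{1..k}" e] by simp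
  finally have "\<not> surj ?L" using assms(3) by force
  then have "\<not> inj ?L" using linear_injective_imp_surjective[OF lin] by blast
  then obtain u where u: "u \<noteq> 0" "?L u = 0" using linear_injective_0[OF lin] by blast
  have 0: "G u (e j) = 0" if "j \<in> {1..k}" for j
  proof -
    have "G (?L u) (e j) = (\<Sum>i=1..k. G u (e i) * G (e i) (e j))"
      by (simp only: linear_sum[OF G(1)] linear_cmul[OF G(1)] real_scaleR_def)
    also have "\<dots> = (\<Sum>i=1..k. if i = j then G u (e j) else 0)"
      using assms(2) that by (intro sum.cong) (auto simp: orthonormal_upto_def)
    also have "\<dots> = G u (e j)" using that by simp
    finally show ?thesis using u(2) linear_0[OF G(1)] by simp
  qed
  have pos: "G u u > 0" using inner_formD(4)[OF assms(1) u(1)] .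
  let ?u = "u /\<^sub>R sqrt (G u u)"
  show ?thesis
  proof (rule that[of ?u])
    show "G ?u ?u = 1" using pos by (simp only: linear_cmul[OF G(1)] linear_cmul[OF G(2)]) (simp add: field_simps)
    show "G ?u (e i) = 0" if "i \<in> {1..k}" for i using 0[OF that] by (simp add: linear_cmul[OF G(1)])
  qed
qed

lemma orthonormal_frame_extension:
  fixes G :: "'a::euclidean_space \<Rightarrow> 'a \<Rightarrow> real"
  assumes "inner_form G" "orthonormal_upto G k e" "k \<le> DIM('a)"
  obtains e' where "orthonormal_frame G e'" "\<And>i. i \<in> {1..k} \<Longrightarrow> e' i = e i"
proof -
  have "\<exists>e'. orthonormal_frame G e' \<and> (\<forall>i\<in>{1..k}. e' i = e i)"
    using assms(3,2)
  proof (induction k arbitrary: e rule: inc_induct)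
    case base
    then show ?case unfolding orthonormal_frame_iff by blast
  next
    case (step k)
    obtain u where u: "G u u = 1" "\<And>i. i \<in> {1..k} \<Longrightarrow> G u (e i) = 0"
      using orthonormal_upto_orthogonal_vector[OF assms(1) step.prems step.hyps(2)] by blast
    have "orthonormal_upto G (Suc k) (e(Suc k := u))"
      using step.prems u inner_formD(3)[OF assms(1), of "e _" u]
      unfolding orthonormal_upto_def by (simp add: atLeastAtMostSuc_conv)
    from step.IH[OF this] obtain e' where "orthonormal_frame G e'" "\<forall>i\<in>{1..Suc k}. e' i = (e(Suc k := u)) i"
      by blast
    moreover from this(2) have "\<forall>i\<in>{1..k}. e' i = e i" by force
    ultimately show ?case by blast
  qed
  then show ?thesis using that by blast
qed

lemma orthonormal_frame_exists:
  assumes "inner_form G" obtains e where "orthonormal_frame G e"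
  by (rule orthonormal_frame_extension[OF assms, of 0]) (auto simp: orthonormal_upto_def)

text \<open>A bijection between \<open>Basis\<close> and the index set turns the frame into a linear
  self-map; orthonormality makes it injective, hence surjective, so every vector is a combination of
  the frame.\<close>

lemma orthonormal_frame_expand:
  fixes G :: "'a::euclidean_space \<Rightarrow> 'a \<Rightarrow> real"
  assumes "inner_form G" "orthonormal_frame G e"
  shows "u = (\<Sum>i=1..DIM('a). G u (e i) *\<^sub>R e i)"
proof -
  obtain \<phi> where \<phi>: "bij_betw \<phi> (Basis::'a set) {1..DIM('a)}"
    using finite_same_card_bij[of "Basis::'a set" "{1..DIM('a)}"] by auto
  let ?M = "\<lambda>x. \<Sum>b\<in>Basis. (x \<bullet> b) *\<^sub>R e (\<phi> b)"
  have G: "linear (\<lambda>u. G u v)" for v by (rule inner_formD[OF assms(1)])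
  have lin: "linear ?M"
    by (intro linearI) (simp_all add: inner_add_left scaleR_left_distrib sum.distrib scaleR_sum_right)
  have coord: "G (?M x) (e (\<phi> c)) = x \<bullet> c" if "c \<in> Basis" for x c
  proof -
    have o: "G (e (\<phi> b)) (e (\<phi> c)) = (if b = c then 1 else 0)" if "b \<in> Basis" for b
    proof -
      have "\<phi> b \<in> {1..DIM('a)}" "\<phi> c \<in> {1..DIM('a)}" "\<phi> b = \<phi> c \<longleftrightarrow> b = c"
        using \<phi> that \<open>c \<in> Basis\<close> by (auto simp: bij_betw_def inj_on_def)
      then show ?thesis using assms(2) unfolding orthonormal_frame_def by simp
    qed
    have "G (?M x) (e (\<phi> c)) = (\<Sum>b\<in>Basis. (x \<bullet> b) * G (e (\<phi> b)) (e (\<phi> c)))"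
      by (simp only: linear_sum[OF G] linear_cmul[OF G] real_scaleR_def)
    also have "\<dots> = (\<Sum>b\<in>Basis. if b = c then x \<bullet> c else 0)"
      by (intro sum.cong) (auto simp: o)
    finally show ?thesis using that by simp
  qed
  have "x = 0" if "?M x = 0" for x
  proof (rule euclidean_eqI)
    fix c :: 'a assume c: "c \<in> Basis"
    show "x \<bullet> c = 0 \<bullet> c" using coord[OF c, of x] that linear_0[OF G] by simp
  qed
  then have "inj ?M" using linear_injective_0[OF lin] by blast
  then have "surj ?M" by (rule linear_injective_imp_surjective[OF lin]) (rule refl)
  then obtain x where x: "u = ?M x" by (rule surjE)
  have "?M x = (\<Sum>b\<in>Basis. G u (e (\<phi> b)) *\<^sub>R e (\<phi> b))"
    by (intro sum.cong) (auto simp: x coord)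
  also have "\<dots> = (\<Sum>i=1..DIM('a). G u (e i) *\<^sub>R e i)" by (rule sum.reindex_bij_betw[OF \<phi>])
  finally show ?thesis using x by simp
qed

text \<open>The right-hand side involves only a fixed basis and its metric duals. Hence the trace
  does not depend on the frame, in particular not on the one chosen inside
  \<open>metric_trace\<close>, and it varies smoothly with the metric.\<close>

lemma frame_trace_eq:
  fixes G :: "'a::euclidean_space \<Rightarrow> 'a \<Rightarrow> real" and B :: "'a \<Rightarrow> 'a \<Rightarrow> 'c::real_vector"
  assumes ip: "inner_form G" and e: "orthonormal_frame G e"
    and B: "\<And>v. linear (\<lambda>u. B u v)" "\<And>u. linear (\<lambda>v. B u v)"
  shows "(\<Sum>i=1..DIM('a). B (e i) (e i)) = (\<Sum>b\<in>Basis. B b (metric_dual G (\<lambda>w. w \<bullet> b)))"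
proof -
  let ?d = "\<lambda>b. metric_dual G (\<lambda>w. w \<bullet> b)"
  have lin: "linear (\<lambda>w. w \<bullet> b)" for b :: 'a by (simp add: bounded_linear.linear bounded_linear_inner_left)
  have d: "?d b = (\<Sum>i=1..DIM('a). (e i \<bullet> b) *\<^sub>R e i)" for b
    using orthonormal_frame_expand[OF ip e, of "?d b"] metric_dual_works[OF ip lin] by simp
  have "(\<Sum>b\<in>Basis. B b (?d b)) = (\<Sum>b\<in>Basis. \<Sum>i=1..DIM('a). (e i \<bullet> b) *\<^sub>R B b (e i))"
    unfolding d by (simp only: linear_sum[OF B(2)] linear_cmul[OF B(2)])
  also have "\<dots> = (\<Sum>i=1..DIM('a). \<Sum>b\<in>Basis. (e i \<bullet> b) *\<^sub>R B b (e i))" by (rule sum.swap)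
  also have "\<dots> = (\<Sum>i=1..DIM('a). B (e i) (e i))"
    by (intro sum.cong refl linear_expand[OF B(1), symmetric])
  finally show ?thesis by simp
qed

lemma metric_trace_eq:
  fixes G :: "'a::euclidean_space \<Rightarrow> 'a \<Rightarrow> real" and B :: "'a \<Rightarrow> 'a \<Rightarrow> 'c::real_vector"
  assumes "inner_form G" "orthonormal_frame G e" "\<And>v. linear (\<lambda>u. B u v)" "\<And>u. linear (\<lambda>v. B u v)"
  shows "metric_trace G B = (\<Sum>i=1..DIM('a). B (e i) (e i))"
proof -
  have "orthonormal_frame G (SOME e. orthonormal_frame G e)" using someI[of "orthonormal_frame G" e] assms(2) by simp
  from frame_trace_eq[OF assms(1) this assms(3,4)] show ?thesis
    unfolding metric_trace_def Let_def frame_trace_eq[OF assms] .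
qed

lemma linear_trace_eq:
  fixes G :: "'a::euclidean_space \<Rightarrow> 'a \<Rightarrow> real"
  assumes "inner_form G" "orthonormal_frame G e" "linear L"
  shows "linear_trace L = (\<Sum>i=1..DIM('a). G (L (e i)) (e i))"
proof -
  have "linear (\<lambda>u. G (L u) v)" for v
    using linear_compose[OF assms(3) inner_formD(1)[OF assms(1)], of v] by (simp add: o_def)
  from frame_trace_eq[OF assms(1,2), of "\<lambda>u v. G (L u) v", OF this inner_formD(2)[OF assms(1)]]
  have "(\<Sum>i=1..DIM('a). G (L (e i)) (e i)) = (\<Sum>b\<in>Basis. G (L b) (metric_dual G (\<lambda>w. w \<bullet> b)))" .
  also have "\<dots> = (\<Sum>b\<in>Basis. L b \<bullet> b)"
    by (intro sum.cong refl)
      (simp add: inner_formD(3)[OF assms(1), of "L _"] metric_dual_works[OF assms(1)]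
        bounded_linear.linear bounded_linear_inner_left)
  finally show ?thesis by (simp add: linear_trace_def)
qed

section \<open>Second fundamental form and Gauss equation on a coordinate patch\<close>

locale immersion_patch =
  fixes f :: "'a::euclidean_space \<Rightarrow> 'b::euclidean_space" and S :: "'a set"
  assumes open_S: "open S" and smooth_f: "smooth_map_on S f"
    and inj_df: "y \<in> S \<Longrightarrow> inj (frechet_derivative f (at y))"
begin

abbreviation "G \<equiv> induced_metric f"
abbreviation "\<Gamma> \<equiv> christoffel G"
abbreviation "h \<equiv> second_fundamental_form f"

lemma smooth_dd: "smooth_map_on S (dd v f)" "smooth_map_on S (dd u (dd v f))" "smooth_map_on S (dd w (dd u (dd v f)))"
  by (intro smooth_onD(2) smooth_f)+

lemma diff_dd:
  assumes "y \<in> S"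
  shows "f differentiable (at y)" "dd v f differentiable (at y)" "dd u (dd v f) differentiable (at y)"
  by (rule smooth_onD(1)[OF _ assms]; rule smooth_f smooth_dd)+

lemma dd_sym: "y \<in> S \<Longrightarrow> dd u (dd v f) y = dd v (dd u f) y"
  by (rule dd_commute[OF open_S _ smooth_f])

lemma linear_dd_f:
  assumes "y \<in> S"
  shows "linear (\<lambda>u. dd u f y)" "linear (\<lambda>u. dd u (dd v f) y)" "linear (\<lambda>v. dd u (dd v f) y)"
proof -
  show "linear (\<lambda>u. dd u f y)" "linear (\<lambda>u. dd u (dd v f) y)" using diff_dd[OF assms] linear_dd by blast+
  show "linear (\<lambda>v. dd u (dd v f) y)" unfolding dd_sym[OF assms, of u] using diff_dd[OF assms] linear_dd by blast
qed

lemma G_eq: "G y u v = dd u f y \<bullet> dd v f y"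
  by (simp add: induced_metric_def dd_def)

lemma inner_form_G:
  assumes "y \<in> S" shows "inner_form (G y)"
proof -
  have L: "linear (\<lambda>u. dd u f y)" by (rule linear_dd_f[OF assms])
  have "dd v f y \<noteq> 0" if "v \<noteq> 0" for v
    using inj_df[OF assms] linear_0[OF L] that unfolding dd_def inj_def by metis
  moreover have "bilinear (G y)"
    unfolding bilinear_def G_eq
    by (auto intro!: linearI simp: linear_add[OF L] linear_cmul[OF L] inner_add_left inner_add_right)
  ultimately show ?thesis by (simp add: inner_form_def G_eq inner_commute)
qed

lemmas G_linear = inner_formD(1,2)[OF inner_form_G]
lemmas G_sym = inner_formD(3)[OF inner_form_G]
lemmas G_ext = inner_form_ext[OF inner_form_G]

lemma smooth_G: "smooth_map_on S (\<lambda>y. G y u v)"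
  unfolding G_eq by (intro smooth_on_inner open_S smooth_dd)

lemma dd_inner:
  assumes "p differentiable (at y)" "q differentiable (at y)"
  shows "dd w (\<lambda>z. p z \<bullet> q z) y = p y \<bullet> dd w q y + dd w p y \<bullet> q y"
  by (intro dd_eqI has_derivative_inner dd_works assms)

lemma dd_G:
  assumes "y \<in> S"
  shows "dd w (\<lambda>z. G z u v) y = dd u f y \<bullet> dd w (dd v f) y + dd w (dd u f) y \<bullet> dd v f y"
  unfolding G_eq by (intro dd_inner diff_dd assms)

lemma linear_inner_dd: "y \<in> S \<Longrightarrow> linear (\<lambda>w. x \<bullet> dd w f y)"
  using linear_compose[OF linear_dd_f(1) bounded_linear.linear[OF bounded_linear_inner_right]]
  by (auto simp: o_def)

text \<open>Expanding the Koszul formula for an induced metric gives six products of a second and a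
  first derivative, four of which cancel by symmetry of second derivatives. The Christoffel symbol
  is thus the coordinate vector of the tangential part of the second derivative.\<close>

lemma christoffel_eq:
  assumes "y \<in> S"
  shows "\<Gamma> y u v = metric_dual (G y) (\<lambda>w. dd u (dd v f) y \<bullet> dd w f y)"
proof -
  have "(frechet_derivative (\<lambda>z. G z v w) (at y) u + frechet_derivative (\<lambda>z. G z u w) (at y) v
      - frechet_derivative (\<lambda>z. G z u v) (at y) w) / 2 = dd u (dd v f) y \<bullet> dd w f y" for w
  proof -
    have *: "frechet_derivative (\<lambda>z. G z p q) (at y) w =
        dd p f y \<bullet> dd w (dd q f) y + dd w (dd p f) y \<bullet> dd q f y" for p q w
      using dd_G[OF assms] by (simp add: dd_def)
    show ?thesis unfolding * using dd_sym[OF assms, of u v] dd_sym[OF assms, of w u] dd_sym[OF assms, of w v]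
      by (simp add: inner_commute)
  qed
  then show ?thesis unfolding christoffel_def by simp
qed

lemma G_christoffel: "y \<in> S \<Longrightarrow> G y (\<Gamma> y u v) w = dd u (dd v f) y \<bullet> dd w f y"
  by (simp add: christoffel_eq metric_dual_works[OF inner_form_G linear_inner_dd])

lemma smooth_christoffel: "smooth_map_on S (\<lambda>y. \<Gamma> y u v)"
proof -
  have "smooth_map_on S (\<lambda>y. metric_dual (G y) (\<lambda>w. dd u (dd v f) y \<bullet> dd w f y))"
    by (intro smooth_on_metric_dual open_S inner_form_G smooth_G linear_inner_dd smooth_on_inner smooth_dd)
  then show ?thesis by (subst smooth_on_cong[OF open_S christoffel_eq])
qed

lemma christoffel_sym: "y \<in> S \<Longrightarrow> \<Gamma> y u v = \<Gamma> y v u"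
  by (simp add: christoffel_eq dd_sym[of y u v])

lemma linear_christoffel:
  assumes "y \<in> S" shows "linear (\<lambda>u. \<Gamma> y u v)" "linear (\<lambda>v. \<Gamma> y u v)"
proof -
  note L = linear_dd_f(2)[OF assms]
  show "linear (\<lambda>u. \<Gamma> y u v)" for v
    by (rule linearI; rule G_ext[OF assms])
      (simp_all add: linear_add[OF G_linear(1)[OF assms]] linear_cmul[OF G_linear(1)[OF assms]]
        G_christoffel[OF assms] linear_add[OF L] linear_cmul[OF L] inner_add_left)
  then show "linear (\<lambda>v. \<Gamma> y u v)" unfolding christoffel_sym[OF assms, of u] .
qed

lemma levi_civita_const: "levi_civita G (\<lambda>_. u) (\<lambda>_. v) = (\<lambda>y. \<Gamma> y u v)"
  by (simp add: levi_civita_def)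

lemma second_fundamental_form_eq: "h y u v = dd u (dd v f) y - dd (\<Gamma> y u v) f y"
  by (simp add: second_fundamental_form_def levi_civita_const dd_def)

lemma normal_h: "y \<in> S \<Longrightarrow> h y u v \<bullet> dd w f y = 0"
  using G_christoffel[of y u v w] by (simp add: second_fundamental_form_eq inner_diff_left G_eq)

lemma h_sym: "y \<in> S \<Longrightarrow> h y u v = h y v u"
  by (simp add: second_fundamental_form_eq dd_sym[of y u v] christoffel_sym[of y u v])

lemma linear_h:
  assumes "y \<in> S" shows "linear (\<lambda>u. h y u v)" "linear (\<lambda>v. h y u v)"
proof -
  show "linear (\<lambda>u. h y u v)" for v
    unfolding second_fundamental_form_eq
    using linear_compose_sub[OF linear_dd_f(2)[OF assms] linear_compose[OF linear_christoffel(1)[OF assms] linear_dd_f(1)[OF assms]]]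
    by (simp add: o_def)
  then show "linear (\<lambda>v. h y u v)" unfolding h_sym[OF assms, of u] .
qed

lemma dd_dd_inner_h: "y \<in> S \<Longrightarrow> dd u (dd v f) y \<bullet> h y w z = h y u v \<bullet> h y w z"
  unfolding second_fundamental_form_eq[of y u v] inner_diff_left
  using normal_h[of y w z "\<Gamma> y u v"] by (simp add: inner_commute)

text \<open>A product rule for a point-dependent linear map applied to a moving vector. Expanding
  the vector in the fixed basis reduces it to real coefficients, so differentiability of L is asked
  only for fixed arguments.\<close>

lemma dd_linear_arg:
  assumes "y \<in> S" "\<And>z. z \<in> S \<Longrightarrow> linear (L z)" "\<And>v. (\<lambda>z. L z v) differentiable (at y)" "V differentiable (at y)"
  shows "((\<lambda>z. L z (V z)) has_derivative (\<lambda>w. dd w (\<lambda>z. L z (V y)) y + L y (dd w V y))) (at y)"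
    "dd w (\<lambda>z. L z (V z)) y = dd w (\<lambda>z. L z (V y)) y + L y (dd w V y)"
proof -
  let ?D = "\<lambda>w. \<Sum>b\<in>Basis. (V y \<bullet> b) *\<^sub>R dd w (\<lambda>z. L z b) y + (dd w V y \<bullet> b) *\<^sub>R L y b"
  have D: "((\<lambda>z. \<Sum>b\<in>Basis. (V z \<bullet> b) *\<^sub>R L z b) has_derivative ?D) (at y)"
    by (intro has_derivative_sum has_derivative_scaleR has_derivative_inner_left dd_works assms)
  have 1: "((\<lambda>z. L z (V z)) has_derivative ?D) (at y)"
    by (rule has_derivative_transform_within_open[OF D open_S assms(1)])
      (rule linear_expand[OF assms(2), symmetric])
  have "?D w = dd w (\<lambda>z. L z (V y)) y + L y (dd w V y)" for w
    by (simp only: sum.distrib linear_expand[OF assms(2)[OF assms(1)], of "dd w V y", symmetric]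
      linear_expand[OF linear_dd_param[OF open_S assms(1-3)], of w "V y", symmetric])
  with 1 show 2: "((\<lambda>z. L z (V z)) has_derivative (\<lambda>w. dd w (\<lambda>z. L z (V y)) y + L y (dd w V y))) (at y)" by simp
  show "dd w (\<lambda>z. L z (V z)) y = dd w (\<lambda>z. L z (V y)) y + L y (dd w V y)" by (rule dd_eqI[OF 2])
qed

text \<open>Obtained by differentiating G (\<Gamma> v w) z = D^2 f (v, w) . df z in direction u. The
  third derivative is symmetric in u and v, so antisymmetrising leaves the Gauss equation.\<close>

lemma G_covariant_derivative_twice:
  assumes "y \<in> S"
  shows "G y (levi_civita G (\<lambda>_. u) (levi_civita G (\<lambda>_. v) (\<lambda>_. w)) y) z =
     dd u (dd v (dd w f)) y \<bullet> dd z f y + h y v w \<bullet> h y u z"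
proof -
  let ?c = "\<Gamma> y v w"
  have d\<Gamma>: "(\<lambda>y. \<Gamma> y v w) differentiable (at y)" by (rule smooth_onD(1)[OF smooth_christoffel assms])
  have "dd u (\<lambda>x. G x (\<Gamma> x v w) z) y = dd u (\<lambda>x. G x ?c z) y + G y (dd u (\<lambda>x. \<Gamma> x v w) y) z"
    using dd_linear_arg(2)[of y "\<lambda>x a. G x a z", OF assms G_linear(1) smooth_onD(1)[OF smooth_G assms] d\<Gamma>] .
  moreover have "dd u (\<lambda>x. G x (\<Gamma> x v w) z) y = dd u (\<lambda>x. dd v (dd w f) x \<bullet> dd z f x) y"
    by (rule dd_cong_open[OF open_S assms G_christoffel])
  moreover have "\<dots> = dd v (dd w f) y \<bullet> dd u (dd z f) y + dd u (dd v (dd w f)) y \<bullet> dd z f y"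
    by (intro dd_inner diff_dd assms)
  ultimately have "G y (dd u (\<lambda>x. \<Gamma> x v w) y) z = dd v (dd w f) y \<bullet> dd u (dd z f) y + dd u (dd v (dd w f)) y \<bullet> dd z f y
      - dd ?c f y \<bullet> dd u (dd z f) y - dd u (dd ?c f) y \<bullet> dd z f y"
    by (simp add: dd_G[OF assms])
  moreover have "levi_civita G (\<lambda>_. u) (levi_civita G (\<lambda>_. v) (\<lambda>_. w)) y = dd u (\<lambda>x. \<Gamma> x v w) y + \<Gamma> y u ?c"
    unfolding levi_civita_const unfolding levi_civita_def dd_def by (rule refl)
  moreover have "dd u (dd z f) y \<bullet> h y v w = h y u z \<bullet> h y v w" by (rule dd_dd_inner_h[OF assms])
  ultimately show ?thesis
    by (simp add: linear_add[OF G_linear(1)[OF assms]] G_christoffel[OF assms] second_fundamental_form_eq[of y v w]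
        inner_diff_left inner_diff_right inner_commute)
qed

lemma curvature_op_eq:
  assumes "y \<in> S"
  shows "curvature_op G y u v w = levi_civita G (\<lambda>_. u) (levi_civita G (\<lambda>_. v) (\<lambda>_. w)) y
    - levi_civita G (\<lambda>_. v) (levi_civita G (\<lambda>_. u) (\<lambda>_. w)) y"
proof -
  have "levi_civita G (lie_bracket (\<lambda>_. u) (\<lambda>_. v)) (\<lambda>_. w) y = 0"
    using linear_0[OF linear_christoffel(1)[OF assms]] by (simp add: lie_bracket_def levi_civita_def)
  then show ?thesis by (simp add: curvature_op_def curvature_field_def)
qed

lemma gauss_equation:
  assumes "y \<in> S"
  shows "riemann G y u v w z = h y v w \<bullet> h y u z - h y u w \<bullet> h y v z"
proof -
  have "dd u (dd v (dd w f)) y = dd v (dd u (dd w f)) y"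
    by (rule dd_commute[OF open_S assms smooth_dd(1)])
  then show ?thesis
    unfolding riemann_def curvature_op_eq[OF assms] linear_diff[OF G_linear(1)[OF assms]]
      G_covariant_derivative_twice[OF assms] by simp
qed

lemma linear_curvature_op:
  assumes "y \<in> S" shows "linear (\<lambda>u. curvature_op G y u v w)"
  by (rule linearI; rule G_ext[OF assms])
    (simp_all add: linear_add[OF G_linear(1)[OF assms]] linear_cmul[OF G_linear(1)[OF assms]]
      gauss_equation[OF assms, unfolded riemann_def] linear_add[OF linear_h(1)[OF assms]] linear_cmul[OF linear_h(1)[OF assms]]
      algebra_simps)

lemma ricci_eq:
  assumes "y \<in> S" "orthonormal_frame (G y) e"
  shows "ricci G y u v = (\<Sum>i=1..DIM('a). h y u v \<bullet> h y (e i) (e i) - h y (e i) v \<bullet> h y u (e i))"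
  unfolding ricci_def linear_trace_eq[OF inner_form_G[OF assms(1)] assms(2) linear_curvature_op[OF assms(1)]]
  by (simp add: gauss_equation[OF assms(1), unfolded riemann_def])

lemma scalar_curvature_eq:
  assumes "y \<in> S" "orthonormal_frame (G y) e"
  shows "scalar_curvature G y = (\<Sum>i=1..DIM('a). \<Sum>j=1..DIM('a).
     h y (e i) (e i) \<bullet> h y (e j) (e j) - h y (e i) (e j) \<bullet> h y (e i) (e j))"
proof -
  note L = linear_h[OF assms(1)]
  have "linear (\<lambda>u. ricci G y u v)" "linear (\<lambda>v. ricci G y u v)" for u v
    by (auto intro!: linearI simp: ricci_eq[OF assms] linear_add[OF L(1)] linear_add[OF L(2)]
        linear_cmul[OF L(1)] linear_cmul[OF L(2)] inner_add_left inner_add_right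
        sum.distrib sum_subtractf sum_distrib_left right_diff_distrib)
  from metric_trace_eq[OF inner_form_G[OF assms(1)] assms(2) this]
  have "scalar_curvature G y = (\<Sum>i=1..DIM('a). \<Sum>j=1..DIM('a).
     h y (e i) (e i) \<bullet> h y (e j) (e j) - h y (e j) (e i) \<bullet> h y (e i) (e j))"
    unfolding scalar_curvature_def ricci_eq[OF assms] .
  then show ?thesis by (simp only: h_sym[OF assms(1), of "e j" "e i" for i j])
qed

lemma flat_at_if_h_zero:
  assumes "y \<in> S" "\<And>u v. h y u v = 0"
  shows "flat_at G y"
  unfolding flat_at_def
proof (intro allI, rule G_ext[OF assms(1)])
  fix u v w z
  show "G y (curvature_op G y u v w) z = G y 0 z"
    using gauss_equation[OF assms(1), of u v w z] linear_0[OF G_linear(1)[OF assms(1)]] by (simp add: riemann_def assms(2))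
qed

end

section \<open>Linear algebra of the equality case\<close>

lemma sum_split_first_two:
  fixes g :: "nat \<Rightarrow> 'c::comm_monoid_add"
  assumes "n \<ge> 2"
  shows "sum g {1..n} = g 1 + g 2 + sum g {3..n}"
proof -
  have "{1..n} = {1,2} \<union> {3..n}" using assms by auto
  then show ?thesis by (simp add: sum.union_disjoint add.assoc)
qed

text \<open>The identity \<open>\<Sum> \<bar>x - \<eta>\<bar>\<^sup>2 = \<Sum> \<bar>x\<bar>\<^sup>2 - (n - 1) \<bar>\<eta>\<bar>\<^sup>2\<close> for the \<open>n - 1\<close> vectors
  \<open>H 1 1 + H 2 2\<close>, \<open>H 3 3\<close>, ..., \<open>H n n\<close> with mean \<open>\<eta>\<close>.\<close>

lemma chen_sum_identity:
  fixes H :: "nat \<Rightarrow> nat \<Rightarrow> 'b::real_inner"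
  assumes n: "n \<ge> 2" and sym: "H 2 1 = H 1 2"
    and tr: "(\<Sum>i=1..n. H i i) = real (n - 1) *\<^sub>R \<eta>"
    and eq: "(\<Sum>i=1..n. \<Sum>j=1..n. H i j \<bullet> H i j) + 2 * (H 1 1 \<bullet> H 2 2) - 2 * (H 1 2 \<bullet> H 1 2) = real (n - 1) * (\<eta> \<bullet> \<eta>)"
  shows "(\<Sum>j=3..n. H 1 j \<bullet> H 1 j) + (\<Sum>j=3..n. H 2 j \<bullet> H 2 j) + (\<Sum>i=3..n. H i 1 \<bullet> H i 1) + (\<Sum>i=3..n. H i 2 \<bullet> H i 2)
     + (\<Sum>i=3..n. \<Sum>j=3..n. (H i j - (if i = j then \<eta> else 0)) \<bullet> (H i j - (if i = j then \<eta> else 0)))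
     + (H 1 1 + H 2 2 - \<eta>) \<bullet> (H 1 1 + H 2 2 - \<eta>) = 0"
proof -
  have block: "(\<Sum>i=3..n. \<Sum>j=3..n. (H i j - (if i = j then \<eta> else 0)) \<bullet> (H i j - (if i = j then \<eta> else 0)))
    = (\<Sum>i=3..n. \<Sum>j=3..n. H i j \<bullet> H i j) - 2 * ((\<Sum>i=3..n. H i i) \<bullet> \<eta>) + real (n - 2) * (\<eta> \<bullet> \<eta>)"
  proof -
    have "(\<Sum>j=3..n. (H i j - (if i = j then \<eta> else 0)) \<bullet> (H i j - (if i = j then \<eta> else 0)))
      = (\<Sum>j=3..n. H i j \<bullet> H i j) - 2 * (H i i \<bullet> \<eta>) + \<eta> \<bullet> \<eta>" if "i \<in> {3..n}" for i
    proof -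
      have "(\<Sum>j=3..n. (H i j - (if i = j then \<eta> else 0)) \<bullet> (H i j - (if i = j then \<eta> else 0)))
        = (\<Sum>j=3..n. H i j \<bullet> H i j + (if i = j then \<eta> \<bullet> \<eta> - 2 * (H i i \<bullet> \<eta>) else 0))"
        by (intro sum.cong) (auto simp: inner_diff_left inner_diff_right inner_commute)
      then show ?thesis using that by (simp add: sum.distrib)
    qed
    then show ?thesis
      by (simp add: sum.distrib sum_subtractf sum_distrib_left[symmetric] inner_sum_left of_nat_diff n)
  qed
  have tr': "(\<Sum>i=3..n. H i i) = real (n - 1) *\<^sub>R \<eta> - H 1 1 - H 2 2"
    using tr sum_split_first_two[OF n, of "\<lambda>i. H i i"] by (simp add: algebra_simps)
  have sq: "(\<Sum>i=1..n. \<Sum>j=1..n. H i j \<bullet> H i j) = H 1 1 \<bullet> H 1 1 + 2 * (H 1 2 \<bullet> H 1 2) + H 2 2 \<bullet> H 2 2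
     + (\<Sum>j=3..n. H 1 j \<bullet> H 1 j) + (\<Sum>j=3..n. H 2 j \<bullet> H 2 j) + (\<Sum>i=3..n. H i 1 \<bullet> H i 1) + (\<Sum>i=3..n. H i 2 \<bullet> H i 2)
     + (\<Sum>i=3..n. \<Sum>j=3..n. H i j \<bullet> H i j)"
    unfolding sum_split_first_two[OF n] by (simp add: sum.distrib sym[simplified])
  have "real (n - 1) = real (n - 2) + 1" using n by (simp add: of_nat_diff)
  then show ?thesis using eq unfolding sq block tr'
    by (simp add: inner_diff_left inner_diff_right inner_add_left inner_add_right inner_commute algebra_simps)
qed

text \<open>Each term of a vanishing sum of squared norms is zero: the rigidity behind equality in
  Chen's inequality.\<close>

lemma chen_sum_identity_zero:
  fixes H :: "nat \<Rightarrow> nat \<Rightarrow> 'b::real_inner"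
  assumes "n \<ge> 2" "H 2 1 = H 1 2"
    "(\<Sum>i=1..n. H i i) = real (n - 1) *\<^sub>R \<eta>"
    "(\<Sum>i=1..n. \<Sum>j=1..n. H i j \<bullet> H i j) + 2 * (H 1 1 \<bullet> H 2 2) - 2 * (H 1 2 \<bullet> H 1 2) = real (n - 1) * (\<eta> \<bullet> \<eta>)"
  shows "H 1 1 + H 2 2 = \<eta>"
    "\<And>j. 3 \<le> j \<Longrightarrow> j \<le> n \<Longrightarrow> H 1 j = 0" "\<And>j. 3 \<le> j \<Longrightarrow> j \<le> n \<Longrightarrow> H 2 j = 0"
    "\<And>i j. 3 \<le> i \<Longrightarrow> i \<le> n \<Longrightarrow> 3 \<le> j \<Longrightarrow> j \<le> n \<Longrightarrow> H i j = (if i = j then \<eta> else 0)"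
proof -
  have nn: "(\<Sum>j\<in>J. F j \<bullet> F j) \<ge> 0" for J :: "nat set" and F :: "nat \<Rightarrow> 'b" by (simp add: sum_nonneg)
  have z: "F j = 0" if "(\<Sum>j=3..n. F j \<bullet> F j) = 0" "3 \<le> j" "j \<le> n" for F :: "nat \<Rightarrow> 'b" and j
    using that sum_nonneg_eq_0_iff[of "{3..n}" "\<lambda>j. F j \<bullet> F j"] by auto
  let ?M = "\<lambda>i j. H i j - (if i = j then \<eta> else 0)"
  have nn2: "(\<Sum>i=3..n. \<Sum>j=3..n. ?M i j \<bullet> ?M i j) \<ge> 0" by (intro sum_nonneg) simp
  have nn3: "(H 1 1 + H 2 2 - \<eta>) \<bullet> (H 1 1 + H 2 2 - \<eta>) \<ge> 0" by simp
  note id = chen_sum_identity[OF assms]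
  note nns = nn[of "\<lambda>j. H 1 j" "{3..n}"] nn[of "\<lambda>j. H 2 j" "{3..n}"] nn[of "\<lambda>i. H i 1" "{3..n}"] nn[of "\<lambda>i. H i 2" "{3..n}"] nn2 nn3
  have "(H 1 1 + H 2 2 - \<eta>) \<bullet> (H 1 1 + H 2 2 - \<eta>) = 0" using id nns by linarith
  then show "H 1 1 + H 2 2 = \<eta>" by simp
  have "(\<Sum>j=3..n. H 1 j \<bullet> H 1 j) = 0" using id nns by linarith
  then show "3 \<le> j \<Longrightarrow> j \<le> n \<Longrightarrow> H 1 j = 0" for j by (rule z)
  have "(\<Sum>j=3..n. H 2 j \<bullet> H 2 j) = 0" using id nns by linarith
  then show "3 \<le> j \<Longrightarrow> j \<le> n \<Longrightarrow> H 2 j = 0" for j by (rule z)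
  have 0: "(\<Sum>i=3..n. \<Sum>j=3..n. ?M i j \<bullet> ?M i j) = 0" using id nns by linarith
  show "H i j = (if i = j then \<eta> else 0)" if "3 \<le> i" "i \<le> n" "3 \<le> j" "j \<le> n" for i j
  proof -
    have "(\<Sum>j=3..n. ?M i j \<bullet> ?M i j) = 0" using 0 that
      by (subst (asm) sum_nonneg_eq_0_iff) (auto intro: sum_nonneg)
    from z[OF this that(3,4)] show ?thesis by simp
  qed
qed

text \<open>\<open>R\<close> is the Gauss expression of the curvature in a frame whose first two
  vectors span E, and \<open>C\<close> is the R-check tensor. For a first index in E the nonzero
  components are \<kappa> up to sign, inside E, and the mixed ones, which H i i = \<eta> for i \<ge>
  3 turns into entries of \<open>B\<close>. The four values are those that the weakly Einstein
  condition compares.\<close>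

lemma weakly_einstein_sums:
  fixes H :: "nat \<Rightarrow> nat \<Rightarrow> 'b::real_inner"
  assumes n: "n \<ge> 3" and sym: "H 2 1 = H 1 2" and tr: "H 1 1 + H 2 2 = \<eta>"
    and 1: "\<And>j. 3 \<le> j \<Longrightarrow> j \<le> n \<Longrightarrow> H 1 j = 0" and 2: "\<And>j. 3 \<le> j \<Longrightarrow> j \<le> n \<Longrightarrow> H 2 j = 0"
    and 3: "\<And>i. 3 \<le> i \<Longrightarrow> i \<le> n \<Longrightarrow> H i 1 = 0" and 4: "\<And>i. 3 \<le> i \<Longrightarrow> i \<le> n \<Longrightarrow> H i 2 = 0"
    and 5: "\<And>i j. 3 \<le> i \<Longrightarrow> i \<le> n \<Longrightarrow> 3 \<le> j \<Longrightarrow> j \<le> n \<Longrightarrow> H i j = (if i = j then \<eta> else 0)"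
  defines "R \<equiv> \<lambda>a i j k. H i j \<bullet> H a k - H a j \<bullet> H i k"
  defines "C \<equiv> \<lambda>a b. \<Sum>i=1..n. \<Sum>j=1..n. \<Sum>k=1..n. R a i j k * R b i j k"
  defines "B \<equiv> \<lambda>a b. \<eta> \<bullet> H a b"
  defines "\<kappa> \<equiv> H 1 1 \<bullet> H 2 2 - H 1 2 \<bullet> H 1 2"
  shows "C 1 1 = 2 * \<kappa>\<^sup>2 + 2 * real (n - 2) * ((B 1 1)\<^sup>2 + (B 1 2)\<^sup>2)"
    "C 2 2 = 2 * \<kappa>\<^sup>2 + 2 * real (n - 2) * ((B 1 2)\<^sup>2 + (B 2 2)\<^sup>2)"
    "C 1 2 = 2 * real (n - 2) * (B 1 1 * B 1 2 + B 1 2 * B 2 2)"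
    "C 3 3 = 2 * ((B 1 1)\<^sup>2 + 2 * (B 1 2)\<^sup>2 + (B 2 2)\<^sup>2) + 2 * real (n - 3) * (\<eta> \<bullet> \<eta>)\<^sup>2"
proof -
  have n2: "n \<ge> 2" using n by simp
  \<comment> \<open>Indices i in {1, 2} see only the curvature inside E; each of the n - 2 remaining
    i contributes the same mixed term, twice because the last two slots may be exchanged.\<close>
  have ab: "C a b = (\<Sum>i\<in>{1,2}. \<Sum>j\<in>{1,2}. \<Sum>k\<in>{1,2}. R a i j k * R b i j k)
      + 2 * real (n - 2) * (B a 1 * B b 1 + B a 2 * B b 2)"
    if "a \<in> {1,2}" "b \<in> {1,2}" for a b
  proof -
    have a0: "H a j = 0" "H b j = 0" if "3 \<le> j" "j \<le> n" for j using that \<open>a \<in> {1,2}\<close> \<open>b \<in> {1,2}\<close> 1 2 by auto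
    have low: "(\<Sum>j=1..n. \<Sum>k=1..n. R a i j k * R b i j k) = (\<Sum>j\<in>{1,2}. \<Sum>k\<in>{1,2}. R a i j k * R b i j k)"
      if "i \<in> {1,2}" for i
    proof -
      have i0: "H i j = 0" if "3 \<le> j" "j \<le> n" for j using that \<open>i \<in> {1,2}\<close> 1 2 by auto
      show ?thesis unfolding sum_split_first_two[OF n2] R_def by (simp add: a0 i0)
    qed
    have high: "(\<Sum>j=1..n. \<Sum>k=1..n. R a i j k * R b i j k) = 2 * (B a 1 * B b 1 + B a 2 * B b 2)"
      if i: "3 \<le> i" "i \<le> n" for i
    proof -
      have A: "R a i j c * R b i j c = (if j = i then B a c * B b c else 0)"
        "R a i c j * R b i c j = (if j = i then B a c * B b c else 0)"
        if "3 \<le> j" "j \<le> n" "c \<in> {1,2}" for j c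
        using that i 3[OF i] 4[OF i] by (auto simp: R_def B_def 5[OF i that(1,2)] a0 inner_commute)
      have Z: "R a i j k = 0" if "3 \<le> j" "j \<le> n" "3 \<le> k" "k \<le> n" for j k
        using that by (simp add: R_def a0)
      have W: "R a i c c' = 0" if "c \<in> {1,2}" "c' \<in> {1,2}" for c c'
        using that 3[OF i] 4[OF i] by (auto simp: R_def)
      show ?thesis unfolding sum_split_first_two[OF n2]
        by (simp add: A Z W sum.distrib i)
    qed
    have "C a b = (\<Sum>i\<in>{1,2}. \<Sum>j=1..n. \<Sum>k=1..n. R a i j k * R b i j k) + (\<Sum>i=3..n. \<Sum>j=1..n. \<Sum>k=1..n. R a i j k * R b i j k)"
      unfolding C_def sum_split_first_two[OF n2, of "\<lambda>i. \<Sum>j=1..n. \<Sum>k=1..n. R a i j k * R b i j k"] by simp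
    also have "(\<Sum>i\<in>{1,2}. \<Sum>j=1..n. \<Sum>k=1..n. R a i j k * R b i j k) = (\<Sum>i\<in>{1,2}. \<Sum>j\<in>{1,2}. \<Sum>k\<in>{1,2}. R a i j k * R b i j k)"
      by (rule sum.cong[OF refl low])
    also have "(\<Sum>i=3..n. \<Sum>j=1..n. \<Sum>k=1..n. R a i j k * R b i j k) = (\<Sum>i=3..n. 2 * (B a 1 * B b 1 + B a 2 * B b 2))"
      by (intro sum.cong refl high) auto
    finally show ?thesis using n by (simp add: of_nat_diff algebra_simps)
  qed
  show "C 1 1 = 2 * \<kappa>\<^sup>2 + 2 * real (n - 2) * ((B 1 1)\<^sup>2 + (B 1 2)\<^sup>2)"
    by (subst ab) (auto simp: R_def \<kappa>_def sym[simplified] power2_eq_square inner_commute algebra_simps)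
  show "C 2 2 = 2 * \<kappa>\<^sup>2 + 2 * real (n - 2) * ((B 1 2)\<^sup>2 + (B 2 2)\<^sup>2)"
    by (subst ab) (auto simp: R_def \<kappa>_def B_def sym[simplified] power2_eq_square inner_commute algebra_simps)
  show "C 1 2 = 2 * real (n - 2) * (B 1 1 * B 1 2 + B 1 2 * B 2 2)"
    by (subst ab) (auto simp: R_def \<kappa>_def B_def sym[simplified] power2_eq_square inner_commute algebra_simps)
  have H3: "H 3 k = (if k = 3 then \<eta> else 0)" if "k \<in> {1..n}" for k
  proof -
    have "k = 1 \<or> k = 2 \<or> 3 \<le> k" using that by auto
    then show ?thesis using that 3[of 3] 4[of 3] 5[of 3 k] n by auto
  qed
  \<comment> \<open>Since H 3 k is \<eta> for k = 3 and zero otherwise, R 3 i j k is the difference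
    of B i j, present for k = 3, and B i k, present for j = 3. The subtracted summand below is the
    cross term of its square.\<close>
  have i3: "(\<Sum>j=1..n. \<Sum>k=1..n. R 3 i j k * R 3 i j k) = 2 * (\<Sum>j=1..n. (B i j)\<^sup>2) - 2 * (B i 3)\<^sup>2"
    for i
  proof -
    have "R 3 i j k * R 3 i j k = (if k = 3 then (B i j)\<^sup>2 else 0) + (if j = 3 then (B i k)\<^sup>2 else 0)
       - (if k = 3 then (if j = 3 then 2 * (B i 3)\<^sup>2 else 0) else 0)" if "j \<in> {1..n}" "k \<in> {1..n}" for j k
      unfolding R_def H3[OF that(1)] H3[OF that(2)] by (auto simp: B_def power2_eq_square inner_commute algebra_simps)
    then have "(\<Sum>j=1..n. \<Sum>k=1..n. R 3 i j k * R 3 i j k) = (\<Sum>j=1..n. \<Sum>k=1..n. (if k = 3 then (B i j)\<^sup>2 else 0) + (if j = 3 then (B i k)\<^sup>2 else 0)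
       - (if k = 3 then (if j = 3 then 2 * (B i 3)\<^sup>2 else 0) else 0))"
      by (intro sum.cong refl) auto
    also have "\<dots> = (\<Sum>j=1..n. (B i j)\<^sup>2) + (\<Sum>j=1..n. (if j = 3 then (\<Sum>k=1..n. (B i k)\<^sup>2) else 0)) - 2 * (B i 3)\<^sup>2"
    proof -
      have "(\<Sum>k=1..n. (if j = 3 then (B i k)\<^sup>2 else 0)) = (if j = 3 then (\<Sum>k=1..n. (B i k)\<^sup>2) else 0)" for j :: nat
        by simp
      then show ?thesis using n by (simp add: sum.distrib sum_subtractf del: One_nat_def)
    qed
    finally show ?thesis using n by simp
  qed
  have B3: "(\<Sum>i=1..n. (B i 3)\<^sup>2) = (\<eta> \<bullet> \<eta>)\<^sup>2"
  proof -
    have "(\<Sum>i=3..n. (B i 3)\<^sup>2) = (\<Sum>i=3..n. if i = 3 then (\<eta> \<bullet> \<eta>)\<^sup>2 else 0)"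
      using n by (intro sum.cong refl) (auto simp: B_def 5)
    then show ?thesis unfolding sum_split_first_two[OF n2] using n by (simp add: B_def 1[simplified] 2)
  qed
  have BB: "(\<Sum>i=1..n. \<Sum>j=1..n. (B i j)\<^sup>2) = (B 1 1)\<^sup>2 + 2 * (B 1 2)\<^sup>2 + (B 2 2)\<^sup>2 + real (n - 2) * (\<eta> \<bullet> \<eta>)\<^sup>2"
  proof -
    have r: "(\<Sum>j=3..n. (B i j)\<^sup>2) = (\<eta> \<bullet> \<eta>)\<^sup>2" if "3 \<le> i" "i \<le> n" for i
    proof -
      have "(\<Sum>j=3..n. (B i j)\<^sup>2) = (\<Sum>j=3..n. if j = i then (\<eta> \<bullet> \<eta>)\<^sup>2 else 0)"
        using that by (intro sum.cong refl) (auto simp: B_def 5)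
      then show ?thesis using that by simp
    qed
    have z: "B 1 j = 0" "B 2 j = 0" "B j 1 = 0" "B j 2 = 0" if "3 \<le> j" "j \<le> n" for j
      using 1[OF that] 2[OF that] 3[OF that] 4[OF that] by (simp_all add: B_def)
    have s: "B 2 1 = B 1 2" by (simp only: B_def sym)
    show ?thesis unfolding sum_split_first_two[OF n2] using n by (simp add: r z s of_nat_diff del: One_nat_def)
  qed
  have nr: "real (n - 2) = real (n - 3) + 1" using n by (simp add: of_nat_diff)
  have "C 3 3 = 2 * (\<Sum>i=1..n. \<Sum>j=1..n. (B i j)\<^sup>2) - 2 * (\<Sum>i=1..n. (B i 3)\<^sup>2)"
    unfolding C_def i3 by (simp add: sum_subtractf sum_distrib_left)
  then show "C 3 3 = 2 * ((B 1 1)\<^sup>2 + 2 * (B 1 2)\<^sup>2 + (B 2 2)\<^sup>2) + 2 * real (n - 3) * (\<eta> \<bullet> \<eta>)\<^sup>2"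
    unfolding B3 BB nr by (simp add: algebra_simps)
qed

text \<open>If the mean curvature does not vanish, the sectional curvature \<open>\<kappa>\<close> of the distinguished plane is
  \<open>\<plusminus> \<eta>\<^sup>2 \<surd>(3n - 8) / 2\<close>, and the positive sign would exceed the upper bound \<open>\<eta>\<^sup>2 / 4\<close> of the Gauss equation.\<close>

lemma weakly_einstein_chen_algebra:
  fixes H11 H12 H22 \<eta> :: "'b::real_inner"
  assumes n: "n \<ge> 3" and tr: "H11 + H22 = \<eta>"
  defines "\<kappa> \<equiv> H11 \<bullet> H22 - H12 \<bullet> H12"
  defines "L \<equiv> \<eta> \<bullet> \<eta>" and "b11 \<equiv> \<eta> \<bullet> H11" and "b12 \<equiv> \<eta> \<bullet> H12" and "b22 \<equiv> \<eta> \<bullet> H22"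
  assumes e1: "2 * \<kappa>\<^sup>2 + 2 * real (n - 2) * (b11\<^sup>2 + b12\<^sup>2) = 2 * (b11\<^sup>2 + 2 * b12\<^sup>2 + b22\<^sup>2) + 2 * real (n - 3) * L\<^sup>2"
    and e2: "2 * \<kappa>\<^sup>2 + 2 * real (n - 2) * (b12\<^sup>2 + b22\<^sup>2) = 2 * (b11\<^sup>2 + 2 * b12\<^sup>2 + b22\<^sup>2) + 2 * real (n - 3) * L\<^sup>2"
    and e3: "2 * real (n - 2) * (b11 * b12 + b12 * b22) = 0"
  defines "p \<equiv> (1/2) *\<^sub>R (H11 - H22)" and "q \<equiv> H12"
  shows "\<eta> = 0 \<and> p = 0 \<and> q = 0 \<or>
    \<eta> \<noteq> 0 \<and> p \<bullet> \<eta> = 0 \<and> q \<bullet> \<eta> = 0 \<and> p \<bullet> p + q \<bullet> q = (1 + 2 * sqrt (3 * real n - 8)) / 4 * L"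
proof -
  \<comment> \<open>Trace and trace-free parts of h on E; \<kappa> becomes L / 4 minus the squared
    size of the trace-free part.\<close>
  have H: "H11 = (1/2) *\<^sub>R \<eta> + p" "H22 = (1/2) *\<^sub>R \<eta> - p" "H12 = q"
    by (simp_all add: p_def q_def tr[symmetric] algebra_simps) (simp_all add: scaleR_add_left[symmetric])
  have k: "\<kappa> = L / 4 - (p \<bullet> p + q \<bullet> q)"
    unfolding \<kappa>_def H L_def by (simp add: inner_add_left inner_diff_right inner_commute algebra_simps)
  have b: "b11 = L / 2 + p \<bullet> \<eta>" "b22 = L / 2 - p \<bullet> \<eta>" "b12 = q \<bullet> \<eta>"
    unfolding b11_def b12_def b22_def H L_def by (simp_all add: inner_add_right inner_diff_right inner_commute)
  show ?thesis
  proof (cases "\<eta> = 0")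
    case True
    then have "\<kappa>\<^sup>2 = 0" using e1 b by (simp add: L_def)
    then have "p \<bullet> p + q \<bullet> q = 0" using k True by (simp add: L_def)
    then have "p \<bullet> p = 0 \<and> q \<bullet> q = 0" by (smt (verit) inner_ge_zero)
    then show ?thesis using True by simp
  next
    case False
    then have L: "L > 0" by (simp add: L_def)
    have n2: "real (n - 2) \<noteq> 0" using n by simp
    have "2 * real (n - 2) * (b11\<^sup>2 + b12\<^sup>2) = 2 * real (n - 2) * (b12\<^sup>2 + b22\<^sup>2)" using e1 e2 by linarith
    then have "b11\<^sup>2 - b22\<^sup>2 = 0" using n2 by simp
    \<comment> \<open>The factor b11 + b22 equals L > 0, so b11 = b22; their difference is twice p .
      \<eta>.\<close>
    then have "(b11 - b22) * (b11 + b22) = 0" by (simp add: power2_eq_square algebra_simps)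
    then have p0: "p \<bullet> \<eta> = 0" using L by (simp add: b)
    have "b11 * b12 + b12 * b22 = 0" using e3 n2 by simp
    then have "b12 * (b11 + b22) = 0" by (simp add: algebra_simps)
    then have q0: "q \<bullet> \<eta> = 0" using L by (simp add: b)
    have r: "real (n - 2) = real n - 2" "real (n - 3) = real n - 3" using n by (simp_all add: of_nat_diff)
    have b': "b11 = L / 2" "b22 = L / 2" "b12 = 0" using b p0 q0 by auto
    \<comment> \<open>After division by 2 and insertion of b11 = b22 = L / 2, b12 = 0, the factor of
      (L / 2)^2 is 2 + 4 (n - 3) - (n - 2) = 3 n - 8.\<close>
    have "\<kappa>\<^sup>2 = (L / 2)\<^sup>2 * (3 * real n - 8)"
      using e1 unfolding b' r by (simp add: power2_eq_square algebra_simps)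
    also have "\<dots> = (L / 2 * sqrt (3 * real n - 8))\<^sup>2" using n by (subst power_mult_distrib) simp
    finally have "\<kappa> = L / 2 * sqrt (3 * real n - 8) \<or> \<kappa> = - (L / 2 * sqrt (3 * real n - 8))"
      by (simp add: power2_eq_iff)
    moreover have "\<kappa> < L / 2 * sqrt (3 * real n - 8)"
    proof -
      have "p \<bullet> p \<ge> 0" "q \<bullet> q \<ge> 0" by simp_all
      then have "\<kappa> < L / 2 * 1" using k L by linarith
      also have "\<dots> \<le> L / 2 * sqrt (3 * real n - 8)" using L n by (intro mult_left_mono) auto
      finally show ?thesis .
    qed
    ultimately have "\<kappa> = - (L / 2 * sqrt (3 * real n - 8))" by simp
    then have "p \<bullet> p + q \<bullet> q = (1 + 2 * sqrt (3 * real n - 8)) / 4 * L" using k by (simp add: algebra_simps)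
    then show ?thesis using False p0 q0 by simp
  qed
qed

section \<open>The plane of minimal curvature and the resulting form of h\<close>

context immersion_patch
begin

definition pair_curvature :: "'a \<Rightarrow> 'a \<Rightarrow> 'a \<Rightarrow> real" where
  "pair_curvature y u v = h y u u \<bullet> h y v v - h y u v \<bullet> h y u v"

lemma bounded_bilinear_h: "y \<in> S \<Longrightarrow> bounded_bilinear (h y)"
  using linear_h by (simp add: bilinear_conv_bounded_bilinear[symmetric] bilinear_def)

lemma bounded_bilinear_G: "y \<in> S \<Longrightarrow> bounded_bilinear (G y)"
  using G_linear by (simp add: bilinear_conv_bounded_bilinear[symmetric] bilinear_def)

lemma sectional_eq:
  "y \<in> S \<Longrightarrow> sectional G y u v = pair_curvature y u v / (G y u u * G y v v - (G y u v)\<^sup>2)"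
  by (simp add: sectional_def gauss_equation pair_curvature_def h_sym[of y v u] inner_commute)

text \<open>The curvature of a pair is a quadratic form in the bivector, so shearing leaves it
  unchanged and scaling multiplies it by the squared area factor; these are the moves of
  Gram-Schmidt.\<close>

lemma pair_curvature_scale_shear:
  assumes "y \<in> S"
  shows "pair_curvature y (r *\<^sub>R u) (s *\<^sub>R (v - t *\<^sub>R u)) = r\<^sup>2 * s\<^sup>2 * pair_curvature y u v"
  unfolding pair_curvature_def
  by (simp add: linear_cmul[OF linear_h(1)[OF assms]] linear_cmul[OF linear_h(2)[OF assms]]
      linear_diff[OF linear_h(1)[OF assms]] linear_diff[OF linear_h(2)[OF assms]] h_sym[OF assms, of v u]
      inner_diff_left inner_diff_right inner_commute power2_eq_square algebra_simps)

lemma sectional_orthonormalize: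
  assumes y: "y \<in> S" and "u \<noteq> v" "independent {u, v}"
  obtains e1 e2 where "G y e1 e1 = 1" "G y e2 e2 = 1" "G y e1 e2 = 0" "sectional G y u v = pair_curvature y e1 e2"
proof -
  have u0: "u \<noteq> 0" using assms(3) dependent_zero by blast
  have a: "G y u u > 0" using inner_formD(4)[OF inner_form_G[OF y] u0] .
  define t where "t = G y u v / G y u u"
  have "v - t *\<^sub>R u \<noteq> 0"
  proof
    assume "v - t *\<^sub>R u = 0"
    then have "v \<in> span {u}" by (auto simp: span_singleton)
    then have "v \<in> span ({u, v} - {v})" using assms(2) by (simp add: insert_Diff_if)
    then show False using assms(3) unfolding dependent_def by blast
  qed
  then have b: "G y (v - t *\<^sub>R u) (v - t *\<^sub>R u) > 0" using inner_formD(4)[OF inner_form_G[OF y]] by blast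
  note L = G_linear[OF y]
  have uv: "G y u (v - t *\<^sub>R u) = 0"
    using a by (simp add: linear_diff[OF L(2)] linear_cmul[OF L(2)] t_def)
  have bb: "G y (v - t *\<^sub>R u) (v - t *\<^sub>R u) = G y v v - (G y u v)\<^sup>2 / G y u u"
    using a by (simp add: linear_diff[OF L(1)] linear_diff[OF L(2)] linear_cmul[OF L(1)] linear_cmul[OF L(2)] t_def
        G_sym[OF y, of v u] power2_eq_square field_simps)
  let ?r = "1 / sqrt (G y u u)" and ?s = "1 / sqrt (G y (v - t *\<^sub>R u) (v - t *\<^sub>R u))"
  show ?thesis
  proof (rule that[of "?r *\<^sub>R u" "?s *\<^sub>R (v - t *\<^sub>R u)"])
    show "G y (?r *\<^sub>R u) (?r *\<^sub>R u) = 1" using a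
      by (simp only: linear_cmul[OF L(1)] linear_cmul[OF L(2)]) simp
    show "G y (?s *\<^sub>R (v - t *\<^sub>R u)) (?s *\<^sub>R (v - t *\<^sub>R u)) = 1" using b
      by (simp only: linear_cmul[OF L(1)] linear_cmul[OF L(2)]) simp
    show "G y (?r *\<^sub>R u) (?s *\<^sub>R (v - t *\<^sub>R u)) = 0"
      by (simp only: linear_cmul[OF L(1)] linear_cmul[OF L(2)] uv) simp
    have "?r\<^sup>2 * ?s\<^sup>2 = 1 / (G y u u * G y v v - (G y u v)\<^sup>2)"
      using a b by (simp add: power_divide) (simp add: bb field_simps)
    then show "sectional G y u v = pair_curvature y (?r *\<^sub>R u) (?s *\<^sub>R (v - t *\<^sub>R u))"
      unfolding pair_curvature_scale_shear[OF y] sectional_eq[OF y] by simp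
  qed
qed

text \<open>Gram-Schmidt reduces the infimum to orthonormal pairs, which form a compact set, bounded
  because the metric is coercive. Having a minimising plane is what allows Chen's equality to be
  read off in a frame that contains it.\<close>

lemma inf_sectional_attained:
  assumes y: "y \<in> S" and dim: "DIM('a) \<ge> 2"
  obtains e1 e2 where "G y e1 e1 = 1" "G y e2 e2 = 1" "G y e1 e2 = 0" "inf_sectional G y = pair_curvature y e1 e2"
proof -
  let ?C = "{x. G y (fst x) (fst x) = 1 \<and> G y (snd x) (snd x) = 1 \<and> G y (fst x) (snd x) = 0}"
  note cG = bounded_bilinear.continuous_on[OF bounded_bilinear_G[OF y]]
  note ch = bounded_bilinear.continuous_on[OF bounded_bilinear_h[OF y]]
  have "closed ?C"
    by (intro closed_Collect_conj closed_Collect_eq cG continuous_intros)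
  moreover have "bounded ?C"
  proof -
    obtain c where c: "c > 0" "\<And>v. c * (norm v)\<^sup>2 \<le> G y v v"
      using inner_form_coercive[OF inner_form_G[OF y]] by blast
    have n: "norm v \<le> sqrt (1 / c)" if "G y v v = 1" for v
    proof (rule real_le_rsqrt)
      show "(norm v)\<^sup>2 \<le> 1 / c" using c(2)[of v] c(1) that by (simp add: field_simps)
    qed
    have "norm x \<le> 2 * sqrt (1 / c)" if "x \<in> ?C" for x :: "'a \<times> 'a"
      using norm_Pair_le[of "fst x" "snd x"] n[of "fst x"] n[of "snd x"] that by simp
    then show ?thesis by (intro boundedI)
  qed
  ultimately have comp: "compact ?C" by (simp add: compact_eq_bounded_closed)
  obtain e where e: "orthonormal_frame (G y) e" using orthonormal_frame_exists[OF inner_form_G[OF y]] .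
  have ne: "?C \<noteq> {}"
  proof -
    have "(e 1, e 2) \<in> ?C" using e dim by (auto simp: orthonormal_frame_def)
    then show ?thesis by blast
  qed
  have "continuous_on ?C (\<lambda>x. pair_curvature y (fst x) (snd x))"
    unfolding pair_curvature_def by (intro continuous_intros ch)
  from continuous_attains_inf[OF comp ne this] obtain x where
    x: "x \<in> ?C" "\<And>z. z \<in> ?C \<Longrightarrow> pair_curvature y (fst x) (snd x) \<le> pair_curvature y (fst z) (snd z)" by blast
  obtain e1 e2 where x12: "x = (e1, e2)" by force
  have o: "G y e1 e1 = 1" "G y e2 e2 = 1" "G y e1 e2 = 0" using x(1) x12 by auto
  have le: "pair_curvature y e1 e2 \<le> pair_curvature y u v" if "G y u u = 1" "G y v v = 1" "G y u v = 0" for u v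
    using x(2)[of "(u, v)"] that x12 by simp
  have ind: "e1 \<noteq> e2" "independent {e1, e2}"
  proof -
    show ne: "e1 \<noteq> e2" using o by force
    note L = G_linear[OF y]
    have "e1 \<noteq> 0" using o(1) linear_0[OF L(1)] by force
    moreover have "e2 \<notin> span {e1}"
    proof
      assume "e2 \<in> span {e1}"
      then obtain k where "e2 = k *\<^sub>R e1" by (auto simp: span_singleton)
      then show False using o by (simp add: linear_cmul[OF L(2)] linear_cmul[OF L(1)])
    qed
    ultimately show "independent {e1, e2}" using ne by (simp add: insert_commute[of e1] independent_insert)
  qed
  show ?thesis
  proof (rule that[OF o])
    show "inf_sectional G y = pair_curvature y e1 e2"
      unfolding inf_sectional_def
    proof (rule cInf_eq_minimum)
      show "pair_curvature y e1 e2 \<in> {sectional G y u v |u v. u \<noteq> v \<and> independent {u, v}}"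
      proof -
        have "pair_curvature y e1 e2 = sectional G y e1 e2" using o by (simp add: sectional_eq[OF y])
        then show ?thesis using ind by blast
      qed
      fix s assume "s \<in> {sectional G y u v |u v. u \<noteq> v \<and> independent {u, v}}"
      then obtain u v where uv: "s = sectional G y u v" "u \<noteq> v" "independent {u, v}" by blast
      show "pair_curvature y e1 e2 \<le> s"
        using sectional_orthonormalize[OF y uv(2,3)] le uv(1) by metis
    qed
  qed
qed

text \<open>The trace is taken with a fixed basis and its metric duals instead of an orthonormal
  frame, so smoothness in y follows from that of the duals. The divisor n - 1 makes \<eta> the mean
  of the n - 1 vectors h e1 e1 + h e2 e2, h e3 e3, ... of any orthonormal frame.\<close>

definition \<eta> :: "'a \<Rightarrow> 'b" where
  "\<eta> y = (1 / real (DIM('a) - 1)) *\<^sub>R (\<Sum>b\<in>Basis. h y b (metric_dual (G y) (\<lambda>w. w \<bullet> b)))"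

lemma trace_h:
  assumes y: "y \<in> S" and e: "orthonormal_frame (G y) e" and dim: "DIM('a) \<ge> 3"
  shows "(\<Sum>i=1..DIM('a). h y (e i) (e i)) = real (DIM('a) - 1) *\<^sub>R \<eta> y"
    "mean_curvature_vector f y = (real (DIM('a) - 1) / DIM('a)) *\<^sub>R \<eta> y"
proof -
  show 1: "(\<Sum>i=1..DIM('a). h y (e i) (e i)) = real (DIM('a) - 1) *\<^sub>R \<eta> y"
    unfolding frame_trace_eq[OF inner_form_G[OF y] e linear_h[OF y]] \<eta>_def using dim by simp
  show "mean_curvature_vector f y = (real (DIM('a) - 1) / DIM('a)) *\<^sub>R \<eta> y"
    unfolding mean_curvature_vector_def metric_trace_eq[OF inner_form_G[OF y] e linear_h[OF y]] 1 by simp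
qed

lemma normal_\<eta>: "y \<in> S \<Longrightarrow> \<eta> y \<bullet> dd w f y = 0"
  by (simp add: \<eta>_def inner_sum_left normal_h)

text \<open>The vectors \<open>p\<close> and \<open>q\<close> are the entries of the trace-free part of the second fundamental form
  on the plane spanned by \<open>e1\<close> and \<open>e2\<close>.\<close>

definition chen_shape :: "'a \<Rightarrow> 'a \<Rightarrow> 'a \<Rightarrow> 'b \<Rightarrow> 'b \<Rightarrow> bool" where
  "chen_shape y e1 e2 p q \<longleftrightarrow> G y e1 e1 = 1 \<and> G y e2 e2 = 1 \<and> G y e1 e2 = 0 \<and>
     p \<bullet> \<eta> y = 0 \<and> q \<bullet> \<eta> y = 0 \<and>
     p \<bullet> p + q \<bullet> q = (1 + 2 * sqrt (3 * real DIM('a) - 8)) / 4 * (\<eta> y \<bullet> \<eta> y) \<and>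
     (\<forall>u v. h y u v = (G y u v - (G y u e1 * G y v e1 + G y u e2 * G y v e2) / 2) *\<^sub>R \<eta> y
        + (G y u e1 * G y v e1 - G y u e2 * G y v e2) *\<^sub>R p
        + (G y u e1 * G y v e2 + G y u e2 * G y v e1) *\<^sub>R q)"

text \<open>The first two frame vectors span a plane of minimal curvature, so
  \<open>inf_sectional\<close> becomes an expression in h. By the Gauss equation the scalar
  curvature is (n - 1)^2 |\<eta>|^2 - |h|^2, and Chen's equality contributes (n - 2) (n - 1)
  |\<eta>|^2; the difference of the coefficients is n - 1, as the sum-of-squares identity
  requires.\<close>

lemma chen_frame:
  assumes y: "y \<in> S" and dim: "DIM('a) \<ge> 3" and chen: "chen_equality_at f y"
  obtains e where "orthonormal_frame (G y) e"
    "h y (e 1) (e 1) + h y (e 2) (e 2) = \<eta> y"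
    "\<And>j. 3 \<le> j \<Longrightarrow> j \<le> DIM('a) \<Longrightarrow> h y (e 1) (e j) = 0" "\<And>j. 3 \<le> j \<Longrightarrow> j \<le> DIM('a) \<Longrightarrow> h y (e 2) (e j) = 0"
    "\<And>i j. 3 \<le> i \<Longrightarrow> i \<le> DIM('a) \<Longrightarrow> 3 \<le> j \<Longrightarrow> j \<le> DIM('a) \<Longrightarrow> h y (e i) (e j) = (if i = j then \<eta> y else 0)"
proof -
  let ?n = "DIM('a)"
  have n2: "?n \<ge> 2" using dim by simp
  obtain e1 e2 where o: "G y e1 e1 = 1" "G y e2 e2 = 1" "G y e1 e2 = 0"
    and inf: "inf_sectional G y = pair_curvature y e1 e2"
    using inf_sectional_attained[OF y n2] by blast
  let ?d = "\<lambda>i::nat. if i = 1 then e1 else e2"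
  have 12: "i \<in> {1..2::nat} \<longleftrightarrow> i = 1 \<or> i = 2" for i by auto
  have "orthonormal_upto (G y) 2 ?d"
    using o G_sym[OF y, of e2 e1] unfolding orthonormal_upto_def 12 by auto
  from orthonormal_frame_extension[OF inner_form_G[OF y] this n2] obtain e where
    e: "orthonormal_frame (G y) e" "\<And>i. i \<in> {1..2} \<Longrightarrow> e i = ?d i" by blast
  have e12: "e 1 = e1" "e 2 = e2" using e(2) by auto
  let ?H = "\<lambda>i j. h y (e i) (e j)"
  have sym: "?H 2 1 = ?H 1 2" by (rule h_sym[OF y])
  note tr = trace_h[OF y e(1) dim]
  have sc: "scalar_curvature G y = (real (?n - 1))\<^sup>2 * (\<eta> y \<bullet> \<eta> y) - (\<Sum>i=1..?n. \<Sum>j=1..?n. ?H i j \<bullet> ?H i j)"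
  proof -
    have "(\<Sum>i=1..?n. \<Sum>j=1..?n. ?H i i \<bullet> ?H j j) = (\<Sum>i=1..?n. ?H i i) \<bullet> (\<Sum>j=1..?n. ?H j j)"
      by (simp only: inner_sum_left) (simp only: inner_sum_right)
    then show ?thesis unfolding scalar_curvature_eq[OF y e(1)] sum_subtractf tr(1)
      by (simp add: power2_eq_square)
  qed
  have "(norm (mean_curvature_vector f y))\<^sup>2 = (real (?n - 1) / ?n)\<^sup>2 * (\<eta> y \<bullet> \<eta> y)"
    unfolding tr(2) by (simp add: power_mult_distrib power2_norm_eq_inner[symmetric] dot_square_norm power_divide)
  then have "(real ?n)\<^sup>2 * (real ?n - 2) / (2 * (real ?n - 1)) * (norm (mean_curvature_vector f y))\<^sup>2
    = (real ?n)\<^sup>2 * (real ?n - 2) / (2 * (real ?n - 1)) * ((real (?n - 1) / ?n)\<^sup>2 * (\<eta> y \<bullet> \<eta> y))" by simp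
  also have "\<dots> = (real ?n - 2) * (real ?n - 1) / 2 * (\<eta> y \<bullet> \<eta> y)"
    using dim by (simp add: of_nat_diff power_divide) (simp add: power2_eq_square field_simps)
  finally have "(real ?n)\<^sup>2 * (real ?n - 2) / (2 * (real ?n - 1)) * (norm (mean_curvature_vector f y))\<^sup>2
    = (real ?n - 2) * (real ?n - 1) / 2 * (\<eta> y \<bullet> \<eta> y)" .
  with chen have "scalar_curvature G y / 2 - pair_curvature y e1 e2 = (real ?n - 2) * (real ?n - 1) / 2 * (\<eta> y \<bullet> \<eta> y)"
    unfolding chen_equality_at_def inf by simp
  then have "(\<Sum>i=1..?n. \<Sum>j=1..?n. ?H i j \<bullet> ?H i j) + 2 * (?H 1 1 \<bullet> ?H 2 2) - 2 * (?H 1 2 \<bullet> ?H 1 2)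
    = (real (?n - 1))\<^sup>2 * (\<eta> y \<bullet> \<eta> y) - (real ?n - 2) * (real ?n - 1) * (\<eta> y \<bullet> \<eta> y)"
    unfolding sc pair_curvature_def e12 by (simp add: field_simps)
  also have "\<dots> = real (?n - 1) * (\<eta> y \<bullet> \<eta> y)"
    using dim by (simp add: of_nat_diff power2_eq_square algebra_simps)
  finally have eq: "(\<Sum>i=1..?n. \<Sum>j=1..?n. ?H i j \<bullet> ?H i j) + 2 * (?H 1 1 \<bullet> ?H 2 2) - 2 * (?H 1 2 \<bullet> ?H 1 2) = real (?n - 1) * (\<eta> y \<bullet> \<eta> y)" .
  note z = chen_sum_identity_zero[of ?n ?H, OF n2 sym tr(1) eq]
  show ?thesis by (rule that[OF e(1) z])
qed

lemma chen_weakly_einstein_shape: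
  assumes y: "y \<in> S" and dim: "DIM('a) \<ge> 3" and chen: "chen_equality_at f y" and we: "weakly_einstein_at G y"
  shows "(\<eta> y = 0 \<and> (\<forall>u v. h y u v = 0)) \<or> (\<eta> y \<noteq> 0 \<and> (\<exists>e1 e2 p q. chen_shape y e1 e2 p q))"
proof -
  let ?n = "DIM('a)" and ?\<eta> = "\<eta> y"
  obtain e where e: "orthonormal_frame (G y) e"
    and H: "h y (e 1) (e 1) + h y (e 2) (e 2) = \<eta> y"
    "\<And>j. 3 \<le> j \<Longrightarrow> j \<le> DIM('a) \<Longrightarrow> h y (e 1) (e j) = 0" "\<And>j. 3 \<le> j \<Longrightarrow> j \<le> DIM('a) \<Longrightarrow> h y (e 2) (e j) = 0"
    "\<And>i j. 3 \<le> i \<Longrightarrow> i \<le> DIM('a) \<Longrightarrow> 3 \<le> j \<Longrightarrow> j \<le> DIM('a) \<Longrightarrow> h y (e i) (e j) = (if i = j then \<eta> y else 0)"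
    using chen_frame[OF y dim chen] by blast
  have n2: "?n \<ge> 2" using dim by simp
  have H': "h y (e j) (e 1) = 0" "h y (e j) (e 2) = 0" if "3 \<le> j" "j \<le> DIM('a)" for j
    using H(2,3)[OF that] h_sym[OF y] by metis+
  let ?H = "\<lambda>i j. h y (e i) (e j)"
  let ?C = "\<lambda>a b. \<Sum>i=1..?n. \<Sum>j=1..?n. \<Sum>k=1..?n. (?H i j \<bullet> ?H a k - ?H a j \<bullet> ?H i k) * (?H i j \<bullet> ?H b k - ?H b j \<bullet> ?H i k)"
  have C: "?C a b = R_norm_sq G y e / ?n * G y (e a) (e b)" for a b
    using we[unfolded weakly_einstein_at_def, rule_format, OF e, of "e a" "e b"]
    unfolding R_check_def gauss_equation[OF y] .
  have o: "G y (e 1) (e 1) = 1" "G y (e 2) (e 2) = 1" "G y (e 1) (e 2) = 0" "G y (e 3) (e 3) = 1"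
    using e dim by (auto simp: orthonormal_frame_def)
  note sums = weakly_einstein_sums[of ?n ?H, OF dim h_sym[OF y] H(1-3) H' H(4)]
  let ?p = "(1/2) *\<^sub>R (?H 1 1 - ?H 2 2)" and ?q = "?H 1 2"
  have alg: "?\<eta> = 0 \<and> ?p = 0 \<and> ?q = 0 \<or>
    ?\<eta> \<noteq> 0 \<and> ?p \<bullet> ?\<eta> = 0 \<and> ?q \<bullet> ?\<eta> = 0 \<and> ?p \<bullet> ?p + ?q \<bullet> ?q = (1 + 2 * sqrt (3 * real ?n - 8)) / 4 * (?\<eta> \<bullet> ?\<eta>)"
  proof (rule weakly_einstein_chen_algebra[OF dim H(1)])
    \<comment> \<open>R-check is a multiple of the metric, so its diagonal entries in E and in D
      agree and its off-diagonal entry in E vanishes; the index 3 is the first one in D.\<close>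
    have 1: "?C 1 1 = ?C 3 3" "?C 2 2 = ?C 3 3" "?C 1 2 = 0" unfolding C o by simp_all
    show "2 * (?H 1 1 \<bullet> ?H 2 2 - ?H 1 2 \<bullet> ?H 1 2)\<^sup>2 + 2 * real (?n - 2) * ((?\<eta> \<bullet> ?H 1 1)\<^sup>2 + (?\<eta> \<bullet> ?H 1 2)\<^sup>2) =
      2 * ((?\<eta> \<bullet> ?H 1 1)\<^sup>2 + 2 * (?\<eta> \<bullet> ?H 1 2)\<^sup>2 + (?\<eta> \<bullet> ?H 2 2)\<^sup>2) + 2 * real (?n - 3) * (?\<eta> \<bullet> ?\<eta>)\<^sup>2"
      by (rule trans[OF sums(1)[symmetric] trans[OF 1(1) sums(4)]])
    show "2 * (?H 1 1 \<bullet> ?H 2 2 - ?H 1 2 \<bullet> ?H 1 2)\<^sup>2 + 2 * real (?n - 2) * ((?\<eta> \<bullet> ?H 1 2)\<^sup>2 + (?\<eta> \<bullet> ?H 2 2)\<^sup>2) =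
      2 * ((?\<eta> \<bullet> ?H 1 1)\<^sup>2 + 2 * (?\<eta> \<bullet> ?H 1 2)\<^sup>2 + (?\<eta> \<bullet> ?H 2 2)\<^sup>2) + 2 * real (?n - 3) * (?\<eta> \<bullet> ?\<eta>)\<^sup>2"
      by (rule trans[OF sums(2)[symmetric] trans[OF 1(2) sums(4)]])
    show "2 * real (?n - 2) * ((?\<eta> \<bullet> ?H 1 1) * (?\<eta> \<bullet> ?H 1 2) + (?\<eta> \<bullet> ?H 1 2) * (?\<eta> \<bullet> ?H 2 2)) = 0"
      by (rule trans[OF sums(3)[symmetric] 1(3)])
  qed
  define p q where "p = (1/2) *\<^sub>R (?H 1 1 - ?H 2 2)" and "q = ?H 1 2"
  note alg = alg[folded p_def q_def]
  have H12: "?H 1 1 = (1/2) *\<^sub>R ?\<eta> + p" "?H 2 2 = (1/2) *\<^sub>R ?\<eta> - p" "?H 1 2 = q"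
    unfolding p_def q_def H(1)[symmetric] by (simp_all add: algebra_simps scaleR_add_left[symmetric])
  \<comment> \<open>The block D contributes \<eta> times the sum of products over i \<ge> 3, which
    is G y u v minus the E-part; the trace part \<eta> / 2 on E gives half of the E-part
    back.\<close>
  have form: "h y u v = (G y u v - (G y u (e 1) * G y v (e 1) + G y u (e 2) * G y v (e 2)) / 2) *\<^sub>R ?\<eta>
        + (G y u (e 1) * G y v (e 1) - G y u (e 2) * G y v (e 2)) *\<^sub>R p
        + (G y u (e 1) * G y v (e 2) + G y u (e 2) * G y v (e 1)) *\<^sub>R q" for u v
  proof -
    have hu: "h y u v = (\<Sum>i=1..?n. \<Sum>j=1..?n. (G y u (e i) * G y v (e j)) *\<^sub>R ?H i j)"
    proof -
      have "h y u v = h y (\<Sum>i=1..?n. G y u (e i) *\<^sub>R e i) (\<Sum>j=1..?n. G y v (e j) *\<^sub>R e j)"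
        using orthonormal_frame_expand[OF inner_form_G[OF y] e] by simp
      then have "h y u v = (\<Sum>j=1..?n. \<Sum>i=1..?n. (G y v (e j) * G y u (e i)) *\<^sub>R ?H i j)"
        by (simp only: linear_sum[OF linear_h(1)[OF y]] linear_cmul[OF linear_h(1)[OF y]]
            linear_sum[OF linear_h(2)[OF y]] linear_cmul[OF linear_h(2)[OF y]] scaleR_sum_right scaleR_scaleR)
      then show ?thesis by (subst sum.swap) (simp add: mult.commute)
    qed
    have guv: "G y u v = (\<Sum>i=1..?n. G y u (e i) * G y v (e i))"
    proof -
      have "G y u v = G y (\<Sum>i=1..?n. G y u (e i) *\<^sub>R e i) v"
        using orthonormal_frame_expand[OF inner_form_G[OF y] e] by simp
      then show ?thesis by (simp only: linear_sum[OF G_linear(1)[OF y]] linear_cmul[OF G_linear(1)[OF y]]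
            real_scaleR_def G_sym[OF y, of "e _" v])
    qed
    have block: "(\<Sum>i=3..?n. \<Sum>j=3..?n. (G y u (e i) * G y v (e j)) *\<^sub>R ?H i j)
       = (\<Sum>i=3..?n. G y u (e i) * G y v (e i)) *\<^sub>R ?\<eta>"
    proof -
      have "(\<Sum>j=3..?n. (G y u (e i) * G y v (e j)) *\<^sub>R ?H i j) = (G y u (e i) * G y v (e i)) *\<^sub>R ?\<eta>"
        if "i \<in> {3..?n}" for i
      proof -
        have "(\<Sum>j=3..?n. (G y u (e i) * G y v (e j)) *\<^sub>R ?H i j) = (\<Sum>j=3..?n. if i = j then (G y u (e i) * G y v (e i)) *\<^sub>R ?\<eta> else 0)"
          using that by (intro sum.cong refl) (simp add: H(4))
        then show ?thesis using that by simp
      qed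
      then show ?thesis by (simp add: scaleR_sum_left)
    qed
    have z: "(\<Sum>j=3..?n. (c j) *\<^sub>R ?H 1 j) = 0" "(\<Sum>j=3..?n. (c j) *\<^sub>R ?H 2 j) = 0"
      "(\<Sum>j=3..?n. (c j) *\<^sub>R ?H j 1) = 0" "(\<Sum>j=3..?n. (c j) *\<^sub>R ?H j 2) = 0" for c
      by (intro sum.neutral ballI, simp add: H(2,3)[simplified] H'[simplified])+
    have H21: "?H 2 1 = ?H 1 2" by (rule h_sym[OF y])
    show ?thesis
      unfolding hu guv sum_split_first_two[OF n2] sum.distrib block z H21
      unfolding H12 by (rule euclidean_eqI) (simp add: inner_add_left inner_diff_left field_simps)
  qed
  from alg show ?thesis
  proof
    assume "?\<eta> = 0 \<and> p = 0 \<and> q = 0"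
    then show ?thesis using form by simp
  next
    assume a: "?\<eta> \<noteq> 0 \<and> p \<bullet> ?\<eta> = 0 \<and> q \<bullet> ?\<eta> = 0 \<and> p \<bullet> p + q \<bullet> q = (1 + 2 * sqrt (3 * real ?n - 8)) / 4 * (?\<eta> \<bullet> ?\<eta>)"
    have "chen_shape y (e 1) (e 2) p q"
      unfolding chen_shape_def by (intro conjI allI o(1-3) form) (use a in blast)+
    then show ?thesis using a by blast
  qed
qed

end

section \<open>Codazzi relations\<close>

lemma dd_add:
  "p differentiable (at y) \<Longrightarrow> q differentiable (at y) \<Longrightarrow> dd w (\<lambda>z. p z + q z) y = dd w p y + dd w q y"
  by (intro dd_eqI has_derivative_add dd_works)

lemma dd_diff:
  "p differentiable (at y) \<Longrightarrow> q differentiable (at y) \<Longrightarrow> dd w (\<lambda>z. p z - q z) y = dd w p y - dd w q y"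
  by (intro dd_eqI has_derivative_diff dd_works)

lemma dd_scaleR:
  "r differentiable (at y) \<Longrightarrow> q differentiable (at y) \<Longrightarrow>
    dd w (\<lambda>z. r z *\<^sub>R q z) y = r y *\<^sub>R dd w q y + dd w r y *\<^sub>R q y"
  by (intro dd_eqI has_derivative_scaleR dd_works)

lemma dd_mult:
  fixes p q :: "'a::euclidean_space \<Rightarrow> real"
  shows "p differentiable (at y) \<Longrightarrow> q differentiable (at y) \<Longrightarrow> dd w (\<lambda>z. p z * q z) y = p y * dd w q y + dd w p y * q y"
  by (intro dd_eqI has_derivative_mult dd_works)

lemma dd_const_mult:
  fixes p :: "'a::euclidean_space \<Rightarrow> real"
  shows "p differentiable (at y) \<Longrightarrow> dd w (\<lambda>z. c * p z) y = c * dd w p y"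
  by (intro dd_eqI has_derivative_mult_right dd_works)

lemma dd_const_scaleR:
  "p differentiable (at y) \<Longrightarrow> dd w (\<lambda>z. c *\<^sub>R p z) y = c *\<^sub>R dd w p y"
  by (intro dd_eqI has_derivative_scaleR_right dd_works)

text \<open>The first-order relations along the eigenvectors \<open>e1\<close>, \<open>e2\<close>; the vectors \<open>t122\<close>, \<open>t112\<close> are values of the
  covariant derivative of the second fundamental form.\<close>

lemma codazzi_algebra_plane:
  fixes \<eta> p q :: "'b::real_inner"
  assumes "p \<bullet> \<eta> = 0" "q \<bullet> \<eta> = 0" "p \<bullet> p + q \<bullet> q \<noteq> (\<eta> \<bullet> \<eta>) / 4"
    and 1: "\<eta>1 = z1 *\<^sub>R ((1/2) *\<^sub>R \<eta> - p) - z2 *\<^sub>R q" and 2: "\<eta>2 = z2 *\<^sub>R ((1/2) *\<^sub>R \<eta> + p) - z1 *\<^sub>R q"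
    and "t122 \<bullet> \<eta> = \<eta>1 \<bullet> \<eta> / 2 + p \<bullet> \<eta>1" "t122 \<bullet> \<eta> = - (q \<bullet> \<eta>2)"
    and "t112 \<bullet> \<eta> = \<eta>2 \<bullet> \<eta> / 2 - p \<bullet> \<eta>2" "t112 \<bullet> \<eta> = - (q \<bullet> \<eta>1)"
  shows "\<eta>1 = 0" "\<eta>2 = 0"
proof -
  have "\<eta>1 \<bullet> \<eta> / 2 + p \<bullet> \<eta>1 + q \<bullet> \<eta>2 = 0" "\<eta>2 \<bullet> \<eta> / 2 - p \<bullet> \<eta>2 + q \<bullet> \<eta>1 = 0" using assms(6-9) by linarith+
  \<comment> \<open>Substituting \<open>1\<close> and \<open>2\<close> cancels the products p . q
    and leaves the same factor for z1 and z2.\<close>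
  then have "z1 * ((\<eta> \<bullet> \<eta>) / 4 - (p \<bullet> p + q \<bullet> q)) = 0" "z2 * ((\<eta> \<bullet> \<eta>) / 4 - (p \<bullet> p + q \<bullet> q)) = 0"
    unfolding 1 2 using assms(1,2)
    by (simp_all add: inner_diff_left inner_diff_right inner_add_left inner_add_right inner_commute algebra_simps)
  then have "z1 = 0" "z2 = 0" using assms(3) by auto
  then show "\<eta>1 = 0" "\<eta>2 = 0" using 1 2 by simp_all
qed

text \<open>This treats the direction of a unit vector u in D: the \<open>t\<close> stand for the
  derivative of h on (u, e_i, e_j), the \<open>c\<close> for the E-components of the derivative of u
  along E, and \<zeta> for the normal derivative of \<eta> along u. The two formulas for
  \<open>t12\<close> express the Codazzi symmetry. The trace-free part (x, y) of \<open>c\<close> is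
  excluded because s > 0, and its half trace \<phi> by \<open>k\<close>, the derivative of the
  curvature of E, because 1 + 2 s > 0.\<close>

lemma codazzi_algebra_orthogonal:
  fixes \<eta> p q :: "'b::real_inner"
  assumes pq: "p \<bullet> \<eta> = 0" "q \<bullet> \<eta> = 0" and P: "p \<bullet> p + q \<bullet> q = (1 + 2 * s) / 4 * (\<eta> \<bullet> \<eta>)" and s: "s > 0" and "\<eta> \<noteq> 0"
    and t11: "t11 = c11 *\<^sub>R ((1/2) *\<^sub>R \<eta> - p) - c12 *\<^sub>R q"
    and t12: "t12 = c12 *\<^sub>R ((1/2) *\<^sub>R \<eta> + p) - c11 *\<^sub>R q" "t12 = c21 *\<^sub>R ((1/2) *\<^sub>R \<eta> - p) - c22 *\<^sub>R q"
    and t22: "t22 = c22 *\<^sub>R ((1/2) *\<^sub>R \<eta> + p) - c21 *\<^sub>R q"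
    and tr: "\<zeta> = t11 + t22"
    and e: "t11 \<bullet> \<eta> = \<zeta> \<bullet> \<eta> / 2 - p \<bullet> \<zeta>" "t12 \<bullet> \<eta> = - (q \<bullet> \<zeta>)"
    and k: "t11 \<bullet> ((1/2) *\<^sub>R \<eta> - p) + ((1/2) *\<^sub>R \<eta> + p) \<bullet> t22 - 2 * (q \<bullet> t12) = - s * (\<zeta> \<bullet> \<eta>)"
  shows "\<zeta> = 0"
proof -
  define L where "L = \<eta> \<bullet> \<eta>"
  have L: "L > 0" using \<open>\<eta> \<noteq> 0\<close> by (simp add: L_def)
  have "t12 \<bullet> \<eta> = c12 * L / 2" unfolding t12(1) using pq by (simp add: inner_diff_left inner_add_left L_def)
  moreover have "t12 \<bullet> \<eta> = c21 * L / 2" unfolding t12(2) using pq by (simp add: inner_diff_left inner_add_left L_def)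
  ultimately have c: "c21 = c12" using L by simp
  define x \<phi> where "x = (c11 - c22) / 2" and "\<phi> = (c11 + c22) / 2"
  have c': "c11 = \<phi> + x" "c22 = \<phi> - x" by (simp_all add: x_def \<phi>_def field_simps)
  define y where "y = c12"
  have "2 *\<^sub>R (y *\<^sub>R p) = 2 *\<^sub>R (x *\<^sub>R q)"
  proof -
    have "c12 *\<^sub>R ((1/2) *\<^sub>R \<eta> + p) - c11 *\<^sub>R q = c12 *\<^sub>R ((1/2) *\<^sub>R \<eta> - p) - c22 *\<^sub>R q" using t12 c by simp
    then show ?thesis unfolding c' y_def scaleR_2 by (simp add: algebra_simps)
  qed
  then have yp: "y *\<^sub>R p = x *\<^sub>R q" by (simp only: scaleR_cancel_left) simp
  \<comment> \<open>Since y p = x q, the vector x r is (x^2 + y^2) p and y r is (x^2 + y^2) q;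
    \<open>e1\<close> and \<open>e2\<close> then combine into one equation for x^2 + y^2.\<close>
  define r where "r = x *\<^sub>R p + y *\<^sub>R q"
  have \<zeta>: "\<zeta> = \<phi> *\<^sub>R \<eta> - 2 *\<^sub>R r"
    unfolding tr t11 t22 c c' r_def y_def
    by (subst vector_eq_rdot[symmetric]) (simp add: inner_add_left inner_diff_left field_simps)
  have r\<eta>: "r \<bullet> \<eta> = 0" using pq by (simp add: r_def inner_add_left)
  have e1: "L * x / 2 = 2 * (p \<bullet> r)"
    using e(1) r\<eta> pq unfolding t11 \<zeta> c' by (simp add: inner_diff_left inner_diff_right inner_add_left L_def algebra_simps)
  have e2: "L * y / 2 = 2 * (q \<bullet> r)"
    using e(2) r\<eta> pq unfolding t12(1) \<zeta> c' y_def by (simp add: inner_diff_left inner_diff_right inner_add_left L_def algebra_simps)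
  have xr: "x *\<^sub>R r = (x * x + y * y) *\<^sub>R p"
  proof -
    have "x *\<^sub>R r = (x * x) *\<^sub>R p + y *\<^sub>R (x *\<^sub>R q)" by (simp add: r_def scaleR_add_right mult.commute)
    then show ?thesis unfolding yp[symmetric] by (simp add: scaleR_add_left)
  qed
  have yr: "y *\<^sub>R r = (x * x + y * y) *\<^sub>R q"
  proof -
    have "y *\<^sub>R r = x *\<^sub>R (y *\<^sub>R p) + (y * y) *\<^sub>R q" by (simp add: r_def scaleR_add_right mult.commute)
    then show ?thesis unfolding yp by (simp add: scaleR_add_left)
  qed
  have "x * (L * x / 2) = 2 * (p \<bullet> (x *\<^sub>R r))" unfolding e1 by simp
  moreover have "y * (L * y / 2) = 2 * (q \<bullet> (y *\<^sub>R r))" unfolding e2 by simp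
  ultimately have "(x * x + y * y) * (L / 2 - 2 * (p \<bullet> p + q \<bullet> q)) = 0"
    unfolding xr yr inner_scaleR_right by (simp add: field_simps)
  \<comment> \<open>By \<open>P\<close> the factor L / 2 - 2 (p . p + q . q) is -s L.\<close>
  then have "(x * x + y * y) * (s * L) = 0" unfolding P L_def by (simp add: algebra_simps)
  then have "x * x + y * y = 0" using s L by simp
  then have xy: "x = 0" "y = 0" by (simp_all add: sum_squares_eq_zero_iff)
  have t: "t11 = \<phi> *\<^sub>R ((1/2) *\<^sub>R \<eta> - p)" "t22 = \<phi> *\<^sub>R ((1/2) *\<^sub>R \<eta> + p)" "t12 = - (\<phi> *\<^sub>R q)"
    using t11 t12(1) t22 c c' xy by (simp_all add: y_def)
  have z: "\<zeta> = \<phi> *\<^sub>R \<eta>" using \<zeta> by (simp add: r_def xy)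
  have "\<phi> * (L / 2 + 2 * (p \<bullet> p + q \<bullet> q)) = - s * \<phi> * L"
    using k pq unfolding t z L_def
    by (simp add: inner_diff_left inner_diff_right inner_add_left inner_add_right inner_commute algebra_simps)
  then have "\<phi> * (L * (1 + 2 * s)) = 0" unfolding P L_def by (simp add: field_simps)
  then have "\<phi> = 0" using s L by simp
  then show ?thesis using z by simp
qed

section \<open>Normal projection and the covariant derivative of h\<close>

context immersion_patch
begin

definition normal_proj :: "'a \<Rightarrow> 'b \<Rightarrow> 'b" where
  "normal_proj y x = x - dd (metric_dual (G y) (\<lambda>w. x \<bullet> dd w f y)) f y"

lemma inner_normal_proj: "\<zeta> \<bullet> normal_proj y x = \<zeta> \<bullet> x" if "\<And>w. \<zeta> \<bullet> dd w f y = 0"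
  using that by (simp add: normal_proj_def inner_diff_right)

lemma normal_proj_normal:
  assumes "y \<in> S" shows "normal_proj y x \<bullet> dd w f y = 0"
  using metric_dual_works[OF inner_form_G[OF assms] linear_inner_dd[OF assms], of x w]
  by (simp add: normal_proj_def inner_diff_left G_eq)

lemma normal_proj_eqI:
  assumes "y \<in> S" "\<And>w. \<zeta> \<bullet> dd w f y = 0" "x - \<zeta> = dd v f y"
  shows "normal_proj y x = \<zeta>"
proof -
  have "metric_dual (G y) (\<lambda>w. x \<bullet> dd w f y) = v"
  proof (rule metric_dual_eqI[OF inner_form_G[OF assms(1)]])
    fix w
    have "G y v w = (x - \<zeta>) \<bullet> dd w f y" by (simp add: G_eq assms(3))
    then show "G y v w = x \<bullet> dd w f y" by (simp add: inner_diff_left assms(2))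
  qed
  then show ?thesis using assms(3) by (simp add: normal_proj_def algebra_simps)
qed

lemma normal_proj_id: "y \<in> S \<Longrightarrow> (\<And>w. \<zeta> \<bullet> dd w f y = 0) \<Longrightarrow> normal_proj y \<zeta> = \<zeta>"
  by (rule normal_proj_eqI[of _ _ _ 0]) (simp_all add: linear_0[OF linear_dd_f(1)])

lemma normal_proj_dd: "y \<in> S \<Longrightarrow> normal_proj y (dd v f y) = 0"
  by (rule normal_proj_eqI[of _ _ _ v]) simp_all

lemma normal_proj_dd_dd: "y \<in> S \<Longrightarrow> normal_proj y (dd u (dd v f) y) = h y u v"
  by (rule normal_proj_eqI[of _ _ _ "\<Gamma> y u v"]) (auto simp: normal_h simp: second_fundamental_form_eq[of y u v] intro: normal_h[unfolded second_fundamental_form_eq])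

lemma linear_normal_proj:
  assumes y: "y \<in> S" shows "linear (normal_proj y)"
proof -
  have d: "dd (metric_dual (G y) (\<lambda>w. x \<bullet> dd w f y)) f y = x - normal_proj y x" for x
    by (simp add: normal_proj_def)
  note L = linear_dd_f(1)[OF y]
  show ?thesis
  proof (rule linearI)
    fix x x' and r :: real
    show "normal_proj y (x + x') = normal_proj y x + normal_proj y x'"
      by (rule normal_proj_eqI[OF y, of _ _ "metric_dual (G y) (\<lambda>w. x \<bullet> dd w f y) + metric_dual (G y) (\<lambda>w. x' \<bullet> dd w f y)"])
        (simp_all only: linear_add[OF L] inner_add_left normal_proj_normal[OF y] d, simp_all)
    show "normal_proj y (r *\<^sub>R x) = r *\<^sub>R normal_proj y x"
      by (rule normal_proj_eqI[OF y, of _ _ "r *\<^sub>R metric_dual (G y) (\<lambda>w. x \<bullet> dd w f y)"])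
        (simp_all only: linear_cmul[OF L] inner_scaleR_left normal_proj_normal[OF y] d, simp_all add: scaleR_diff_right)
  qed
qed

lemma smooth_linear_arg:
  assumes "open T" "\<And>z. z \<in> T \<Longrightarrow> linear (L z)" "\<And>v. smooth_map_on T (\<lambda>z. L z v)" "smooth_map_on T V"
  shows "smooth_map_on T (\<lambda>z. L z (V z))"
proof -
  have "smooth_map_on T (\<lambda>z. \<Sum>b\<in>Basis. (V z \<bullet> b) *\<^sub>R L z b)"
    by (intro smooth_on_sum smooth_on_scaleR smooth_on_inner smooth_on_const assms)
  then show ?thesis
    by (subst smooth_on_cong[OF assms(1) linear_expand[OF assms(2)]])
qed

lemma smooth_h: "smooth_map_on S (\<lambda>y. h y u v)"
  unfolding second_fundamental_form_eq
  by (intro smooth_on_diff open_S smooth_dd smooth_linear_arg[of S "\<lambda>z a. dd a f z"] linear_dd_f smooth_christoffel)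

lemma smooth_\<eta>: "smooth_map_on S \<eta>"
proof -
  have lin: "linear (\<lambda>w. w \<bullet> b)" for b :: 'a by (simp add: bounded_linear.linear bounded_linear_inner_left)
  have dual: "smooth_map_on S (\<lambda>y. metric_dual (G y) (\<lambda>w. w \<bullet> b))" for b
    by (intro smooth_on_metric_dual open_S inner_form_G smooth_G lin smooth_on_const)
  have "smooth_map_on S (\<lambda>y. h y b (metric_dual (G y) (\<lambda>w. w \<bullet> b)))" for b
    by (rule smooth_linear_arg[of S "\<lambda>z a. h z b a", OF open_S linear_h(2) smooth_h dual])
  then show ?thesis unfolding \<eta>_def[abs_def]
    by (intro smooth_on_scaleR smooth_on_const smooth_on_sum open_S)
qed

text \<open>The covariant derivative of h in the normal bundle, written with the third derivative of
  f: the correction h w (\<Gamma> u v) comes from the tangential term in the definition of h, the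
  other two from differentiating the arguments.\<close>

definition dh :: "'a \<Rightarrow> 'a \<Rightarrow> 'a \<Rightarrow> 'a \<Rightarrow> 'b" where
  "dh y w u v = normal_proj y (dd w (dd u (dd v f)) y) - h y w (\<Gamma> y u v) - h y u (\<Gamma> y w v) - h y v (\<Gamma> y w u)"

text \<open>The Codazzi equation: third derivatives commute, and the three Christoffel corrections
  are permuted among themselves.\<close>

lemma dh_sym:
  assumes "y \<in> S" shows "dh y w u v = dh y u w v" "dh y w u v = dh y w v u"
proof -
  have "dd w (dd u (dd v f)) y = dd u (dd w (dd v f)) y"
    by (rule dd_commute[OF open_S assms smooth_dd(1)])
  then show "dh y w u v = dh y u w v" by (simp add: dh_def christoffel_sym[OF assms, of w u])
  have "dd w (dd u (dd v f)) y = dd w (dd v (dd u f)) y"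
    by (rule dd_cong_open[OF open_S assms dd_sym])
  then show "dh y w u v = dh y w v u" by (simp add: dh_def christoffel_sym[OF assms, of u v])
qed

definition cov :: "'a \<Rightarrow> 'a \<Rightarrow> ('a \<Rightarrow> 'a) \<Rightarrow> 'a" where
  "cov y w V = dd w V y + \<Gamma> y w (V y)"

lemma diff_h: "y \<in> S \<Longrightarrow> (\<lambda>z. h z u v) differentiable (at y)" by (rule smooth_onD(1)[OF smooth_h])

lemma diff_G: "y \<in> S \<Longrightarrow> (\<lambda>z. G z u v) differentiable (at y)" by (rule smooth_onD(1)[OF smooth_G])

text \<open>The Leibniz rule for h on moving fields. It converts an identity between h and smooth
  fields, once differentiated, into one for \<open>dh\<close> and the covariant derivatives of the
  fields.\<close>

lemma dd_h_fields:
  assumes y: "y \<in> S" and V: "V differentiable (at y)" and W: "W differentiable (at y)"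
  shows "(\<lambda>z. h z (V z) (W z)) differentiable (at y)"
    "normal_proj y (dd w (\<lambda>z. h z (V z) (W z)) y) = dh y w (V y) (W y) + h y (cov y w V) (W y) + h y (V y) (cov y w W)"
proof -
  let ?N = "normal_proj y"
  have dW: "(\<lambda>z. h z a (W z)) differentiable (at y)" for a
    using dd_linear_arg(1)[OF y linear_h(2) diff_h[OF y] W] by (blast intro: differentiableI)
  show "(\<lambda>z. h z (V z) (W z)) differentiable (at y)"
    using dd_linear_arg(1)[of y "\<lambda>z a. h z a (W z)", OF y linear_h(1) dW V] by (blast intro: differentiableI)
  have 1: "dd w (\<lambda>z. h z (V z) (W z)) y = dd w (\<lambda>z. h z (V y) (W z)) y + h y (dd w V y) (W y)"
    by (rule dd_linear_arg(2)[of y "\<lambda>z a. h z a (W z)", OF y linear_h(1) dW V])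
  have 2: "dd w (\<lambda>z. h z a (W z)) y = dd w (\<lambda>z. h z a (W y)) y + h y a (dd w W y)" for a
    by (rule dd_linear_arg(2)[OF y linear_h(2) diff_h[OF y] W])
  have 3: "?N (dd w (\<lambda>z. h z u v) y) = ?N (dd w (dd u (dd v f)) y) - h y w (\<Gamma> y u v)" for u v
  proof -
    have d\<Gamma>: "(\<lambda>z. \<Gamma> z u v) differentiable (at y)" by (rule smooth_onD(1)[OF smooth_christoffel y])
    note la = dd_linear_arg[of y "\<lambda>z a. dd a f z", OF y linear_dd_f(1) diff_dd(2)[OF y] d\<Gamma>]
    have "dd w (\<lambda>z. h z u v) y = dd w (dd u (dd v f)) y - dd w (\<lambda>z. dd (\<Gamma> z u v) f z) y"
      unfolding second_fundamental_form_eq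
      using la(1) by (intro dd_diff diff_dd y) (blast intro: differentiableI)
    moreover have "dd w (\<lambda>z. dd (\<Gamma> z u v) f z) y = dd w (dd (\<Gamma> y u v) f) y + dd (dd w (\<lambda>z. \<Gamma> z u v) y) f y"
      by (rule la(2))
    ultimately show ?thesis
      by (simp add: linear_diff[OF linear_normal_proj[OF y]] linear_add[OF linear_normal_proj[OF y]]
        normal_proj_dd[OF y] normal_proj_dd_dd[OF y])
  qed
  have Nh: "?N (h y a b) = h y a b" for a b by (rule normal_proj_id[OF y normal_h[OF y]])
  show "?N (dd w (\<lambda>z. h z (V z) (W z)) y) = dh y w (V y) (W y) + h y (cov y w V) (W y) + h y (V y) (cov y w W)"
    unfolding 1 2 linear_add[OF linear_normal_proj[OF y]] 3 Nh cov_def dh_def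
    by (simp add: linear_add[OF linear_h(1)[OF y]] linear_add[OF linear_h(2)[OF y]] h_sym[OF y, of "\<Gamma> y w (V y)"])
qed

lemma dd_G_fields:
  assumes y: "y \<in> S" and V: "V differentiable (at y)" and W: "W differentiable (at y)"
  shows "(\<lambda>z. G z (V z) (W z)) differentiable (at y)"
    "dd w (\<lambda>z. G z (V z) (W z)) y = G y (cov y w V) (W y) + G y (V y) (cov y w W)"
proof -
  have dW: "(\<lambda>z. G z a (W z)) differentiable (at y)" for a
    using dd_linear_arg(1)[OF y G_linear(2) diff_G[OF y] W] by (blast intro: differentiableI)
  show "(\<lambda>z. G z (V z) (W z)) differentiable (at y)"
    using dd_linear_arg(1)[of y "\<lambda>z a. G z a (W z)", OF y G_linear(1) dW V] by (blast intro: differentiableI)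
  have 1: "dd w (\<lambda>z. G z (V z) (W z)) y = dd w (\<lambda>z. G z (V y) (W z)) y + G y (dd w V y) (W y)"
    by (rule dd_linear_arg(2)[of y "\<lambda>z a. G z a (W z)", OF y G_linear(1) dW V])
  have 2: "dd w (\<lambda>z. G z a (W z)) y = dd w (\<lambda>z. G z a (W y)) y + G y a (dd w W y)" for a
    by (rule dd_linear_arg(2)[OF y G_linear(2) diff_G[OF y] W])
  have 3: "dd w (\<lambda>z. G z u v) y = G y (\<Gamma> y w u) v + G y u (\<Gamma> y w v)" for u v
    unfolding dd_G[OF y] G_sym[OF y, of u] G_christoffel[OF y] by (simp add: inner_commute)
  show "dd w (\<lambda>z. G z (V z) (W z)) y = G y (cov y w V) (W y) + G y (V y) (cov y w W)"
    unfolding 1 2 3 cov_def by (simp add: linear_add[OF G_linear(1)[OF y]] linear_add[OF G_linear(2)[OF y]])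
qed

text \<open>For vectors normal at y the tangential parts of the derivatives drop out, so the inner
  product is differentiated by the normal connection.\<close>

lemma dd_inner_normal:
  assumes y: "y \<in> S" and "P differentiable (at y)" "Q differentiable (at y)"
    and "\<And>w. P y \<bullet> dd w f y = 0" "\<And>w. Q y \<bullet> dd w f y = 0"
  shows "dd w (\<lambda>z. P z \<bullet> Q z) y = normal_proj y (dd w P y) \<bullet> Q y + P y \<bullet> normal_proj y (dd w Q y)"
  unfolding dd_inner[OF assms(2,3)]
  using inner_normal_proj[of "P y" y "dd w Q y", OF assms(4)] inner_normal_proj[of "Q y" y "dd w P y", OF assms(5)]
  by (simp add: inner_commute)

end

section \<open>Smooth fields in the two eigendistributions\<close>

locale chen_weakly_einstein_patch = immersion_patch f S
  for f :: "'a::euclidean_space \<Rightarrow> 'b::euclidean_space" and S +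
  assumes dim: "DIM('a) \<ge> 3" and chen: "y \<in> S \<Longrightarrow> chen_equality_at f y"
    and we: "y \<in> S \<Longrightarrow> weakly_einstein_at (induced_metric f) y"
begin

lemma shape_cases:
  assumes "y \<in> S"
  obtains "\<eta> y = 0" "\<And>u v. h y u v = 0" | e1 e2 p q where "\<eta> y \<noteq> 0" "chen_shape y e1 e2 p q"
  using chen_weakly_einstein_shape[OF assms dim chen[OF assms] we[OF assms]] by blast

text \<open>The shape operator of \<eta>, which is not normalised: its eigenvalues are |\<eta>|^2 /
  2 on E and |\<eta>|^2 on D. They differ where \<eta> is nonzero, so subtracting either eigenvalue
  leaves a multiple of the projection to the other distribution.\<close>

definition mean_shape :: "'a \<Rightarrow> 'a \<Rightarrow> 'a" where
  "mean_shape y u = metric_dual (G y) (\<lambda>w. h y u w \<bullet> \<eta> y)"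

lemma linear_h_inner: "y \<in> S \<Longrightarrow> linear (\<lambda>w. h y u w \<bullet> x)"
  by (auto intro!: linearI simp: linear_add[OF linear_h(2)] linear_cmul[OF linear_h(2)] inner_add_left)

lemma smooth_mean_shape: "smooth_map_on S (\<lambda>y. mean_shape y u)"
  unfolding mean_shape_def
  by (intro smooth_on_metric_dual open_S inner_form_G smooth_G linear_h_inner smooth_on_inner smooth_h smooth_\<eta>)

lemma G_mean_shape: "y \<in> S \<Longrightarrow> G y (mean_shape y u) w = h y u w \<bullet> \<eta> y"
  unfolding mean_shape_def by (rule metric_dual_works[OF inner_form_G linear_h_inner])

text \<open>Up to the factor \<open>\<eta>\<^sup>2 / 2\<close>, the fields below are the projections of constant fields onto the two eigendistributions
  of the shape operator of \<open>\<eta>\<close>; since no eigenvectors are chosen, they are smooth.\<close>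

definition plane_field :: "'a \<Rightarrow> 'a \<Rightarrow> 'a" where
  "plane_field x y = (\<eta> y \<bullet> \<eta> y) *\<^sub>R x - mean_shape y x"

definition umbilic_field :: "'a \<Rightarrow> 'a \<Rightarrow> 'a" where
  "umbilic_field u y = mean_shape y u - ((1/2) * (\<eta> y \<bullet> \<eta> y)) *\<^sub>R u"

lemma smooth_plane_field: "smooth_map_on S (plane_field x)"
  unfolding plane_field_def[abs_def]
  by (intro smooth_on_diff smooth_on_scaleR smooth_on_inner smooth_on_const smooth_\<eta> smooth_mean_shape open_S)

lemma smooth_umbilic_field: "smooth_map_on S (umbilic_field x)"
proof -
  have "smooth_map_on S (\<lambda>y. ((1/2) *\<^sub>R (\<eta> y \<bullet> \<eta> y)) *\<^sub>R x)"
    by (intro smooth_on_scaleR smooth_on_inner smooth_on_const smooth_\<eta> open_S)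
  from smooth_on_diff[OF open_S smooth_mean_shape this] show ?thesis
    by (simp add: umbilic_field_def[abs_def])
qed

context
  fixes y e1 e2 p q
  assumes y: "y \<in> S" and shape: "chen_shape y e1 e2 p q"
begin

lemma shape_G: "G y e1 e1 = 1" "G y e2 e2 = 1" "G y e1 e2 = 0" "G y e2 e1 = 0"
  and shape_orth: "p \<bullet> \<eta> y = 0" "q \<bullet> \<eta> y = 0"
  and shape_pq: "p \<bullet> p + q \<bullet> q = (1 + 2 * sqrt (3 * real DIM('a) - 8)) / 4 * (\<eta> y \<bullet> \<eta> y)"
  and shape_h: "h y u v = (G y u v - (G y u e1 * G y v e1 + G y u e2 * G y v e2) / 2) *\<^sub>R \<eta> y
        + (G y u e1 * G y v e1 - G y u e2 * G y v e2) *\<^sub>R p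
        + (G y u e1 * G y v e2 + G y u e2 * G y v e1) *\<^sub>R q"
  using shape G_sym[OF y, of e2 e1] unfolding chen_shape_def by simp_all

lemmas G_simps = linear_add[OF G_linear(1)[OF y]] linear_add[OF G_linear(2)[OF y]]
  linear_cmul[OF G_linear(1)[OF y]] linear_cmul[OF G_linear(2)[OF y]]
  linear_diff[OF G_linear(1)[OF y]] linear_diff[OF G_linear(2)[OF y]]

lemma mean_shape_eq:
  "mean_shape y u = (\<eta> y \<bullet> \<eta> y) *\<^sub>R (u - (1/2) *\<^sub>R (G y u e1 *\<^sub>R e1 + G y u e2 *\<^sub>R e2))"
  unfolding mean_shape_def
proof (rule metric_dual_eqI[OF inner_form_G[OF y]])
  fix w
  show "G y ((\<eta> y \<bullet> \<eta> y) *\<^sub>R (u - (1/2) *\<^sub>R (G y u e1 *\<^sub>R e1 + G y u e2 *\<^sub>R e2))) w = h y u w \<bullet> \<eta> y"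
    unfolding shape_h[of u w] G_simps real_scaleR_def inner_add_left inner_scaleR_left shape_orth
      G_sym[OF y, of e1 w] G_sym[OF y, of e2 w]
    by (simp add: field_simps)
qed

lemma plane_field_eq:
  "plane_field x y = ((\<eta> y \<bullet> \<eta> y) / 2 * G y x e1) *\<^sub>R e1 + ((\<eta> y \<bullet> \<eta> y) / 2 * G y x e2) *\<^sub>R e2"
  unfolding plane_field_def mean_shape_eq by (simp add: algebra_simps)

lemma umbilic_field_eq:
  "umbilic_field u y = ((\<eta> y \<bullet> \<eta> y) / 2) *\<^sub>R (u - G y u e1 *\<^sub>R e1 - G y u e2 *\<^sub>R e2)"
  unfolding umbilic_field_def mean_shape_eq
  by (rule euclidean_eqI) (simp add: inner_add_left inner_diff_left field_simps)

lemma G_umbilic: "G y (umbilic_field u y) e1 = 0" "G y (umbilic_field u y) e2 = 0"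
  unfolding umbilic_field_eq by (simp_all add: G_simps shape_G)

lemma h_plane:
  defines "V \<equiv> \<lambda>a b. a *\<^sub>R e1 + b *\<^sub>R e2"
  shows "G y (V a1 a2) (V b1 b2) = a1 * b1 + a2 * b2"
    "h y (V a1 a2) (V b1 b2) = ((a1 * b1 + a2 * b2) / 2) *\<^sub>R \<eta> y + (a1 * b1 - a2 * b2) *\<^sub>R p + (a1 * b2 + a2 * b1) *\<^sub>R q"
  unfolding V_def shape_h by (simp_all add: G_simps shape_G) (simp add: field_simps)

lemma h_umbilic:
  assumes "G y u e1 = 0" "G y u e2 = 0"
  shows "h y v u = G y v u *\<^sub>R \<eta> y" "h y u v = G y v u *\<^sub>R \<eta> y"
  unfolding shape_h[of v u] shape_h[of u v] using assms by (simp_all add: G_sym[OF y, of u v])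

text \<open>Facts stated without e1, e2, p, q, so that they hold at neighbouring points whatever
  frame is chosen there. The fifth is the trace of h over E and the sixth the curvature of E, both
  multiplied by the Gram determinant of the two projected fields, which need not be
  orthonormal.\<close>

lemma field_relations:
  defines "L \<equiv> \<eta> y \<bullet> \<eta> y" and "X \<equiv> \<lambda>x. plane_field x y" and "U \<equiv> \<lambda>u. umbilic_field u y"
  shows "G y (X x) (U u) = 0" "h y (X x) (U u) = 0" "h y (U u) (U u) = G y (U u) (U u) *\<^sub>R \<eta> y"
    "h y (X x) (X x') \<bullet> \<eta> y = L / 2 * G y (X x) (X x')"
    "(G y (X x) (X x) * G y (X x') (X x') - (G y (X x) (X x'))\<^sup>2) *\<^sub>R \<eta> y =
       G y (X x') (X x') *\<^sub>R h y (X x) (X x) - (2 * G y (X x) (X x')) *\<^sub>R h y (X x) (X x') + G y (X x) (X x) *\<^sub>R h y (X x') (X x')"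
    "h y (X x) (X x) \<bullet> h y (X x') (X x') - h y (X x) (X x') \<bullet> h y (X x) (X x') =
       - (sqrt (3 * real DIM('a) - 8) / 2 * L * (G y (X x) (X x) * G y (X x') (X x') - (G y (X x) (X x'))\<^sup>2))"
proof -
  have um: "G y (U u) e1 = 0" "G y (U u) e2 = 0" unfolding U_def by (rule G_umbilic)+
  obtain a1 a2 b1 b2 where X: "X x = a1 *\<^sub>R e1 + a2 *\<^sub>R e2" "X x' = b1 *\<^sub>R e1 + b2 *\<^sub>R e2"
    unfolding X_def plane_field_eq by blast
  show XU: "G y (X x) (U u) = 0"
    unfolding X using um by (simp add: G_simps G_sym[OF y, of _ "U u"])
  show "h y (X x) (U u) = 0" unfolding h_umbilic(1)[OF um] XU by simp
  show "h y (U u) (U u) = G y (U u) (U u) *\<^sub>R \<eta> y" by (rule h_umbilic(1)[OF um])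
  show "h y (X x) (X x') \<bullet> \<eta> y = L / 2 * G y (X x) (X x')"
    unfolding X h_plane L_def using shape_orth by (simp add: inner_add_left)
  show "(G y (X x) (X x) * G y (X x') (X x') - (G y (X x) (X x'))\<^sup>2) *\<^sub>R \<eta> y =
       G y (X x') (X x') *\<^sub>R h y (X x) (X x) - (2 * G y (X x) (X x')) *\<^sub>R h y (X x) (X x') + G y (X x) (X x) *\<^sub>R h y (X x') (X x')"
    unfolding X h_plane
    by (rule euclidean_eqI) (simp add: inner_add_left inner_diff_left power2_eq_square field_simps)
  let ?s = "sqrt (3 * real DIM('a) - 8)"
  let ?det = "(a1 * a1 + a2 * a2) * (b1 * b1 + b2 * b2) - (a1 * b1 + a2 * b2)\<^sup>2"
  have "h y (X x) (X x) \<bullet> h y (X x') (X x') - h y (X x) (X x') \<bullet> h y (X x) (X x') = ?det * (L / 4 - (p \<bullet> p + q \<bullet> q))"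
    unfolding X h_plane L_def inner_add_left inner_add_right inner_scaleR_left inner_scaleR_right
      shape_orth inner_commute[of "\<eta> y" p] inner_commute[of "\<eta> y" q] inner_commute[of q p]
    by (simp add: power2_eq_square field_simps)
  also have "\<dots> = - (?s / 2 * L * ?det)" unfolding shape_pq L_def by (simp add: field_simps)
  finally show "h y (X x) (X x) \<bullet> h y (X x') (X x') - h y (X x) (X x') \<bullet> h y (X x) (X x') =
       - (?s / 2 * L * (G y (X x) (X x) * G y (X x') (X x') - (G y (X x) (X x'))\<^sup>2))"
    unfolding X h_plane .
qed

end

abbreviation "\<Omega> \<equiv> {z \<in> S. \<eta> z \<noteq> 0}"

lemma open_\<Omega>: "open \<Omega>"
proof -
  have "open (S \<inter> \<eta> -` (- {0}))"
    by (rule continuous_open_preimage[OF smooth_on_continuous[OF smooth_\<eta>] open_S]) (auto intro: open_Compl)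
  moreover have "\<Omega> = S \<inter> \<eta> -` (- {0})" by auto
  ultimately show ?thesis by simp
qed

lemma field_relations_\<Omega>:
  assumes "z \<in> \<Omega>"
  defines "X \<equiv> \<lambda>x. plane_field x z" and "U \<equiv> \<lambda>u. umbilic_field u z"
  shows "G z (X x) (U u) = 0" "h z (X x) (U u) = 0" "h z (U u) (U u) = G z (U u) (U u) *\<^sub>R \<eta> z"
    "h z (X x) (X x') \<bullet> \<eta> z = 1 / 2 * ((\<eta> z \<bullet> \<eta> z) * G z (X x) (X x'))"
    "(G z (X x) (X x) * G z (X x') (X x') - G z (X x) (X x') * G z (X x) (X x')) *\<^sub>R \<eta> z =
       G z (X x') (X x') *\<^sub>R h z (X x) (X x) - 2 *\<^sub>R (G z (X x) (X x') *\<^sub>R h z (X x) (X x')) + G z (X x) (X x) *\<^sub>R h z (X x') (X x')"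
    "h z (X x) (X x) \<bullet> h z (X x') (X x') - h z (X x) (X x') \<bullet> h z (X x) (X x') =
       (- sqrt (3 * real DIM('a) - 8) / 2) * ((\<eta> z \<bullet> \<eta> z) * (G z (X x) (X x) * G z (X x') (X x') - G z (X x) (X x') * G z (X x) (X x')))"
proof -
  have z: "z \<in> S" using assms by simp
  obtain e1 e2 p q where sh: "chen_shape z e1 e2 p q" using shape_cases[OF z] assms(1) by blast
  note r = field_relations[OF z sh]
  show "G z (X x) (U u) = 0" "h z (X x) (U u) = 0" "h z (U u) (U u) = G z (U u) (U u) *\<^sub>R \<eta> z" unfolding X_def U_def by (rule r)+
  show "h z (X x) (X x') \<bullet> \<eta> z = 1 / 2 * ((\<eta> z \<bullet> \<eta> z) * G z (X x) (X x'))" using r(4)[of x x'] by (simp add: X_def)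
  show "(G z (X x) (X x) * G z (X x') (X x') - G z (X x) (X x') * G z (X x) (X x')) *\<^sub>R \<eta> z =
       G z (X x') (X x') *\<^sub>R h z (X x) (X x) - 2 *\<^sub>R (G z (X x) (X x') *\<^sub>R h z (X x) (X x')) + G z (X x) (X x) *\<^sub>R h z (X x') (X x')"
    using r(5)[of x x'] by (simp add: power2_eq_square X_def)
  show "h z (X x) (X x) \<bullet> h z (X x') (X x') - h z (X x) (X x') \<bullet> h z (X x) (X x') =
       (- sqrt (3 * real DIM('a) - 8) / 2) * ((\<eta> z \<bullet> \<eta> z) * (G z (X x) (X x) * G z (X x') (X x') - G z (X x) (X x') * G z (X x) (X x')))"
    using r(6)[of x x'] by (simp add: power2_eq_square X_def)
qed

section \<open>First-order relations at a point where the mean curvature is nonzero\<close>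

context
  fixes y e1 e2 p q u
  assumes y: "y \<in> S" and ny: "\<eta> y \<noteq> 0" and shape: "chen_shape y e1 e2 p q"
    and u: "G y u u = 1" "G y u e1 = 0" "G y u e2 = 0"
begin

abbreviation "ndd w \<equiv> normal_proj y (dd w \<eta> y)"

text \<open>Each conclusion is the derivative at y of one identity of
  \<open>field_relations_\<Omega>\<close>, for fields that take the values e1, e2, u at y. The
  derivatives of the fields within E and within D cancel; only \<open>c1\<close> and
  \<open>c2\<close>, the E-components of the derivative of the field in D, remain.\<close>

lemma first_order_relations:
  defines "U \<equiv> umbilic_field ((2 / (\<eta> y \<bullet> \<eta> y)) *\<^sub>R u)"
  defines "c1 \<equiv> \<lambda>w. G y (cov y w U) e1" and "c2 \<equiv> \<lambda>w. G y (cov y w U) e2"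
  shows "dh y w e1 u = c1 w *\<^sub>R ((1/2) *\<^sub>R \<eta> y - p) - c2 w *\<^sub>R q"
    "dh y w e2 u = c2 w *\<^sub>R ((1/2) *\<^sub>R \<eta> y + p) - c1 w *\<^sub>R q"
    "dh y w u u = ndd w"
    "dh y w e1 e1 \<bullet> \<eta> y = ndd w \<bullet> \<eta> y / 2 - p \<bullet> ndd w"
    "dh y w e2 e2 \<bullet> \<eta> y = ndd w \<bullet> \<eta> y / 2 + p \<bullet> ndd w"
    "dh y w e1 e2 \<bullet> \<eta> y = - (q \<bullet> ndd w)"
    "ndd w = dh y w e1 e1 + dh y w e2 e2"
    "dh y w e1 e1 \<bullet> ((1/2) *\<^sub>R \<eta> y - p) + ((1/2) *\<^sub>R \<eta> y + p) \<bullet> dh y w e2 e2 - 2 * (q \<bullet> dh y w e1 e2)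
      = - sqrt (3 * real DIM('a) - 8) * (ndd w \<bullet> \<eta> y)"
proof -
  define L where "L = \<eta> y \<bullet> \<eta> y"
  have L: "L > 0" using ny by (simp add: L_def)
  \<comment> \<open>The projections carry the factor |\<eta>|^2 / 2. The constant 2 / L removes it
    at y, so the fields equal e1 and e2 there and are merely multiples of projections
    elsewhere.\<close>
  define X1 X2 where "X1 = plane_field ((2 / L) *\<^sub>R e1)" and "X2 = plane_field ((2 / L) *\<^sub>R e2)"
  note gs = G_simps[OF y shape] and sG = shape_G[OF y shape]
  have X1y: "X1 y = e1" and X2y: "X2 y = e2"
    unfolding X1_def X2_def plane_field_eq[OF y shape] L_def[symmetric] using L by (simp_all add: gs sG)
  have Uy: "U y = u"
    unfolding U_def umbilic_field_eq[OF y shape] L_def[symmetric] using L by (simp add: gs u)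
  have dX1: "X1 differentiable (at y)" and dX2: "X2 differentiable (at y)" and dU: "U differentiable (at y)"
    unfolding X1_def X2_def U_def
    by (rule smooth_onD(1)[OF smooth_plane_field y] smooth_onD(1)[OF smooth_umbilic_field y])+
  have d\<eta>: "\<eta> differentiable (at y)" by (rule smooth_onD(1)[OF smooth_\<eta> y])
  have y\<Omega>: "y \<in> \<Omega>" using y ny by simp
  note rel = field_relations_\<Omega>
  note cong = dd_cong_open[OF open_\<Omega> y\<Omega>]
  have dd0: "dd w (\<lambda>z. 0) y = (0::'c::euclidean_space)" by (simp add: dd_def)
  note N = linear_normal_proj[OF y]
  note Ns = linear_add[OF N] linear_diff[OF N] linear_cmul[OF N] linear_0[OF N]
  have N\<eta>: "normal_proj y (\<eta> y) = \<eta> y" by (rule normal_proj_id[OF y normal_\<eta>[OF y]])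
  have Nh: "normal_proj y (h y a b) = h y a b" for a b by (rule normal_proj_id[OF y normal_h[OF y]])
  let ?v = "cov y w X1" and ?v' = "cov y w X2" and ?t = "cov y w U"
  have hu: "h y v u = G y v u *\<^sub>R \<eta> y" "h y u v = G y v u *\<^sub>R \<eta> y" for v by (rule h_umbilic[OF y shape u(2,3)])+
  have h1: "h y e1 v = G y v e1 *\<^sub>R ((1/2) *\<^sub>R \<eta> y + p) + G y v e2 *\<^sub>R q"
    and h2: "h y e2 v = G y v e2 *\<^sub>R ((1/2) *\<^sub>R \<eta> y - p) + G y v e1 *\<^sub>R q" for v
    unfolding shape_h[OF y shape, of e1 v] shape_h[OF y shape, of e2 v] sG G_sym[OF y, of e1 v] G_sym[OF y, of e2 v]
    by (simp_all add: algebra_simps)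
  have h1': "h y v e1 = G y v e1 *\<^sub>R ((1/2) *\<^sub>R \<eta> y + p) + G y v e2 *\<^sub>R q"
    and h2': "h y v e2 = G y v e2 *\<^sub>R ((1/2) *\<^sub>R \<eta> y - p) + G y v e1 *\<^sub>R q" for v
    using h1[of v] h2[of v] h_sym[OF y] by metis+
  note hs = hu h1 h2 h1' h2'
  have h11: "h y e1 e1 = (1/2) *\<^sub>R \<eta> y + p" and h22: "h y e2 e2 = (1/2) *\<^sub>R \<eta> y - p" and h12: "h y e1 e2 = q"
    by (simp_all add: h1 h2 sG)
  have c: "G y ?t e1 = c1 w" "G y ?t e2 = c2 w" by (simp_all add: c1_def c2_def)
  \<comment> \<open>Differentiated orthogonality of E and D: the derivative of X1 leaves E by minus
    what the derivative of U leaves D.\<close>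
  have G1: "G y ?v u = - c1 w"
  proof -
    have "dd w (\<lambda>z. G z (X1 z) (U z)) y = dd w (\<lambda>z. 0) y"
      by (rule cong) (simp add: X1_def U_def rel)
    then show ?thesis unfolding dd_G_fields(2)[OF y dX1 dU] dd0 X1y Uy by (simp add: c1_def G_sym[OF y, of e1])
  qed
  have G2: "G y ?v' u = - c2 w"
  proof -
    have "dd w (\<lambda>z. G z (X2 z) (U z)) y = dd w (\<lambda>z. 0) y"
      by (rule cong) (simp add: X2_def U_def rel)
    then show ?thesis unfolding dd_G_fields(2)[OF y dX2 dU] dd0 X2y Uy by (simp add: c2_def G_sym[OF y, of e2])
  qed
  show "dh y w e1 u = c1 w *\<^sub>R ((1/2) *\<^sub>R \<eta> y - p) - c2 w *\<^sub>R q"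
  proof -
    have "dd w (\<lambda>z. h z (X1 z) (U z)) y = dd w (\<lambda>z. 0) y"
      by (rule cong) (simp add: X1_def U_def rel)
    then have "0 = dh y w e1 u + h y ?v u + h y e1 ?t"
      using dd_h_fields(2)[OF y dX1 dU, of w] unfolding X1y Uy dd0 by (simp add: Ns)
    then have D: "dh y w e1 u = - (h y ?v u + h y e1 ?t)" by (metis eq_neg_iff_add_eq_0 add.assoc)
    show ?thesis unfolding D hu h1 G1 c
      by (rule euclidean_eqI) (simp add: inner_add_left inner_diff_left field_simps)
  qed
  show "dh y w e2 u = c2 w *\<^sub>R ((1/2) *\<^sub>R \<eta> y + p) - c1 w *\<^sub>R q"
  proof -
    have "dd w (\<lambda>z. h z (X2 z) (U z)) y = dd w (\<lambda>z. 0) y"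
      by (rule cong) (simp add: X2_def U_def rel)
    then have "0 = dh y w e2 u + h y ?v' u + h y e2 ?t"
      using dd_h_fields(2)[OF y dX2 dU, of w] unfolding X2y Uy dd0 by (simp add: Ns)
    then have D: "dh y w e2 u = - (h y ?v' u + h y e2 ?t)" by (metis eq_neg_iff_add_eq_0 add.assoc)
    show ?thesis unfolding D hu h2 G2 c
      by (rule euclidean_eqI) (simp add: inner_add_left inner_diff_left field_simps)
  qed
  show "dh y w u u = ndd w"
  proof -
    have "dd w (\<lambda>z. h z (U z) (U z)) y = dd w (\<lambda>z. G z (U z) (U z) *\<^sub>R \<eta> z) y"
      by (rule cong) (simp add: U_def rel)
    also have "\<dots> = dd w \<eta> y + (2 * G y ?t u) *\<^sub>R \<eta> y"
      unfolding dd_scaleR[OF dd_G_fields(1)[OF y dU dU] d\<eta>] dd_G_fields(2)[OF y dU dU] Uy u G_sym[OF y, of u ?t] by simp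
    finally have "ndd w + (2 * G y ?t u) *\<^sub>R \<eta> y = dh y w u u + (G y ?t u *\<^sub>R \<eta> y + G y ?t u *\<^sub>R \<eta> y)"
      using dd_h_fields(2)[OF y dU dU, of w] unfolding Uy hu by (simp add: Ns N\<eta> add.assoc)
    moreover have "G y ?t u *\<^sub>R \<eta> y + G y ?t u *\<^sub>R \<eta> y = (2 * G y ?t u) *\<^sub>R \<eta> y"
      by (simp only: mult_2 scaleR_add_left)
    ultimately show ?thesis by (metis add_right_cancel)
  qed
  have dL: "dd w (\<lambda>z. \<eta> z \<bullet> \<eta> z) y = 2 * (ndd w \<bullet> \<eta> y)"
    unfolding dd_inner_normal[OF y d\<eta> d\<eta> normal_\<eta>[OF y] normal_\<eta>[OF y]] by (simp add: inner_commute)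
  have diffL: "(\<lambda>z. \<eta> z \<bullet> \<eta> z) differentiable (at y)"
    by (rule smooth_onD(1)[OF smooth_on_inner[OF open_S smooth_\<eta> smooth_\<eta>] y])
  \<comment> \<open>Derivative of h (X, Y) . \<eta> = |\<eta>|^2 / 2 * G (X, Y). Since e1 and e2 are
    eigenvectors of the shape operator of \<eta>, the terms with \<open>cov\<close> agree on both
    sides and disappear in the three cases below.\<close>
  have shape_eta: "dh y w a b \<bullet> \<eta> y + h y (cov y w X) b \<bullet> \<eta> y + h y a (cov y w Y) \<bullet> \<eta> y + h y a b \<bullet> ndd w
     = (ndd w \<bullet> \<eta> y) * G y a b + L / 2 * (G y (cov y w X) b + G y a (cov y w Y))"
    if "X = plane_field x" "Y = plane_field x'" "X y = a" "Y y = b" for X Y x x' a b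
  proof -
    have dX: "X differentiable (at y)" and dY: "Y differentiable (at y)"
      unfolding that by (rule smooth_onD(1)[OF smooth_plane_field y])+
    note dh_f = dd_h_fields[OF y dX dY] and dG_f = dd_G_fields[OF y dX dY]
    have "dd w (\<lambda>z. h z (X z) (Y z) \<bullet> \<eta> z) y = dd w (\<lambda>z. 1 / 2 * ((\<eta> z \<bullet> \<eta> z) * G z (X z) (Y z))) y"
      by (rule cong) (unfold that(1,2), rule rel(4))
    also have "\<dots> = 1 / 2 * (L * dd w (\<lambda>z. G z (X z) (Y z)) y + 2 * (ndd w \<bullet> \<eta> y) * G y (X y) (Y y))"
      by (subst dd_const_mult) (simp_all add: dd_mult[OF diffL dG_f(1)] dL L_def diffL dG_f(1) differentiable_mult)
    also have "dd w (\<lambda>z. h z (X z) (Y z) \<bullet> \<eta> z) y =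
       normal_proj y (dd w (\<lambda>z. h z (X z) (Y z)) y) \<bullet> \<eta> y + h y (X y) (Y y) \<bullet> ndd w"
      by (rule dd_inner_normal[OF y dh_f(1) d\<eta> normal_h[OF y] normal_\<eta>[OF y]])
    finally show ?thesis unfolding dh_f(2) dG_f(2) that(3,4) by (simp add: inner_add_left algebra_simps)
  qed
  note orth = shape_orth[OF y shape]
  have he: "h y v e1 \<bullet> \<eta> y = L / 2 * G y v e1" "h y v e2 \<bullet> \<eta> y = L / 2 * G y v e2"
    "h y e1 v \<bullet> \<eta> y = L / 2 * G y e1 v" "h y e2 v \<bullet> \<eta> y = L / 2 * G y e2 v" for v
    unfolding hs G_sym[OF y, of e1 v] G_sym[OF y, of e2 v] using orth by (simp_all add: inner_add_left inner_diff_left L_def)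
  show "dh y w e1 e1 \<bullet> \<eta> y = ndd w \<bullet> \<eta> y / 2 - p \<bullet> ndd w"
    using shape_eta[OF X1_def X1_def X1y X1y] unfolding he h11 sG
    by (simp add: inner_add_left inner_commute algebra_simps)
  show "dh y w e2 e2 \<bullet> \<eta> y = ndd w \<bullet> \<eta> y / 2 + p \<bullet> ndd w"
    using shape_eta[OF X2_def X2_def X2y X2y] unfolding he h22 sG
    by (simp add: inner_diff_left inner_commute algebra_simps)
  show "dh y w e1 e2 \<bullet> \<eta> y = - (q \<bullet> ndd w)"
    using shape_eta[OF X1_def X2_def X1y X2y] unfolding he h12 sG
    by (simp add: inner_add_left inner_commute algebra_simps)
  \<comment> \<open>\<open>X1\<close>, \<open>X2\<close> are orthonormal only at \<open>y\<close>, so the relations for the trace and the determinant of \<open>h\<close> on the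
    plane are differentiated after multiplication by the Gram determinant.\<close>
  define g11 g12 g22 where "g11 = (\<lambda>z. G z (X1 z) (X1 z))" and "g12 = (\<lambda>z. G z (X1 z) (X2 z))" and "g22 = (\<lambda>z. G z (X2 z) (X2 z))"
  define b11 b12 b22 where "b11 = (\<lambda>z. h z (X1 z) (X1 z))" and "b12 = (\<lambda>z. h z (X1 z) (X2 z))" and "b22 = (\<lambda>z. h z (X2 z) (X2 z))"
  have dg: "g11 differentiable (at y)" "g12 differentiable (at y)" "g22 differentiable (at y)"
    unfolding g11_def g12_def g22_def by (intro dd_G_fields dX1 dX2 y)+
  have db: "b11 differentiable (at y)" "b12 differentiable (at y)" "b22 differentiable (at y)"
    unfolding b11_def b12_def b22_def by (intro dd_h_fields dX1 dX2 y)+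
  have gy: "g11 y = 1" "g12 y = 0" "g22 y = 1" unfolding g11_def g12_def g22_def X1y X2y by (rule sG)+
  have b_y: "b11 y = (1/2) *\<^sub>R \<eta> y + p" "b12 y = q" "b22 y = (1/2) *\<^sub>R \<eta> y - p"
    unfolding b11_def b12_def b22_def X1y X2y by (rule h11 h12 h22)+
  \<comment> \<open>The E-components of the derivatives of X1 and X2, carried along as unknowns;
    they cancel in the last two conclusions.\<close>
  define m11 m12 m21 m22 where "m11 = G y ?v e1" and "m12 = G y ?v e2" and "m21 = G y ?v' e1" and "m22 = G y ?v' e2"
  have g': "dd w g11 y = 2 * m11" "dd w g12 y = m12 + m21" "dd w g22 y = 2 * m22"
    unfolding g11_def g12_def g22_def dd_G_fields(2)[OF y dX1 dX1] dd_G_fields(2)[OF y dX1 dX2] dd_G_fields(2)[OF y dX2 dX2]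
      X1y X2y m11_def m12_def m21_def m22_def G_sym[OF y, of e1 "cov _ _ _"] G_sym[OF y, of e2 "cov _ _ _"] by simp_all
  have b': "normal_proj y (dd w b11 y) = dh y w e1 e1 + 2 *\<^sub>R (m11 *\<^sub>R ((1/2) *\<^sub>R \<eta> y + p) + m12 *\<^sub>R q)"
    "normal_proj y (dd w b12 y) = dh y w e1 e2 + (m12 *\<^sub>R ((1/2) *\<^sub>R \<eta> y - p) + m11 *\<^sub>R q) + (m21 *\<^sub>R ((1/2) *\<^sub>R \<eta> y + p) + m22 *\<^sub>R q)"
    "normal_proj y (dd w b22 y) = dh y w e2 e2 + 2 *\<^sub>R (m22 *\<^sub>R ((1/2) *\<^sub>R \<eta> y - p) + m21 *\<^sub>R q)"
    unfolding b11_def b12_def b22_def dd_h_fields(2)[OF y dX1 dX1] dd_h_fields(2)[OF y dX1 dX2] dd_h_fields(2)[OF y dX2 dX2]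
      X1y X2y h1 h2 h1' h2' m11_def m12_def m21_def m22_def by (simp_all add: scaleR_2 add.assoc)
  have ddet: "dd w (\<lambda>z. g11 z * g22 z - g12 z * g12 z) y = 2 * m11 + 2 * m22"
    by (subst dd_diff) (simp_all add: dd_mult dg gy g' differentiable_mult)
  have det_diff: "(\<lambda>z. g11 z * g22 z - g12 z * g12 z) differentiable (at y)"
    by (intro differentiable_diff differentiable_mult dg)
  show "ndd w = dh y w e1 e1 + dh y w e2 e2"
  proof -
    have "dd w (\<lambda>z. (g11 z * g22 z - g12 z * g12 z) *\<^sub>R \<eta> z) y
      = dd w (\<lambda>z. g22 z *\<^sub>R b11 z - 2 *\<^sub>R (g12 z *\<^sub>R b12 z) + g11 z *\<^sub>R b22 z) y"
      by (rule cong) (unfold g11_def g12_def g22_def b11_def b12_def b22_def X1_def X2_def, rule rel(5))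
    moreover have "dd w (\<lambda>z. (g11 z * g22 z - g12 z * g12 z) *\<^sub>R \<eta> z) y = dd w \<eta> y + (2 * m11 + 2 * m22) *\<^sub>R \<eta> y"
      unfolding dd_scaleR[OF det_diff d\<eta>] ddet gy by simp
    moreover have "dd w (\<lambda>z. g22 z *\<^sub>R b11 z - 2 *\<^sub>R (g12 z *\<^sub>R b12 z) + g11 z *\<^sub>R b22 z) y =
      dd w b11 y + (2 * m22) *\<^sub>R b11 y - 2 *\<^sub>R ((m12 + m21) *\<^sub>R b12 y) + (dd w b22 y + (2 * m11) *\<^sub>R b22 y)"
    proof -
      have 1: "(\<lambda>z. g22 z *\<^sub>R b11 z) differentiable (at y)" "(\<lambda>z. g12 z *\<^sub>R b12 z) differentiable (at y)" "(\<lambda>z. g11 z *\<^sub>R b22 z) differentiable (at y)"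
        "(\<lambda>z. 2 *\<^sub>R (g12 z *\<^sub>R b12 z)) differentiable (at y)"
        by (intro differentiable_scaleR dg db differentiable_const)+
      show ?thesis
        unfolding dd_add[OF differentiable_diff[OF 1(1,4)] 1(3)] dd_diff[OF 1(1,4)] dd_const_scaleR[OF 1(2)]
          dd_scaleR[OF dg(3) db(1)] dd_scaleR[OF dg(2) db(2)] dd_scaleR[OF dg(1) db(3)] gy g' by simp
    qed
    ultimately have "normal_proj y (dd w \<eta> y + (2 * m11 + 2 * m22) *\<^sub>R \<eta> y) =
      normal_proj y (dd w b11 y + (2 * m22) *\<^sub>R b11 y - 2 *\<^sub>R ((m12 + m21) *\<^sub>R b12 y) + (dd w b22 y + (2 * m11) *\<^sub>R b22 y))"
      by simp
    moreover have "normal_proj y (b11 y) = b11 y" "normal_proj y (b12 y) = b12 y" "normal_proj y (b22 y) = b22 y"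
      unfolding b11_def b12_def b22_def by (rule Nh)+
    ultimately have eq: "ndd w + (2 * m11 + 2 * m22) *\<^sub>R \<eta> y =
      normal_proj y (dd w b11 y) + (2 * m22) *\<^sub>R b11 y - 2 *\<^sub>R ((m12 + m21) *\<^sub>R b12 y) + (normal_proj y (dd w b22 y) + (2 * m11) *\<^sub>R b22 y)"
      by (simp only: Ns N\<eta>)
    then have D: "ndd w = normal_proj y (dd w b11 y) + (2 * m22) *\<^sub>R b11 y - 2 *\<^sub>R ((m12 + m21) *\<^sub>R b12 y) + (normal_proj y (dd w b22 y) + (2 * m11) *\<^sub>R b22 y) - (2 * m11 + 2 * m22) *\<^sub>R \<eta> y"
      by (metis add_diff_cancel_right')
    show ?thesis unfolding D b' b_y
      by (rule euclidean_eqI) (simp add: inner_add_left inner_diff_left field_simps)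
  qed
  show "dh y w e1 e1 \<bullet> ((1/2) *\<^sub>R \<eta> y - p) + ((1/2) *\<^sub>R \<eta> y + p) \<bullet> dh y w e2 e2 - 2 * (q \<bullet> dh y w e1 e2)
      = - sqrt (3 * real DIM('a) - 8) * (ndd w \<bullet> \<eta> y)"
  proof -
    let ?s = "sqrt (3 * real DIM('a) - 8)"
    have "dd w (\<lambda>z. b11 z \<bullet> b22 z - b12 z \<bullet> b12 z) y =
      dd w (\<lambda>z. (- ?s / 2) * ((\<eta> z \<bullet> \<eta> z) * (g11 z * g22 z - g12 z * g12 z))) y"
      by (rule cong) (unfold g11_def g12_def g22_def b11_def b12_def b22_def X1_def X2_def, rule rel(6))
    also have "\<dots> = (- ?s / 2) * (L * (2 * m11 + 2 * m22) + 2 * (ndd w \<bullet> \<eta> y))"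
      unfolding dd_const_mult[OF differentiable_mult[OF diffL det_diff]] dd_mult[OF diffL det_diff] ddet dL gy L_def by simp
    also have "dd w (\<lambda>z. b11 z \<bullet> b22 z - b12 z \<bullet> b12 z) y =
       normal_proj y (dd w b11 y) \<bullet> b22 y + b11 y \<bullet> normal_proj y (dd w b22 y) - 2 * (b12 y \<bullet> normal_proj y (dd w b12 y))"
    proof -
      have n: "b11 y \<bullet> dd w f y = 0" "b12 y \<bullet> dd w f y = 0" "b22 y \<bullet> dd w f y = 0" for w
        unfolding b11_def b12_def b22_def by (rule normal_h[OF y])+
      have "(\<lambda>z. b11 z \<bullet> b22 z) differentiable (at y)" "(\<lambda>z. b12 z \<bullet> b12 z) differentiable (at y)"
        using db unfolding differentiable_def by (blast intro: has_derivative_inner)+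
      then show ?thesis
        by (simp add: dd_diff dd_inner_normal[OF y db(1) db(3) n(1,3)] dd_inner_normal[OF y db(2) db(2) n(2,2)] inner_commute)
    qed
    finally have e: "normal_proj y (dd w b11 y) \<bullet> b22 y + b11 y \<bullet> normal_proj y (dd w b22 y) - 2 * (b12 y \<bullet> normal_proj y (dd w b12 y))
       = (- ?s / 2) * (L * (2 * m11 + 2 * m22) + 2 * (ndd w \<bullet> \<eta> y))" .
    have pq: "p \<bullet> p = (1 + 2 * ?s) / 4 * L - q \<bullet> q" using shape_pq[OF y shape] by (simp add: L_def)
    show ?thesis using e orth unfolding b' b_y
      by (simp add: inner_add_left inner_add_right inner_diff_left inner_diff_right inner_commute pq L_def[symmetric] field_simps)
  qed
qed

end

end

section \<open>The local product structure\<close>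

context chen_weakly_einstein_patch
begin

lemma unit_umbilic_vector:
  assumes y: "y \<in> S" and sh: "chen_shape y e1 e2 p q"
  obtains v where "G y v v = 1" "G y v e1 = 0" "G y v e2 = 0"
proof -
  have 12: "i \<in> {1..2::nat} \<longleftrightarrow> i = 1 \<or> i = 2" for i by auto
  let ?d = "\<lambda>i::nat. if i = 1 then e1 else e2"
  have o: "orthonormal_upto (G y) 2 ?d"
    using shape_G[OF y sh] unfolding orthonormal_upto_def 12 by auto
  have "2 < DIM('a)" using dim by simp
  from orthonormal_upto_orthogonal_vector[OF inner_form_G[OF y] o this] obtain v where
    v: "G y v v = 1" "\<And>i. i \<in> {1..2} \<Longrightarrow> G y v (?d i) = 0" by blast
  show ?thesis by (rule that[OF v(1)]) (use v(2)[of 1] v(2)[of 2] in auto)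
qed

text \<open>A unit vector u in D has h u u = \<eta>, and differentiating this gives dh w u u as the
  normal derivative of \<eta>. Symmetry of \<open>dh\<close> turns it into dh u w u for w in E; for
  w = u it lets dh u e_i e_j be computed along e_i or along e_j. The two algebraic lemmas then
  settle the directions e1, e2 and u.\<close>

lemma normal_dd_\<eta>:
  assumes "y \<in> \<Omega>"
  shows "normal_proj y (dd w \<eta> y) = 0"
proof -
  have y: "y \<in> S" and ny: "\<eta> y \<noteq> 0" using assms by auto
  obtain e1 e2 p q where sh: "chen_shape y e1 e2 p q" using shape_cases[OF y] ny by blast
  note o = shape_G[OF y sh] and gs = G_simps[OF y sh]
  let ?s = "sqrt (3 * real DIM('a) - 8)"
  have s: "?s > 0" using dim by simp
  have L: "\<eta> y \<bullet> \<eta> y > 0" using ny by simp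
  have pq: "p \<bullet> p + q \<bullet> q \<noteq> \<eta> y \<bullet> \<eta> y / 4"
    using s L unfolding shape_pq[OF y sh] by (simp add: field_simps)
  have D: "linear (\<lambda>w. dd w \<eta> y)" by (rule linear_dd[OF smooth_onD(1)[OF smooth_\<eta> y]])
  note N = linear_normal_proj[OF y]
  have Nlin: "normal_proj y (dd (a + b) \<eta> y) = normal_proj y (dd a \<eta> y) + normal_proj y (dd b \<eta> y)"
    "normal_proj y (dd (r *\<^sub>R a) \<eta> y) = r *\<^sub>R normal_proj y (dd a \<eta> y)" for a b r
    by (simp_all add: linear_add[OF D] linear_cmul[OF D] linear_add[OF N] linear_cmul[OF N])
  have zero: "normal_proj y (dd e1 \<eta> y) = 0" "normal_proj y (dd e2 \<eta> y) = 0" "normal_proj y (dd u \<eta> y) = 0"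
    if u: "G y u u = 1" "G y u e1 = 0" "G y u e2 = 0" for u
  proof -
    note F = first_order_relations[OF y ny sh u]
    have sym: "dh y a b c = dh y b a c" "dh y a b c = dh y a c b" for a b c using dh_sym[OF y] by blast+
    have p1: "normal_proj y (dd e1 \<eta> y) = G y (cov y u (umbilic_field ((2 / (\<eta> y \<bullet> \<eta> y)) *\<^sub>R u))) e1 *\<^sub>R ((1/2) *\<^sub>R \<eta> y - p)
         - G y (cov y u (umbilic_field ((2 / (\<eta> y \<bullet> \<eta> y)) *\<^sub>R u))) e2 *\<^sub>R q"
        unfolding F(3)[of e1, symmetric] sym(1)[of e1 u u] by (rule F(1))
    have p2: "normal_proj y (dd e2 \<eta> y) = G y (cov y u (umbilic_field ((2 / (\<eta> y \<bullet> \<eta> y)) *\<^sub>R u))) e2 *\<^sub>R ((1/2) *\<^sub>R \<eta> y + p)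
         - G y (cov y u (umbilic_field ((2 / (\<eta> y \<bullet> \<eta> y)) *\<^sub>R u))) e1 *\<^sub>R q"
        unfolding F(3)[of e2, symmetric] sym(1)[of e2 u u] by (rule F(2))
    have p3: "dh y e1 e2 e2 \<bullet> \<eta> y = normal_proj y (dd e1 \<eta> y) \<bullet> \<eta> y / 2 + p \<bullet> normal_proj y (dd e1 \<eta> y)" by (rule F(5))
    have p4: "dh y e1 e2 e2 \<bullet> \<eta> y = - (q \<bullet> normal_proj y (dd e2 \<eta> y))" unfolding sym(1)[of e1 e2] by (rule F(6))
    have p5: "dh y e2 e1 e1 \<bullet> \<eta> y = normal_proj y (dd e2 \<eta> y) \<bullet> \<eta> y / 2 - p \<bullet> normal_proj y (dd e2 \<eta> y)" by (rule F(4))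
    have p6: "dh y e2 e1 e1 \<bullet> \<eta> y = - (q \<bullet> normal_proj y (dd e1 \<eta> y))" unfolding sym(1)[of e2 e1] sym(2)[of e1 e2 e1] by (rule F(6))
    show "normal_proj y (dd e1 \<eta> y) = 0" "normal_proj y (dd e2 \<eta> y) = 0"
      by (rule codazzi_algebra_plane[OF shape_orth[OF y sh] pq p1 p2 p3 p4 p5 p6])+
    have r: "dh y u a b = dh y a b u" for a b using sym by metis
    show "normal_proj y (dd u \<eta> y) = 0"
    proof (rule codazzi_algebra_orthogonal[OF shape_orth[OF y sh] shape_pq[OF y sh] s ny])
      show "dh y u e1 e1 = G y (cov y e1 (umbilic_field ((2 / (\<eta> y \<bullet> \<eta> y)) *\<^sub>R u))) e1 *\<^sub>R ((1/2) *\<^sub>R \<eta> y - p)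
         - G y (cov y e1 (umbilic_field ((2 / (\<eta> y \<bullet> \<eta> y)) *\<^sub>R u))) e2 *\<^sub>R q"
        unfolding r[of e1 e1] by (rule F(1))
      show "dh y u e1 e2 = G y (cov y e1 (umbilic_field ((2 / (\<eta> y \<bullet> \<eta> y)) *\<^sub>R u))) e2 *\<^sub>R ((1/2) *\<^sub>R \<eta> y + p)
         - G y (cov y e1 (umbilic_field ((2 / (\<eta> y \<bullet> \<eta> y)) *\<^sub>R u))) e1 *\<^sub>R q"
        unfolding r[of e1 e2] by (rule F(2))
      show "dh y u e1 e2 = G y (cov y e2 (umbilic_field ((2 / (\<eta> y \<bullet> \<eta> y)) *\<^sub>R u))) e1 *\<^sub>R ((1/2) *\<^sub>R \<eta> y - p)
         - G y (cov y e2 (umbilic_field ((2 / (\<eta> y \<bullet> \<eta> y)) *\<^sub>R u))) e2 *\<^sub>R q"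
        unfolding sym(2)[of u e1 e2] r[of e2 e1] by (rule F(1))
      show "dh y u e2 e2 = G y (cov y e2 (umbilic_field ((2 / (\<eta> y \<bullet> \<eta> y)) *\<^sub>R u))) e2 *\<^sub>R ((1/2) *\<^sub>R \<eta> y + p)
         - G y (cov y e2 (umbilic_field ((2 / (\<eta> y \<bullet> \<eta> y)) *\<^sub>R u))) e1 *\<^sub>R q"
        unfolding r[of e2 e2] by (rule F(2))
    qed (rule F(7) F(4) F(6) F(8))+
  qed
  \<comment> \<open>Even along e1 and e2 the relations involve a unit vector of D, which exists
    because the dimension is at least 3.\<close>
  obtain v where v: "G y v v = 1" "G y v e1 = 0" "G y v e2 = 0" using unit_umbilic_vector[OF y sh] .
  note z12 = zero(1,2)[OF v]
  define r where "r = w - G y w e1 *\<^sub>R e1 - G y w e2 *\<^sub>R e2"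
  have r12: "G y r e1 = 0" "G y r e2 = 0" unfolding r_def by (simp_all add: gs o)
  have "normal_proj y (dd r \<eta> y) = 0"
  proof (cases "r = 0")
    case True
    then show ?thesis using Nlin(2)[of 0 0] by simp
  next
    case False
    then have "G y r r > 0" by (rule inner_formD(4)[OF inner_form_G[OF y]])
    then have "G y ((1 / sqrt (G y r r)) *\<^sub>R r) ((1 / sqrt (G y r r)) *\<^sub>R r) = 1" by (simp only: gs) simp
    moreover have "G y ((1 / sqrt (G y r r)) *\<^sub>R r) e1 = 0" "G y ((1 / sqrt (G y r r)) *\<^sub>R r) e2 = 0"
      by (simp_all only: gs r12) simp_all
    ultimately have "normal_proj y (dd ((1 / sqrt (G y r r)) *\<^sub>R r) \<eta> y) = 0" by (rule zero(3))
    then show ?thesis using \<open>G y r r > 0\<close> unfolding Nlin(2) by simp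
  qed
  moreover have "w = r + (G y w e1 *\<^sub>R e1 + G y w e2 *\<^sub>R e2)" by (simp add: r_def)
  then have "normal_proj y (dd w \<eta> y) = normal_proj y (dd (r + (G y w e1 *\<^sub>R e1 + G y w e2 *\<^sub>R e2)) \<eta> y)"
    by (rule arg_cong)
  ultimately show ?thesis by (simp only: Nlin z12) simp
qed

text \<open>The Weingarten formula; its normal part vanishes because \<eta> is parallel in the
  normal bundle.\<close>

lemma dd_\<eta>:
  assumes "y \<in> \<Omega>"
  shows "dd w \<eta> y = - dd (mean_shape y w) f y"
proof -
  have y: "y \<in> S" using assms by simp
  note L = linear_dd_f(1)[OF y] and N = linear_normal_proj[OF y]
  have d\<eta>: "\<eta> differentiable (at y)" by (rule smooth_onD(1)[OF smooth_\<eta> y])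
  let ?t = "dd w \<eta> y + dd (mean_shape y w) f y"
  have "?t \<bullet> dd v f y = 0" for v
  proof -
    have "dd w (\<lambda>z. \<eta> z \<bullet> dd v f z) y = dd w (\<lambda>z. 0) y"
      by (rule dd_cong_open[OF open_S y normal_\<eta>])
    also have "\<dots> = 0" by (simp add: dd_def)
    finally have "\<eta> y \<bullet> dd w (dd v f) y + dd w \<eta> y \<bullet> dd v f y = 0"
      unfolding dd_inner[OF d\<eta> diff_dd(2)[OF y]] .
    moreover have "\<eta> y \<bullet> dd w (dd v f) y = \<eta> y \<bullet> h y w v"
      using inner_normal_proj[OF normal_\<eta>[OF y], of "dd w (dd v f) y"] by (simp add: normal_proj_dd_dd[OF y])
    ultimately show ?thesis unfolding inner_add_left using G_mean_shape[OF y, of w v] by (simp add: G_eq inner_commute)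
  qed
  then have "normal_proj y ?t = ?t" by (rule normal_proj_id[OF y])
  moreover have "normal_proj y ?t = 0"
    unfolding linear_add[OF N] normal_dd_\<eta>[OF assms] normal_proj_dd[OF y] by simp
  ultimately show ?thesis by (simp add: eq_neg_iff_add_eq_0)
qed

text \<open>In the derivative of the Weingarten formula the derivative of \<open>mean_shape\<close>
  contributes only a tangential term.\<close>

lemma normal_dd_dd_\<eta>:
  assumes "y \<in> \<Omega>"
  shows "normal_proj y (dd w (dd u \<eta>) y) = - h y w (mean_shape y u)"
proof -
  have y: "y \<in> S" using assms by simp
  note N = linear_normal_proj[OF y]
  have dm: "(\<lambda>z. mean_shape z u) differentiable (at y)" by (rule smooth_onD(1)[OF smooth_mean_shape y])
  note la = dd_linear_arg[of y "\<lambda>z a. dd a f z", OF y linear_dd_f(1) diff_dd(2)[OF y] dm]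
  have "dd w (dd u \<eta>) y = dd w (\<lambda>z. (-1) *\<^sub>R dd (mean_shape z u) f z) y"
    by (rule dd_cong_open[OF open_\<Omega> assms]) (simp add: dd_\<eta>)
  also have "\<dots> = (-1) *\<^sub>R dd w (\<lambda>z. dd (mean_shape z u) f z) y"
    using la(1) by (intro dd_const_scaleR) (blast intro: differentiableI)
  also have "dd w (\<lambda>z. dd (mean_shape z u) f z) y = dd w (dd (mean_shape y u) f) y + dd (dd w (\<lambda>z. mean_shape z u) y) f y"
    by (rule la(2))
  finally have "dd w (dd u \<eta>) y = (-1) *\<^sub>R (dd w (dd (mean_shape y u) f) y + dd (dd w (\<lambda>z. mean_shape z u) y) f y)" .
  then show ?thesis
    by (simp only: linear_cmul[OF N] linear_add[OF N] normal_proj_dd[OF y] normal_proj_dd_dd[OF y]) simp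
qed

text \<open>The splitting is used only through derivatives up to third order at y. Orthogonality of
  dR and dQ together with the symmetry of second derivatives makes D^2 R orthogonal to dQ and dR
  orthogonal to D^2 Q; one further derivative allows D^2 R (e1, e1) . D^2 Q (u, u) to be
  evaluated.\<close>

lemma \<eta>_zero:
  assumes "y \<in> S" shows "\<eta> y = 0"
proof (rule ccontr)
  assume ny: "\<eta> y \<noteq> 0"
  then have y\<Omega>: "y \<in> \<Omega>" using assms by simp
  note y = assms
  \<comment> \<open>A ball, because constancy of |\<eta>|^2 is deduced from a vanishing derivative
    on a convex set.\<close>
  then obtain d where d: "d > 0" "ball y d \<subseteq> \<Omega>" using open_contains_ball[of \<Omega>] open_\<Omega> y\<Omega> by blast
  define B where "B = ball y d"
  have B: "open B" "y \<in> B" "B \<subseteq> \<Omega>" "convex B" using d by (auto simp: B_def)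
  have BS: "B \<subseteq> S" using B(3) by auto
  define L where "L = \<eta> y \<bullet> \<eta> y"
  have L: "L > 0" using ny by (simp add: L_def)
  have const: "\<eta> z \<bullet> \<eta> z = L" if "z \<in> B" for z
    unfolding L_def
  proof (rule has_derivative_zero_unique[OF B(4) _ that B(2)])
    fix x assume x: "x \<in> B"
    then have x\<Omega>: "x \<in> \<Omega>" and xS: "x \<in> S" using B(3) by auto
    have d\<eta>: "\<eta> differentiable (at x)" by (rule smooth_onD(1)[OF smooth_\<eta> xS])
    have "((\<lambda>z. \<eta> z \<bullet> \<eta> z) has_derivative (\<lambda>w. \<eta> x \<bullet> dd w \<eta> x + dd w \<eta> x \<bullet> \<eta> x)) (at x)"
      by (intro has_derivative_inner dd_works d\<eta>)
    then have "((\<lambda>z. \<eta> z \<bullet> \<eta> z) has_derivative (\<lambda>w. 0)) (at x)"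
      using normal_\<eta>[OF xS] by (simp add: dd_\<eta>[OF x\<Omega>] inner_commute)
    then show "((\<lambda>z. \<eta> z \<bullet> \<eta> z) has_derivative (\<lambda>w. 0)) (at x within B)" by (rule has_derivative_at_withinI)
  qed
  \<comment> \<open>\<open>Q\<close> and \<open>R\<close> are constant along the two eigendistributions respectively; they are the factors of the local
    product structure of the immersion.\<close>
  define Q R where "Q = (\<lambda>z. \<eta> z + (L / 2) *\<^sub>R f z)" and "R = (\<lambda>z. \<eta> z + L *\<^sub>R f z)"
  have sQ: "smooth_map_on B Q" and sR: "smooth_map_on B R"
    unfolding Q_def R_def by (rule smooth_on_subset[OF _ BS];
      intro smooth_on_add smooth_on_scaleR smooth_on_const smooth_\<eta> smooth_f open_S)+
  note sD = smooth_onD(2)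
  note df = smooth_onD(1)
  have first: "\<exists>e1 e2 p q. chen_shape z e1 e2 p q \<and>
      (\<forall>u. dd u R z = (L / 2) *\<^sub>R dd (G z u e1 *\<^sub>R e1 + G z u e2 *\<^sub>R e2) f z) \<and>
      (\<forall>u. dd u Q z = - (L / 2) *\<^sub>R dd (u - (G z u e1 *\<^sub>R e1 + G z u e2 *\<^sub>R e2)) f z)"
    if "z \<in> B" for z
  proof -
    have z\<Omega>: "z \<in> \<Omega>" and z: "z \<in> S" and nz: "\<eta> z \<noteq> 0" using that B(3) by auto
    obtain e1 e2 p q where sh: "chen_shape z e1 e2 p q" using shape_cases[OF z] nz by blast
    note lf = linear_dd_f(1)[OF z]
    note lin = linear_add[OF lf] linear_diff[OF lf] linear_cmul[OF lf]
    have "dd u Q z = dd u \<eta> z + (L / 2) *\<^sub>R dd u f z" "dd u R z = dd u \<eta> z + L *\<^sub>R dd u f z" for u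
      unfolding Q_def R_def
      by (intro dd_eqI has_derivative_add has_derivative_scaleR_right dd_works df[OF smooth_\<eta> z] df[OF smooth_f z])+
    note D = this[unfolded dd_\<eta>[OF z\<Omega>] mean_shape_eq[OF z sh] const[OF that] lin]
    have "dd u Q z = - (L / 2) *\<^sub>R dd (u - (G z u e1 *\<^sub>R e1 + G z u e2 *\<^sub>R e2)) f z"
      "dd u R z = (L / 2) *\<^sub>R dd (G z u e1 *\<^sub>R e1 + G z u e2 *\<^sub>R e2) f z" for u
      unfolding D lin by (rule euclidean_eqI, simp add: inner_add_left inner_diff_left field_simps)+
    with sh show ?thesis by blast
  qed
  have second: "dd w (dd u R) z \<bullet> dd v Q z = 0" "dd u R z \<bullet> dd w (dd v Q) z = 0" if z: "z \<in> B" for z u v w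
  proof -
    have zS: "z \<in> S" using z BS by auto
    obtain e1 e2 p q where sh: "chen_shape z e1 e2 p q"
      and R1: "\<And>u. dd u R z = (L / 2) *\<^sub>R dd (G z u e1 *\<^sub>R e1 + G z u e2 *\<^sub>R e2) f z"
      and Q1: "\<And>u. dd u Q z = - (L / 2) *\<^sub>R dd (u - (G z u e1 *\<^sub>R e1 + G z u e2 *\<^sub>R e2)) f z"
      using first[OF z] by blast
    note gs = G_simps[OF zS sh] and o = shape_G[OF zS sh]
    have prod: "dd u R x \<bullet> dd v Q x = 0" if x: "x \<in> B" for x u v
    proof -
      have xS: "x \<in> S" using x BS by auto
      obtain e1 e2 p q where shx: "chen_shape x e1 e2 p q"
        and Rx: "dd u R x = (L / 2) *\<^sub>R dd (G x u e1 *\<^sub>R e1 + G x u e2 *\<^sub>R e2) f x"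
        and Qx: "dd v Q x = - (L / 2) *\<^sub>R dd (v - (G x v e1 *\<^sub>R e1 + G x v e2 *\<^sub>R e2)) f x"
        using first[OF x] by blast
      have "G x (G x u e1 *\<^sub>R e1 + G x u e2 *\<^sub>R e2) (v - (G x v e1 *\<^sub>R e1 + G x v e2 *\<^sub>R e2)) = 0"
        by (simp add: G_simps[OF xS shx] shape_G[OF xS shx] G_sym[OF xS, of e1 v] G_sym[OF xS, of e2 v])
      then show ?thesis unfolding Rx Qx by (simp add: G_eq)
    qed
    have leib: "dd u R z \<bullet> dd w (dd v Q) z + dd w (dd u R) z \<bullet> dd v Q z = 0" for u v w
    proof -
      have "dd w (\<lambda>x. dd u R x \<bullet> dd v Q x) z = dd w (\<lambda>x. 0) z"
        by (rule dd_cong_open[OF B(1) z prod])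
      then show ?thesis unfolding dd_inner[OF df[OF sD[OF sR] z] df[OF sD[OF sQ] z]] by (simp add: dd_def)
    qed
    have sym: "dd a (dd b R) z = dd b (dd a R) z" "dd a (dd b Q) z = dd b (dd a Q) z" for a b
      using dd_commute[OF B(1) z] sR sQ by blast+
    \<comment> \<open>With \<open>sym\<close>, the trilinear form D^2 R (a, b) . dQ c is totally
      symmetric. Its slot c sees only the D-component; moved into a slot of R, that component is
      annihilated by dR after one use of \<open>leib\<close>.\<close>
    have tot: "dd a (dd b R) z \<bullet> dd c Q z = dd a (dd c R) z \<bullet> dd b Q z" for a b c
      using leib[of a b c] leib[of a c b] sym by (simp add: inner_commute)
    let ?\<pi> = "G z v e1 *\<^sub>R e1 + G z v e2 *\<^sub>R e2"
    have lQ: "linear (\<lambda>v. dd v Q z)" by (rule linear_dd[OF df[OF sQ z]])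
    have "dd ?\<pi> Q z = 0"
      unfolding Q1 by (simp add: gs o linear_0[OF linear_dd_f(1)[OF zS]])
    then have "dd v Q z = dd (v - ?\<pi>) Q z" by (simp add: linear_diff[OF lQ])
    then have "dd w (dd u R) z \<bullet> dd v Q z = dd w (dd (v - ?\<pi>) R) z \<bullet> dd u Q z"
      using tot[of w u "v - ?\<pi>"] by simp
    also have "\<dots> = - (dd (v - ?\<pi>) R z \<bullet> dd w (dd u Q) z)" using leib[of "v - ?\<pi>" w u] by linarith
    also have "dd (v - ?\<pi>) R z = 0"
      unfolding R1 by (simp add: gs o linear_0[OF linear_dd_f(1)[OF zS]])
    finally show *: "dd w (dd u R) z \<bullet> dd v Q z = 0" by simp
    show "dd u R z \<bullet> dd w (dd v Q) z = 0" using leib[of u w v] * by linarith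
  qed
  have third: "dd w (dd u R) y \<bullet> dd x (dd v Q) y = - (dd x (dd w (dd u R)) y \<bullet> dd v Q y)"
    "dd x (dd u R) y \<bullet> dd w (dd v Q) y = - (dd u R y \<bullet> dd x (dd w (dd v Q)) y)" for u v w x
  proof -
    have "dd x (\<lambda>z. dd w (dd u R) z \<bullet> dd v Q z) y = dd x (\<lambda>z. 0) y"
      "dd x (\<lambda>z. dd u R z \<bullet> dd w (dd v Q) z) y = dd x (\<lambda>z. 0) y"
      by (rule dd_cong_open[OF B(1,2)]; rule second; assumption)+
    then show "dd w (dd u R) y \<bullet> dd x (dd v Q) y = - (dd x (dd w (dd u R)) y \<bullet> dd v Q y)"
      "dd x (dd u R) y \<bullet> dd w (dd v Q) y = - (dd u R y \<bullet> dd x (dd w (dd v Q)) y)"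
      unfolding dd_inner[OF df[OF sD[OF sD[OF sR]] B(2)] df[OF sD[OF sQ] B(2)]]
        dd_inner[OF df[OF sD[OF sR] B(2)] df[OF sD[OF sD[OF sQ]] B(2)]]
      by (simp_all add: dd_def eq_neg_iff_add_eq_0 add.commute)
  qed
  obtain e1 e2 p q where sh: "chen_shape y e1 e2 p q"
    and R1: "\<And>u. dd u R y = (L / 2) *\<^sub>R dd (G y u e1 *\<^sub>R e1 + G y u e2 *\<^sub>R e2) f y"
    and Q1: "\<And>u. dd u Q y = - (L / 2) *\<^sub>R dd (u - (G y u e1 *\<^sub>R e1 + G y u e2 *\<^sub>R e2)) f y"
    using first[OF B(2)] by blast
  note gs = G_simps[OF y sh] and o = shape_G[OF y sh]
  obtain u where u: "G y u u = 1" "G y u e1 = 0" "G y u e2 = 0" using unit_umbilic_vector[OF y sh] .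
  have sym3: "dd u (dd e1 (dd e1 R)) y = dd e1 (dd e1 (dd u R)) y"
  proof -
    have "dd u (dd e1 (dd e1 R)) y = dd e1 (dd u (dd e1 R)) y" by (rule dd_commute[OF B(1,2) sD[OF sR]])
    also have "\<dots> = dd e1 (dd e1 (dd u R)) y"
      by (rule dd_cong_open[OF B(1,2)]) (rule dd_commute[OF B(1) _ sR])
    finally show ?thesis .
  qed
  have Ru: "dd u R y = 0" unfolding R1 u by (simp add: linear_0[OF linear_dd_f(1)[OF y]])
  \<comment> \<open>A derivative is moved from Q to R, the third derivative of R is reordered, and a
    derivative along e1 is moved back. This yields D^2 R (e1, u) . D^2 Q (e1, u), which vanishes
    because dR u = 0.\<close>
  have "dd e1 (dd e1 R) y \<bullet> dd u (dd u Q) y = - (dd u (dd e1 (dd e1 R)) y \<bullet> dd u Q y)" by (rule third(1))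
  also have "\<dots> = dd e1 (dd u R) y \<bullet> dd e1 (dd u Q) y" unfolding sym3 by (rule third(1)[symmetric])
  also have "\<dots> = 0" unfolding third(2) Ru by simp
  finally have orth: "dd e1 (dd e1 R) y \<bullet> dd u (dd u Q) y = 0" .
  note N = linear_normal_proj[OF y]
  have ddQ: "dd a (dd b Q) y = dd a (dd b \<eta>) y + (L / 2) *\<^sub>R dd a (dd b f) y"
    and ddR: "dd a (dd b R) y = dd a (dd b \<eta>) y + L *\<^sub>R dd a (dd b f) y" for a b
  proof -
    have 1: "dd b Q z = dd b \<eta> z + (L / 2) *\<^sub>R dd b f z" "dd b R z = dd b \<eta> z + L *\<^sub>R dd b f z" if "z \<in> S" for z
      unfolding Q_def R_def
      by (intro dd_eqI has_derivative_add has_derivative_scaleR_right dd_works df[OF smooth_\<eta> that] df[OF smooth_f that])+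
    have "dd a (dd b Q) y = dd a (\<lambda>z. dd b \<eta> z + (L / 2) *\<^sub>R dd b f z) y"
      "dd a (dd b R) y = dd a (\<lambda>z. dd b \<eta> z + L *\<^sub>R dd b f z) y"
      by (rule dd_cong_open[OF open_S y]; rule 1; assumption)+
    moreover have "dd a (\<lambda>z. dd b \<eta> z + c *\<^sub>R dd b f z) y = dd a (dd b \<eta>) y + c *\<^sub>R dd a (dd b f) y" for c
      by (intro dd_eqI has_derivative_add has_derivative_scaleR_right dd_works df[OF sD[OF smooth_\<eta>] y] df[OF sD[OF smooth_f] y])
    ultimately show "dd a (dd b Q) y = dd a (dd b \<eta>) y + (L / 2) *\<^sub>R dd a (dd b f) y"
      "dd a (dd b R) y = dd a (dd b \<eta>) y + L *\<^sub>R dd a (dd b f) y" by simp_all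
  qed
  have ms: "mean_shape y u = L *\<^sub>R u" "mean_shape y e1 = (L / 2) *\<^sub>R e1"
    unfolding mean_shape_eq[OF y sh] u o L_def[symmetric]
    by (simp_all add: algebra_simps) (simp add: scaleR_add_left[symmetric])
  have NQ: "normal_proj y (dd u (dd u Q) y) = - (L / 2) *\<^sub>R \<eta> y"
    unfolding ddQ linear_add[OF N] linear_cmul[OF N] normal_dd_dd_\<eta>[OF y\<Omega>] normal_proj_dd_dd[OF y] ms
      linear_cmul[OF linear_h(2)[OF y]] h_umbilic(1)[OF y sh u(2,3)] u(1)
    by (rule euclidean_eqI) (simp add: inner_add_left inner_diff_left field_simps)
  \<comment> \<open>The tangential part of D^2 Q (u, u) does not contribute: orthogonality to dR
    puts t in D, where df t is a multiple of dQ t, and D^2 R is orthogonal to dQ.\<close>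
  obtain t where t: "dd u (dd u Q) y = - (L / 2) *\<^sub>R \<eta> y + dd t f y"
    using NQ unfolding normal_proj_def by (metis diff_add_cancel)
  let ?\<pi> = "G y t e1 *\<^sub>R e1 + G y t e2 *\<^sub>R e2"
  have "0 = dd t R y \<bullet> dd u (dd u Q) y" using second(2)[OF B(2)] by simp
  also have "\<dots> = L / 2 * G y ?\<pi> t"
    unfolding R1 t by (simp add: inner_add_right inner_diff_right normal_\<eta>[OF y] inner_commute[of _ "\<eta> y"] G_eq)
  also have "G y ?\<pi> t = G y ?\<pi> ?\<pi>" by (simp add: gs o G_sym[OF y, of e1 t] G_sym[OF y, of e2 t])
  finally have "G y ?\<pi> ?\<pi> = 0" using L by simp
  then have "?\<pi> = 0" using inner_formD(4)[OF inner_form_G[OF y], of ?\<pi>] by force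
  then have "dd t Q y = - (L / 2) *\<^sub>R dd t f y" unfolding Q1 by simp
  moreover have "dd e1 (dd e1 R) y \<bullet> dd t Q y = 0" by (rule second(1)[OF B(2)])
  ultimately have "dd e1 (dd e1 R) y \<bullet> dd t f y = 0" using L by simp
  then have "\<eta> y \<bullet> dd e1 (dd e1 R) y = 0" using orth L unfolding t by (simp add: inner_add_right inner_diff_right inner_commute)
  then have "\<eta> y \<bullet> normal_proj y (dd e1 (dd e1 R) y) = 0"
    using inner_normal_proj[of "\<eta> y" y "dd e1 (dd e1 R) y", OF normal_\<eta>[OF y]] by simp
  moreover have "normal_proj y (dd e1 (dd e1 R) y) = (L / 2) *\<^sub>R h y e1 e1"
    unfolding ddR linear_add[OF N] linear_cmul[OF N] normal_dd_dd_\<eta>[OF y\<Omega>] normal_proj_dd_dd[OF y] ms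
      linear_cmul[OF linear_h(2)[OF y]]
    by (rule euclidean_eqI) (simp add: inner_add_left inner_diff_left field_simps)
  \<comment> \<open>This is the sectional curvature of the plane spanned by e1 and u, since h u u =
    \<eta> and h e1 u = 0.\<close>
  moreover have "\<eta> y \<bullet> h y e1 e1 = L / 2"
    unfolding shape_h[OF y sh] o using shape_orth[OF y sh] by (simp add: inner_add_right inner_commute L_def)
  ultimately show False using L by simp
qed

lemma flat_at_patch:
  assumes "y \<in> S" shows "flat_at (induced_metric f) y"
  using shape_cases[OF assms] \<eta>_zero[OF assms] flat_at_if_h_zero[OF assms] by blast

end

section \<open>From coordinate patches to the submanifold\<close>

lemma chen_weakly_einstein_imp_flat:
  fixes F :: "'m \<Rightarrow> 'b::euclidean_space" and \<A> :: "('m, 'a::euclidean_space) chart set"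
  assumes "DIM('a) \<ge> 3" "immersed_submanifold X \<A> F" "weakly_einstein \<A> F" "chen_equality \<A> F"
  shows "flat \<A> F"
  unfolding flat_def everywhere_def
proof clarify
  fix U \<phi> x assume A: "(U, \<phi>) \<in> \<A>" and x: "x \<in> U"
  have op: "open (\<phi> ` U)" using assms(2) A unfolding immersed_submanifold_def smooth_atlas_def by blast
  have im: "smooth_map_on (\<phi> ` U) (in_chart F (U, \<phi>))"
    "\<forall>y\<in>\<phi> ` U. inj (frechet_derivative (in_chart F (U, \<phi>)) (at y))"
    using assms(2) A unfolding immersed_submanifold_def by blast+
  have we: "weakly_einstein_at (induced_metric (in_chart F (U, \<phi>))) y" if "y \<in> \<phi> ` U" for y
    using assms(3) A that unfolding weakly_einstein_def everywhere_def by blast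
  have ch: "chen_equality_at (in_chart F (U, \<phi>)) y" if "y \<in> \<phi> ` U" for y
    using assms(4) A that unfolding chen_equality_def everywhere_def by blast
  interpret chen_weakly_einstein_patch "in_chart F (U, \<phi>)" "\<phi> ` U"
    by unfold_locales (use op im we ch assms(1) in auto)
  show "flat_at (induced_metric (in_chart F (U, \<phi>))) (\<phi> x)" using x by (intro flat_at_patch) simp
qed

theorem theorem2p4:
  fixes X :: "'m topology"
    and \<A> :: "('m, 'a::euclidean_space) chart set"
    and F :: "'m \<Rightarrow> 'b::euclidean_space"
    and n p :: nat
  assumes "n \<ge> 3" and "p \<ge> 1"
    and "DIM('a) = n" and "DIM('b) = n + p"
    and "immersed_submanifold X \<A> F"
    and "weakly_einstein \<A> F"
    and "chen_equality \<A> F"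
  shows "(p = 1 \<longrightarrow> flat \<A> F) \<and>
         (p \<ge> 2 \<longrightarrow>
            flat \<A> F \<or>
            (normal_form_entries \<A> F (\<lambda>a b. a = b \<and> b \<noteq> 0) \<and>
             nonneg_ricci \<A> F \<and>
             (n = 4 \<longrightarrow>
                normal_form_entries \<A> F (\<lambda>a b. a = b \<and> (b = 1/2 \<or> b = - 1/2)) \<and>
                ricci_operator_rank \<A> F 2)))"
  using chen_weakly_einstein_imp_flat[of X \<A> F] assms by simp

end
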